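(* Let $Z\subset\mathbb R^d$ be a nonempty compact set, let functions $f_1:\mathbb R^d\times\mathbb R^s\to\mathbb R$ and $f_2:\mathbb R^d\times\mathbb R^m\to\mathbb R^s$ be given, and let $X$ be a random vector in $\mathbb R^m$ with probability distribution $P$ and domain $\mathcal X\subset\mathbb R^m$. Let $$\varrho=\min_{z\in Z}f_1\big(z,\mathbb E[f_2(z,X)]\big),\qquad \varrho^{(n)}=\min_{z\in Z}f_1\Big(z,\tfrac1n\sum_{i=1}^nf_2(z,X_i)\Big),$$ where $X_1,\dots,X_n$ is a random i.i.d. sample from $P$, and let $\hat Z$ be the set of optimal solutions $z\in Z$ of the minimization problem defining $\varrho$. Suppose the following conditions are satisfied: (i) the function $f_2(z,\cdot)$ is measurable for all $z\in Z$; (ii) the function $f_1(z,\cdot)$ is differentiable for all $z\in Z$, and both $f_1(\cdot,\cdot)$ and its derivative with respect to the second argument, $\nabla f_1(\cdot,\cdot)$, are continuous with respect to both arguments; (iii) an integrable function $\gamma(\cdot)$ exists such that $\|f_2(z',x)-f_2(z'',x)\|\le\gamma(x)\|z'-z''\|$ for all $z',z''\in Z$ and all $x\in\mathcal X$; moreover, $\int\gamma^2(x)\,P(dx)<\infty$. Then $$\sqrt n\,\big[\varrho^{(n)}-\varrho\big]\xrightarrow{\ \mathcal D\ }\min_{z\in\hat Z}\big\langle\nabla f_1\big(z,\mathbb E[f_2(z,X)]\big),W(z)\big\rangle\qquad(n\to\infty),$$ where $W(z)$ is a zero-mean Brownian process on $Z$ with the covariance function $$\mathrm{cov}[W(z'),W(z'')]=\int_{\mathcal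 X}\big(f_2(z',x)-\mathbb E[f_2(z',X)]\big)\big(f_2(z'',x)-\mathbb E[f_2(z'',X)]\big)^\top P(dx).$$
   Context: $\nabla f_1(z,\eta)$ denotes the gradient of $f_1$ with respect to its second argument $\eta\in\mathbb R^s$. A "zero-mean Brownian process on $Z$" means a zero-mean Gaussian process indexed by $Z$, with values in $\mathbb R^s$, with continuous sample paths and the stated covariance function. $\xrightarrow{\mathcal D}$ denotes convergence in distribution.
   Formalization: It is additionally assumed that E[f_2(z,X)] and the covariance integrals exist (finite second moments of f_2(z,X)) for all z in Z; (i)–(iii) do not imply this, and the claim fails without it, e.g. f_2(z,x)=x with X of infinite variance. *)

theory Defs
  imports "HOL-Probability.Probability"
begin

definition gradient :: "('a::real_inner \<Rightarrow> real) \<Rightarrow> 'a \<Rightarrow> 'a" where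
  "gradient f x = (THE D. GDERIV f x :> D)"

lemma gradient_eqI:
  assumes "GDERIV f x :> D"
  shows "gradient f x = D"
  unfolding gradient_def
proof (rule the_equality)
  fix E assume "GDERIV f x :> E"
  with assms have "(\<lambda>h. inner h D) = (\<lambda>h. inner h E)"
    unfolding gderiv_def by (rule has_derivative_unique)
  then have "inner (E - D) D = inner (E - D) E"
    by meson
  then have "inner (E - D) (E - D) = 0"
    by (simp add: inner_diff_right)
  then show "E = D" by simp
qed (rule assms)

lemma GDERIV_gradient:
  fixes f :: "'a::euclidean_space \<Rightarrow> real"
  assumes "f differentiable (at x)"
  shows "GDERIV f x :> gradient f x"
proof -
  obtain f' where f': "(f has_derivative f') (at x)"
    using assms by (auto simp: differentiable_def)
  then interpret linear f' by (rule has_derivative_linear)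
  have "f' = (\<lambda>h. inner h (adjoint f' 1))"
    using adjoint_works[OF linear_axioms, of _ 1] by (auto simp: fun_eq_iff)
  with f' have "GDERIV f x :> adjoint f' 1"
    unfolding gderiv_def by metis
  then show ?thesis
    using gradient_eqI by metis
qed

text \<open>
  The smallest value of \<open>f\<close> on \<open>S\<close>; unspecified when the minimum is not attained.
\<close>

definition min_value :: "('a \<Rightarrow> real) \<Rightarrow> 'a set \<Rightarrow> real" where
  "min_value f S = (LEAST y. y \<in> f ` S)"

lemma min_value_eqI:
  assumes "z \<in> S" "\<And>y. y \<in> S \<Longrightarrow> f z \<le> f y"
  shows "min_value f S = f z"
  unfolding min_value_def using assms by (intro Least_equality) auto

definition outer_product :: "real^'n \<Rightarrow> real^'m \<Rightarrow> real^'m^'n" where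
  "outer_product v w = (\<chi> i j. v $ i * w $ j)"

definition covariance_matrix ::
    "'a measure \<Rightarrow> ('a \<Rightarrow> real^'n) \<Rightarrow> ('a \<Rightarrow> real^'m) \<Rightarrow> real^'m^'n" where
  "covariance_matrix M U V =
    (LINT x|M. outer_product (U x - (LINT y|M. U y)) (V x - (LINT y|M. V y)))"

text \<open>Constants count as (degenerate) Gaussian random variables.\<close>

definition gaussian_variable :: "'a measure \<Rightarrow> ('a \<Rightarrow> real) \<Rightarrow> bool" where
  "gaussian_variable M Y \<longleftrightarrow> Y \<in> borel_measurable M \<and>
    ((\<exists>c. AE x in M. Y x = c) \<or>
     (\<exists>m \<sigma>. \<sigma> > 0 \<and> distributed M lborel Y (normal_density m \<sigma>)))"

text \<open>
  The finite-dimensional distributions are jointly Gaussian: every finite linear combination of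
  the coordinates of the \<open>W z\<close> is a Gaussian random variable.
\<close>

definition gaussian_process_on :: "'a measure \<Rightarrow> 'i set \<Rightarrow> ('i \<Rightarrow> 'a \<Rightarrow> real^'s) \<Rightarrow> bool" where
  "gaussian_process_on M Z W \<longleftrightarrow>
    (\<forall>z\<in>Z. W z \<in> borel_measurable M) \<and>
    (\<forall>F a. finite F \<longrightarrow> F \<subseteq> Z \<longrightarrow>
       gaussian_variable M (\<lambda>\<omega>. \<Sum>z\<in>F. inner (a z) (W z \<omega>)))"

definition zero_mean_brownian_process ::
    "'a measure \<Rightarrow> 'i::topological_space set \<Rightarrow> ('i \<Rightarrow> 'i \<Rightarrow> real^'s^'s)
      \<Rightarrow> ('i \<Rightarrow> 'a \<Rightarrow> real^'s) \<Rightarrow> bool" where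
  "zero_mean_brownian_process M Z K W \<longleftrightarrow>
    prob_space M \<and>
    gaussian_process_on M Z W \<and>
    (\<forall>z\<in>Z. (LINT \<omega>|M. W z \<omega>) = 0) \<and>
    (\<forall>z'\<in>Z. \<forall>z''\<in>Z. covariance_matrix M (W z') (W z'') = K z' z'') \<and>
    (\<forall>\<omega>\<in>space M. continuous_on Z (\<lambda>z. W z \<omega>))"

text \<open>
  The limit may live on another probability space. Measurability is part of the definition
  because \<^const>\<open>distr\<close> is meaningless for functions that are not measurable.
\<close>

definition converges_in_distribution ::
    "'a measure \<Rightarrow> (nat \<Rightarrow> 'a \<Rightarrow> real) \<Rightarrow> 'b measure \<Rightarrow> ('b \<Rightarrow> real) \<Rightarrow> bool" where
  "converges_in_distribution M Y N Y' \<longleftrightarrow>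
    (\<forall>n. Y n \<in> borel_measurable M) \<and> Y' \<in> borel_measurable N \<and>
    weak_conv_m (\<lambda>n. distr M borel (Y n)) (distr N borel Y')"

end

theory Submission
  imports Defs
begin

text \<open>
  Write \<open>W\<^sub>n(z)\<close> for \<open>\<surd>n\<close> times the difference between the empirical and the true mean of \<open>f2 z\<close>.
  A Taylor expansion of \<open>f1\<close> in its second argument shows that \<open>\<surd>n (\<rho>\<^sub>n - \<rho>)\<close> differs from the
  minimum of \<open>\<langle>\<nabla>f1(z, \<mu> z), W\<^sub>n(z)\<rangle>\<close> over the minimizers by an amount controlled by the supremum
  and the modulus of continuity of \<open>W\<^sub>n\<close>. Both are bounded in probability uniformly in \<open>n\<close>: after
  discarding the sample points with \<open>\<gamma> > \<surd>n\<close>, normalized increments of \<open>W\<^sub>n\<close> have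
  uniformly bounded exponential moments, so a chaining argument over the polynomially many points
  of dyadic nets applies. It remains to compare minima over finite nets, for which the
  central limit theorem for linear combinations suffices. The limit process is a Gram-Schmidt
  expansion with independent normal coefficients on a countable dense set, extended by the same
  chaining bound.
\<close>

section \<open>Chaining\<close>

text \<open>Only two moments of the Lipschitz factor L are available, so exponential bounds have to
  be bought by truncation. The level sqrt n is right from both sides: divided by sqrt n the
  surviving increments are bounded, and the probability that some sample point is discarded is at
  most the integral of L^2 over {L > sqrt n}, which tends to 0. Tails of the form exp (- c t),
  weaker than Gaussian ones, are enough because at scale 4^-j an increment may be as large as 2^-j,
  that is 2^j times the scale; the empirical and the Gaussian process both have such tails.
  Convergence in law in a space of continuous functions is never formulated. A minimum over a finite
  set exceeds y exactly when a random vector lies in an open orthant, so orthant probabilities are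
  compared, with slightly moved thresholds; the moves are absorbed at continuity points of the
  limiting distribution function. The limit enters only through its finite-dimensional laws and its
  continuous paths, hence any realization of it may be used.\<close>

lemma compact_nets:
  fixes Z :: "(real^'d) set"
  assumes "compact Z"
  shows "\<exists>(K :: real) (Q :: real) F. \<forall>j::nat. finite (F j) \<and> F j \<subseteq> Z \<and> F j \<subseteq> F (Suc j) \<and>
    real (card (F j)) \<le> K * Q ^ j \<and> (\<forall>z\<in>Z. \<exists>y\<in>F j. dist z y \<le> (1/4)^j)"
proof -
  let ?d = "CARD('d)"
  obtain b where b: "\<And>z. z \<in> Z \<Longrightarrow> norm z \<le> b"
    using assms compact_imp_bounded bounded_iff by metis
  define B where "B = nat \<lceil>b\<rceil>"
  have B: "\<bar>z $ i\<bar> \<le> real B" if "z \<in> Z" for z i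
    using b[OF that] component_le_norm_cart[of z i] by (simp add: B_def) linarith
  \<comment> \<open>The factor \<open>?d\<close> pays for passing from coordinates to the norm:
    points of one grid cell differ by at most \<open>1 / real (m j)\<close> in each coordinate, and
    the coordinates add up to \<open>(1/4)^j\<close>.\<close>
  define m where "m j = ?d * 4 ^ j" for j :: nat
  define \<phi> where "\<phi> j z = (\<lambda>i. \<lfloor>z $ i * real (m j)\<rfloor>)" for j and z :: "real^'d"
  define S where "S j = PiE (UNIV :: 'd set) (\<lambda>_. {- int (B * m j) .. int (B * m j)})" for j
  have m_pos: "m j > 0" for j by (simp add: m_def)
  have \<phi>S: "\<phi> j ` Z \<subseteq> S j" for j
  proof -
    have "- int (B * m j) \<le> \<lfloor>z $ i * real (m j)\<rfloor> \<and> \<lfloor>z $ i * real (m j)\<rfloor> \<le> int (B * m j)"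
      if "z \<in> Z" for z i
    proof -
      have "\<bar>z $ i * real (m j)\<bar> \<le> real B * real (m j)"
        using B[OF that, of i] by (simp add: abs_mult mult_right_mono)
      then have "z $ i * real (m j) \<ge> of_int (- int (B * m j))"
        "z $ i * real (m j) \<le> of_int (int (B * m j))" by (simp_all add: abs_le_iff)
      then show ?thesis by (meson floor_le_iff le_floor_iff floor_mono floor_of_int order_trans of_int_floor_le of_int_le_iff)
    qed
    then show ?thesis by (auto simp: S_def \<phi>_def)
  qed
  have finS: "finite (S j)" for j by (simp add: S_def finite_PiE)
  define K where "K = real ((2 * B * ?d + 1) ^ ?d)"
  have cardS: "real (card (S j)) \<le> K * (4 ^ ?d) ^ j" for j
  proof -
    have "2 * (B * m j) + 1 \<le> (2 * B * ?d + 1) * 4 ^ j"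
      by (simp add: m_def algebra_simps)
    then have "(2 * (B * m j) + 1) ^ ?d \<le> ((2 * B * ?d + 1) * 4 ^ j) ^ ?d"
      by (rule power_mono) simp
    also have "\<dots> = (2 * B * ?d + 1) ^ ?d * (4 ^ ?d) ^ j"
      by (simp only: power_mult_distrib power_mult[symmetric] mult.commute[of j])
    finally have *: "(2 * (B * m j) + 1) ^ ?d \<le> (2 * B * ?d + 1) ^ ?d * (4 ^ ?d) ^ j" .
    have card_int: "card {- int n..int n} = 2 * n + 1" for n
      by simp
    have "card (S j) = (2 * (B * m j) + 1) ^ ?d"
      by (simp only: S_def card_PiE[OF finite] card_int prod_constant)
    with * have "card (S j) \<le> (2 * B * ?d + 1) ^ ?d * (4 ^ ?d) ^ j" by (simp only:)
    then have "real (card (S j)) \<le> real ((2 * B * ?d + 1) ^ ?d * (4 ^ ?d) ^ j)"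
      by (rule of_nat_mono)
    then show ?thesis by (simp only: K_def of_nat_mult of_nat_power of_nat_numeral)
  qed
  \<comment> \<open>Each occupied cell is represented by one of its points in Z rather than by its
    centre, because the processes are controlled on Z only.\<close>
  define r where "r j k = (SOME z. z \<in> Z \<and> \<phi> j z = k)" for j k
  have r: "r j (\<phi> j z) \<in> Z \<and> \<phi> j (r j (\<phi> j z)) = \<phi> j z" if "z \<in> Z" for j z
    unfolding r_def by (rule someI[of "\<lambda>y. y \<in> Z \<and> \<phi> j y = \<phi> j z" z]) (simp add: that)
  define G where "G j = r j ` \<phi> j ` Z" for j
  have finG: "finite (G j)" for j
    unfolding G_def by (intro finite_imageI finite_subset[OF \<phi>S finS])
  have GZ: "G j \<subseteq> Z" for j using r by (auto simp: G_def)
  have cardG: "real (card (G j)) \<le> K * (4 ^ ?d) ^ j" for j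
  proof -
    have "card (G j) \<le> card (\<phi> j ` Z)"
      unfolding G_def by (intro card_image_le finite_subset[OF \<phi>S finS])
    also have "\<dots> \<le> card (S j)" by (intro card_mono finS \<phi>S)
    finally show ?thesis using cardS[of j] by linarith
  qed
  have net: "\<exists>y\<in>G j. dist z y \<le> (1/4)^j" if "z \<in> Z" for j z
  proof (rule bexI)
    let ?y = "r j (\<phi> j z)"
    show "?y \<in> G j" using that by (simp add: G_def)
    have "\<bar>(z - ?y) $ i\<bar> \<le> 1 / real (m j)" for i
    proof -
      have "\<lfloor>z $ i * real (m j)\<rfloor> = \<lfloor>?y $ i * real (m j)\<rfloor>"
        using r[OF that, of j] by (simp add: \<phi>_def fun_eq_iff)
      then have "\<bar>z $ i * real (m j) - ?y $ i * real (m j)\<bar> \<le> 1" by linarith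
      then have "\<bar>(z - ?y) $ i\<bar> * real (m j) \<le> 1"
        by (simp add: left_diff_distrib[symmetric] abs_mult)
      then show ?thesis using m_pos[of j] by (simp add: field_simps)
    qed
    then have "(\<Sum>i\<in>UNIV. \<bar>(z - ?y) $ i\<bar>) \<le> (\<Sum>i\<in>(UNIV::'d set). 1 / real (m j))"
      by (intro sum_mono)
    also have "\<dots> = (1/4)^j" by (simp add: m_def power_one_over)
    finally show "dist z ?y \<le> (1/4)^j"
      unfolding dist_norm using norm_le_l1_cart[of "z - ?y"] by linarith
  qed
  \<comment> \<open>Representatives chosen at different levels are unrelated; the union makes the
    nets increase. The extra factor j + 1 is at most 2^j, which explains the base
    \<open>2 * 4 ^ ?d\<close>.\<close>
  define F where "F j = (\<Union>i\<le>j. G i)" for j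
  show ?thesis
  proof (rule exI[of _ K], rule exI[of _ "2 * 4 ^ ?d"], rule exI[of _ F], intro conjI allI ballI)
    show "finite (F j)" for j using finG by (simp add: F_def)
    show "F j \<subseteq> Z" for j using GZ by (auto simp: F_def)
    show "F j \<subseteq> F (Suc j)" for j by (auto simp: F_def atMost_Suc)
    show "\<exists>y\<in>F j. dist z y \<le> (1/4)^j" if "z \<in> Z" for j z
      using net[OF that, of j] by (auto simp: F_def)
    show "real (card (F j)) \<le> K * (2 * 4 ^ ?d) ^ j" for j
    proof -
      have "real (card (F j)) \<le> real (\<Sum>i\<le>j. card (G i))"
        unfolding F_def by (intro of_nat_mono card_UN_le) simp
      also have "\<dots> \<le> (\<Sum>i\<le>j. K * (4 ^ ?d) ^ j)"
        unfolding of_nat_sum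
      proof (intro sum_mono)
        fix i assume "i \<in> {..j}"
        have "K * (4 ^ ?d) ^ i \<le> K * (4 ^ ?d) ^ j"
          using \<open>i \<in> {..j}\<close> by (intro mult_left_mono power_increasing) (auto simp: K_def)
        then show "real (card (G i)) \<le> K * (4 ^ ?d) ^ j" using cardG[of i] by linarith
      qed
      also have "\<dots> = real (Suc j) * (K * (4 ^ ?d) ^ j)" by simp
      also have "\<dots> \<le> 2 ^ j * (K * (4 ^ ?d) ^ j)"
      proof (intro mult_right_mono)
        have "Suc j \<le> 2 ^ j" by (simp add: Suc_leI)
        then show "real (Suc j) \<le> 2 ^ j" using of_nat_mono by fastforce
      qed (simp add: K_def)
      finally show ?thesis by (simp add: power_mult_distrib mult_ac)
    qed
  qed
qed

text \<open>A point of a fine net descends to \<open>F k\<close> by nearest neighbours; the link at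
  level j costs at most (1/2)^j, so each of two descents costs at most twice (1/2)^k. Their end
  points are at distance at most (4/3 + 1 + 4/3) times (1/4)^k, below the allowed multiple 5, so one
  further link of cost (1/2)^k joins them, and 2 + 1 + 2 = 5. Links run from
  \<open>F (Suc j)\<close> to \<open>F j\<close>, hence increments are assumed small on
  \<open>F (Suc j)\<close>.\<close>

lemma chaining_bound:
  fixes V :: "'z::metric_space \<Rightarrow> 'b::real_normed_vector"
  assumes mono: "\<And>j. F j \<subseteq> F (Suc j)"
    and net: "\<And>j z. z \<in> (\<Union>i. F i) \<Longrightarrow> \<exists>y\<in>F j. dist z y \<le> (1/4)^j"
    and inc: "\<And>j u v. k \<le> j \<Longrightarrow> u \<in> F (Suc j) \<Longrightarrow> v \<in> F (Suc j) \<Longrightarrow> dist u v \<le> 5 * (1/4)^j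
      \<Longrightarrow> norm (V u - V v) \<le> (1/2)^j"
    and u: "u \<in> (\<Union>i. F i)" and v: "v \<in> (\<Union>i. F i)" and uv: "dist u v \<le> (1/4)^k"
  shows "norm (V u - V v) \<le> 5 * (1/2)^k"
proof -
  have le: "F i \<subseteq> F j" if "i \<le> j" for i j
    using that by (rule lift_Suc_mono_le[of F, OF mono])
  \<comment> \<open>Both bounds are exact partial geometric sums, so one more link extends them by
    precisely its own allowance.\<close>
  have step: "\<exists>y\<in>F k. dist z y \<le> (4/3) * ((1/4)^k - (1/4)^(k+i)) \<and>
      norm (V z - V y) \<le> 2 * ((1/2)^k - (1/2)^(k+i))" if "z \<in> F (k + i)" for i z
    using that
  proof (induction i arbitrary: z)
    case 0
    then show ?case by (auto intro!: bexI[of _ z])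
  next
    case (Suc i)
    obtain z' where z': "z' \<in> F (k + i)" "dist z z' \<le> (1/4)^(k+i)"
      using net[of z "k+i"] Suc.prems by auto
    obtain y where y: "y \<in> F k" "dist z' y \<le> (4/3) * ((1/4)^k - (1/4)^(k+i))"
        "norm (V z' - V y) \<le> 2 * ((1/2)^k - (1/2)^(k+i))"
      using Suc.IH[OF z'(1)] by auto
    have zz: "norm (V z - V z') \<le> (1/2)^(k+i)"
    proof (rule inc)
      show "z \<in> F (Suc (k+i))" using Suc.prems by simp
      show "z' \<in> F (Suc (k+i))" using z'(1) mono by blast
      have "(0::real) \<le> (1/4)^(k+i)" by simp
      then show "dist z z' \<le> 5 * (1/4)^(k+i)" using z'(2) by linarith
    qed simp
    have "dist z y \<le> dist z z' + dist z' y" by (rule dist_triangle)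
    moreover have "norm (V z - V y) \<le> norm (V z - V z') + norm (V z' - V y)"
      using norm_triangle_ineq[of "V z - V z'" "V z' - V y"] by simp
    moreover have "(1/4::real)^(k + Suc i) = (1/4)^(k+i) / 4" "(1/2::real)^(k + Suc i) = (1/2)^(k+i) / 2"
      by simp_all
    ultimately have "dist z y \<le> (4/3) * ((1/4)^k - (1/4)^(k + Suc i))"
      "norm (V z - V y) \<le> 2 * ((1/2)^k - (1/2)^(k + Suc i))"
      using z'(2) y(2,3) zz unfolding right_diff_distrib by linarith+
    then show ?case using y(1) by blast
  qed
  have proj: "\<exists>y\<in>F k. dist z y \<le> (4/3) * (1/4)^k \<and> norm (V z - V y) \<le> 2 * (1/2)^k"
    if z: "z \<in> (\<Union>i. F i)" for z
  proof -
    obtain n where "z \<in> F n" using z by auto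
    then have "z \<in> F (k + n)" using le[of n "k+n"] by auto
    from step[OF this] obtain y where "y \<in> F k" "dist z y \<le> (4/3) * ((1/4)^k - (1/4)^(k+n))"
      "norm (V z - V y) \<le> 2 * ((1/2)^k - (1/2)^(k+n))" by auto
    moreover have "(0::real) \<le> (1/4)^(k+n)" "(0::real) \<le> (1/2)^(k+n)" by simp_all
    ultimately have "y \<in> F k" "dist z y \<le> (4/3) * (1/4)^k" "norm (V z - V y) \<le> 2 * (1/2)^k"
      unfolding right_diff_distrib by linarith+
    then show ?thesis by blast
  qed
  obtain a where a: "a \<in> F k" "dist u a \<le> (4/3) * (1/4)^k" "norm (V u - V a) \<le> 2 * (1/2)^k"
    using proj[OF u] by auto
  obtain b where b: "b \<in> F k" "dist v b \<le> (4/3) * (1/4)^k" "norm (V v - V b) \<le> 2 * (1/2)^k"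
    using proj[OF v] by auto
  have "norm (V a - V b) \<le> (1/2)^k"
  proof (rule inc)
    have "dist a b \<le> dist u a + dist u v + dist v b"
      
      using dist_triangle[of a b u] dist_triangle[of u b v] by (simp add: dist_commute)
    moreover have "(0::real) \<le> (1/4)^k" by simp
    ultimately show "dist a b \<le> 5 * (1/4)^k" using a b uv by linarith
  qed (use a b mono in auto)
  moreover have "norm (V u - V v) \<le> norm (V u - V a) + norm (V a - V b) + norm (V v - V b)"
    
    using norm_triangle_ineq[of "V u - V a" "V a - V b"] norm_triangle_ineq4[of "V u - V b" "V v - V b"] by simp
  ultimately show ?thesis using a b by linarith
qed

text \<open>The ratio of consecutive terms is \<open>q * exp (- c * 2 ^ n)\<close>, since 2^(n+1) -
  2^n = 2^n, and it tends to 0 whatever the size of q.\<close>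

lemma summable_power_times_exp_power2:
  fixes q c :: real
  assumes "0 < c" "0 \<le> q"
  shows "summable (\<lambda>j. q ^ j * exp (- c * 2 ^ j))"
proof -
  have "(\<lambda>j::nat. q * exp (- c * 2 ^ j)) \<longlonglongrightarrow> q * 0"
  proof (intro tendsto_mult tendsto_const)
    have lim: "(\<lambda>j::nat. exp (- c) ^ j) \<longlonglongrightarrow> 0"
      using assms(1) by (intro LIMSEQ_realpow_zero) auto
    have *: "exp (- c * 2 ^ j) \<le> exp (- c) ^ j" for j :: nat
    proof -
      have "real j \<le> 2 ^ j" using of_nat_mono[OF less_imp_le[OF less_exp[of j]]] by simp
      then have "exp (- c * 2 ^ j) \<le> exp (real j * - c)" using assms(1) by simp
      then show ?thesis by (simp only: exp_of_nat_mult)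
    qed
    show "(\<lambda>j::nat. exp (- c * 2 ^ j)) \<longlonglongrightarrow> 0"
      by (rule Lim_null_comparison[OF _ lim]) (simp only: real_norm_def abs_exp_cancel * eventually_True)
  qed
  then have "eventually (\<lambda>j. q * exp (- c * 2 ^ j) < 1/2) sequentially"
    by (rule order_tendstoD) simp
  then obtain N where N: "\<And>j. j \<ge> N \<Longrightarrow> q * exp (- c * 2 ^ j) < 1/2"
    by (auto simp: eventually_sequentially)
  show ?thesis
  proof (rule summable_ratio_test[of "1/2" N])
    fix n assume n: "n \<ge> N"
    have "q ^ Suc n * exp (- c * 2 ^ Suc n) =
        (q * exp (- c * 2 ^ n)) * (q ^ n * exp (- c * 2 ^ n))"
      by (simp add: exp_add[symmetric] mult_ac algebra_simps)
    also have "\<dots> \<le> 1/2 * (q ^ n * exp (- c * 2 ^ n))"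
      using N[OF n] assms by (intro mult_right_mono) auto
    finally show "norm (q ^ Suc n * exp (- c * 2 ^ Suc n)) \<le> 1/2 * norm (q ^ n * exp (- c * 2 ^ n))"
      using assms by (simp add: abs_mult)
  qed simp
qed

text \<open>
  At level \<open>j\<close> increments over distances of order \<open>4\<^sup>-\<^sup>j\<close> are compared with the threshold \<open>2\<^sup>-\<^sup>j\<close>, so the
  failure probability \<open>exp (- c 2\<^sup>j / 5)\<close> beats the number \<open>K\<^sup>2 Q\<^sup>2\<^sup>j\<^sup>+\<^sup>2\<close> of pairs. The radius \<open>\<delta>\<close> is the same
  for all processes with the given tails.
\<close>

lemma chaining_modulus:
  fixes F :: "nat \<Rightarrow> 'z::metric_space set"
  assumes fin: "\<And>j. finite (F j)" and mono: "\<And>j. F j \<subseteq> F (Suc j)"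
    and card: "\<And>j. real (card (F j)) \<le> K * Q ^ j"
    and net: "\<And>j z. z \<in> (\<Union>i. F i) \<Longrightarrow> \<exists>y\<in>F j. dist z y \<le> (1/4)^j"
    and c: "0 < c" and \<eta>: "0 < \<eta>"
  shows "\<exists>\<delta>>0. \<forall>(M :: 'a measure) (V :: 'z \<Rightarrow> 'a \<Rightarrow> 'b::{real_normed_vector, second_countable_topology}).
      prob_space M \<longrightarrow> (\<forall>z\<in>(\<Union>i. F i). V z \<in> borel_measurable M) \<longrightarrow>
      (\<forall>u\<in>(\<Union>i. F i). \<forall>v\<in>(\<Union>i. F i). \<forall>t>0.
        measure M {\<omega>\<in>space M. t * dist u v < norm (V u \<omega> - V v \<omega>)} \<le> C * exp (- c * t)) \<longrightarrow>
      (\<exists>A\<in>sets M. measure M A \<le> \<eta> \<and>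
        (\<forall>\<omega>\<in>space M - A. \<forall>u\<in>(\<Union>i. F i). \<forall>v\<in>(\<Union>i. F i). dist u v \<le> \<delta> \<longrightarrow> norm (V u \<omega> - V v \<omega>) \<le> \<eta>))"
proof -
  \<comment> \<open>Union bound at level j: the squared factor counts pairs in
    \<open>F (Suc j)\<close>, and 2^j / 5 is the value of t for which a distance of 5 times (1/4)^j
    gives the threshold (1/2)^j. The absolute value keeps the terms nonnegative for every C.\<close>
  define a where "a j = (K * Q ^ Suc j) * (K * Q ^ Suc j) * (\<bar>C\<bar> * exp (- c * (2 ^ j / 5)))" for j
  have "summable a"
  proof -
    have "summable (\<lambda>j. (K\<^sup>2 * Q\<^sup>2 * \<bar>C\<bar>) * ((Q\<^sup>2) ^ j * exp (- (c/5) * 2 ^ j)))"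
      using c by (intro summable_mult summable_power_times_exp_power2) auto
    moreover have "(K\<^sup>2 * Q\<^sup>2 * \<bar>C\<bar>) * ((Q\<^sup>2) ^ j * exp (- (c/5) * 2 ^ j)) = a j" for j
      by (simp add: a_def power2_eq_square power_mult_distrib)
    ultimately show ?thesis by (simp only:)
  qed
  have a_nonneg: "0 \<le> a j" for j by (simp add: a_def)
  have "(\<lambda>k. \<Sum>i. a (i + k)) \<longlonglongrightarrow> 0" by (rule suminf_exist_split2) fact
  then have "eventually (\<lambda>k. (\<Sum>i. a (i + k)) < \<eta>) sequentially"
    using \<eta> by (rule order_tendstoD)
  moreover have "(\<lambda>k. 5 * (1/2::real)^k) \<longlonglongrightarrow> 5 * 0"
    by (intro tendsto_intros LIMSEQ_realpow_zero) auto
  then have "eventually (\<lambda>k. 5 * (1/2::real)^k < \<eta>) sequentially"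
    using \<eta> by (intro order_tendstoD) auto
  ultimately have "eventually (\<lambda>k. (\<Sum>i. a (i + k)) < \<eta> \<and> 5 * (1/2::real)^k < \<eta>) sequentially"
    by eventually_elim auto
  then obtain k where k: "(\<Sum>i. a (i + k)) < \<eta>" "5 * (1/2::real)^k < \<eta>"
    by (auto simp: eventually_sequentially)
  show ?thesis
  proof (intro exI[of _ "(1/4)^k"] conjI allI impI)
    fix M :: "'a measure" and V :: "'z \<Rightarrow> 'a \<Rightarrow> 'b"
    assume "prob_space M" and V': "\<forall>z\<in>(\<Union>i. F i). V z \<in> borel_measurable M"
      and tail: "\<forall>u\<in>(\<Union>i. F i). \<forall>v\<in>(\<Union>i. F i). \<forall>t>0.
        measure M {\<omega>\<in>space M. t * dist u v < norm (V u \<omega> - V v \<omega>)} \<le> C * exp (- c * t)"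
    note V[measurable] = V'[rule_format]
    interpret prob_space M by fact
    define E where "E j u v = {\<omega>\<in>space M. (2 ^ j / 5) * dist u v < norm (V u \<omega> - V v \<omega>)}" for j u v
    define B where "B j = (\<Union>(u, v)\<in>F (Suc j) \<times> F (Suc j). E j u v)" for j
    have E_meas: "E j u v \<in> events" if "u \<in> (\<Union>i. F i)" "v \<in> (\<Union>i. F i)" for j u v
      unfolding E_def using V[OF that(1)] V[OF that(2)] by measurable
    have B_meas: "B j \<in> events" for j
      unfolding B_def by (rule sets.finite_UN) (auto simp: fin intro!: E_meas)
    have B_prob: "prob (B j) \<le> a j" for j
    proof -
      have "prob (B j) \<le> (\<Sum>(u, v)\<in>F (Suc j) \<times> F (Suc j). prob (E j u v))"
        unfolding B_def case_prod_unfold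
        by (rule finite_measure_subadditive_finite) (auto simp: fin intro!: E_meas)
      also have "\<dots> \<le> (\<Sum>(u, v)\<in>F (Suc j) \<times> F (Suc j). \<bar>C\<bar> * exp (- c * (2 ^ j / 5)))"
      proof (intro sum_mono, clarify)
        fix u v assume "u \<in> F (Suc j)" "v \<in> F (Suc j)"
        then have "prob (E j u v) \<le> C * exp (- c * (2 ^ j / 5))"
          unfolding E_def by (intro tail[rule_format]) auto
        also have "\<dots> \<le> \<bar>C\<bar> * exp (- c * (2 ^ j / 5))" by (intro mult_right_mono) auto
        finally show "prob (E j u v) \<le> \<bar>C\<bar> * exp (- c * (2 ^ j / 5))" .
      qed
      also have "\<dots> = real (card (F (Suc j))) * real (card (F (Suc j))) * (\<bar>C\<bar> * exp (- c * (2 ^ j / 5)))"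
        by (simp add: case_prod_unfold card_cartesian_product)
      also have "\<dots> \<le> a j"
        unfolding a_def using card[of "Suc j"]
        by (intro mult_right_mono mult_mono) (auto intro: order_trans[of _ "real (card (F (Suc j)))"])
      finally show ?thesis .
    qed
    \<comment> \<open>All levels from k on are controlled at once; coarser ones do not enter, as
      only pairs within (1/4)^k of each other are chained.\<close>
    define A where "A = (\<Union>i. B (i + k))"
    show "\<exists>A\<in>events. prob A \<le> \<eta> \<and>
        (\<forall>\<omega>\<in>space M - A. \<forall>u\<in>(\<Union>i. F i). \<forall>v\<in>(\<Union>i. F i). dist u v \<le> (1/4)^k \<longrightarrow> norm (V u \<omega> - V v \<omega>) \<le> \<eta>)"
    proof (intro bexI conjI ballI impI)
      show "A \<in> events" unfolding A_def using B_meas by auto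
      have sa: "summable (\<lambda>i. a (i + k))" using \<open>summable a\<close> by (rule summable_ignore_initial_segment)
      have sB: "summable (\<lambda>i. prob (B (i + k)))"
        using B_prob by (intro summable_comparison_test[OF _ sa]) auto
      have "prob A \<le> (\<Sum>i. prob (B (i + k)))"
        unfolding A_def using B_meas sB by (intro finite_measure_subadditive_countably) auto
      also have "\<dots> \<le> (\<Sum>i. a (i + k))" using B_prob by (intro suminf_le sa sB) auto
      finally show "prob A \<le> \<eta>" using k by linarith
      fix \<omega> u v assume \<omega>: "\<omega> \<in> space M - A" and uv: "u \<in> (\<Union>i. F i)" "v \<in> (\<Union>i. F i)" "dist u v \<le> (1/4)^k"
      have "norm (V u \<omega> - V v \<omega>) \<le> 5 * (1/2)^k"
      proof (rule chaining_bound[where V = "\<lambda>z. V z \<omega>", OF mono net _ uv])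
        fix j u v assume j: "k \<le> j" "u \<in> F (Suc j)" "v \<in> F (Suc j)" "dist u v \<le> 5 * (1/4)^j"
        have "B j \<subseteq> A" using j(1) by (force simp: A_def intro: exI[of _ "j - k"])
        then have "\<omega> \<notin> E j u v" using \<omega> j by (auto simp: B_def)
        then have "norm (V u \<omega> - V v \<omega>) \<le> (2 ^ j / 5) * dist u v" using \<omega> by (auto simp: E_def)
        also have "\<dots> \<le> (2 ^ j / 5) * (5 * (1/4)^j)" using j(4) by (intro mult_left_mono) auto
        also have "\<dots> = (1/2)^j" by (simp add: power_mult_distrib[symmetric])
        finally show "norm (V u \<omega> - V v \<omega>) \<le> (1/2)^j" .
      qed
      then show "norm (V u \<omega> - V v \<omega>) \<le> \<eta>" using k by linarith
    qed
  qed simp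
qed

section \<open>Weak convergence\<close>

text \<open>Comparing upper tails at two thresholds x < y is enough, because near a continuity point
  of the limiting distribution function the shift of the threshold changes the limit arbitrarily
  little. Approximations that move values slightly outside a small event are thereby
  admissible.\<close>

lemma weak_conv_m_distrI:
  fixes Y :: "nat \<Rightarrow> 'a \<Rightarrow> real" and Y' :: "'b \<Rightarrow> real"
  assumes M: "prob_space M" and N: "prob_space N"
    and Y[measurable]: "\<And>n. Y n \<in> borel_measurable M" and Y'[measurable]: "Y' \<in> borel_measurable N"
    and upper: "\<And>x y e. x < y \<Longrightarrow> 0 < e \<Longrightarrow> \<forall>\<^sub>F n in sequentially.
      measure M {\<omega>\<in>space M. y < Y n \<omega>} \<le> measure N {\<omega>\<in>space N. x < Y' \<omega>} + e"
    and lower: "\<And>x y e. x < y \<Longrightarrow> 0 < e \<Longrightarrow> \<forall>\<^sub>F n in sequentially.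
      measure N {\<omega>\<in>space N. y < Y' \<omega>} \<le> measure M {\<omega>\<in>space M. x < Y n \<omega>} + e"
  shows "weak_conv_m (\<lambda>n. distr M borel (Y n)) (distr N borel Y')"
proof -
  interpret M: prob_space M by fact
  interpret N: prob_space N by fact
  have cM: "cdf (distr M borel (Y n)) x = 1 - measure M {\<omega>\<in>space M. x < Y n \<omega>}" for n x
  proof -
    have "cdf (distr M borel (Y n)) x = M.prob (Y n -` {..x} \<inter> space M)"
      by (simp add: cdf_def measure_distr)
    also have "Y n -` {..x} \<inter> space M = space M - {\<omega>\<in>space M. x < Y n \<omega>}" by auto
    also have "M.prob \<dots> = 1 - measure M {\<omega>\<in>space M. x < Y n \<omega>}" by (rule M.prob_compl) simp
    finally show ?thesis .
  qed
  have cN: "cdf (distr N borel Y') x = 1 - measure N {\<omega>\<in>space N. x < Y' \<omega>}" for x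
  proof -
    have "cdf (distr N borel Y') x = N.prob (Y' -` {..x} \<inter> space N)"
      by (simp add: cdf_def measure_distr)
    also have "Y' -` {..x} \<inter> space N = space N - {\<omega>\<in>space N. x < Y' \<omega>}" by auto
    also have "N.prob \<dots> = 1 - measure N {\<omega>\<in>space N. x < Y' \<omega>}" by (rule N.prob_compl) simp
    finally show ?thesis .
  qed
  let ?c = "cdf (distr N borel Y')"
  show ?thesis
    unfolding weak_conv_m_def weak_conv_def
  proof (intro allI impI)
    fix x assume cont: "isCont ?c x"
    show "(\<lambda>n. cdf (distr M borel (Y n)) x) \<longlonglongrightarrow> ?c x"
    proof (rule tendstoI)
      fix e :: real assume e: "0 < e"
      obtain d where d: "d > 0" "\<And>y. dist y x < d \<Longrightarrow> dist (?c y) (?c x) < e/2"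
        using cont e unfolding continuous_at_eps_delta by (metis half_gt_zero)
      have d1: "\<bar>?c (x + d/2) - ?c x\<bar> < e/2" "\<bar>?c (x - d/2) - ?c x\<bar> < e/2"
        using d(2)[of "x + d/2"] d(2)[of "x - d/2"] d(1) by (auto simp: dist_real_def)
      have "x - d/2 < x" "x < x + d/2" "0 < e/2" using d(1) e by auto
      with upper[of "x - d/2" x "e/2"] lower[of x "x + d/2" "e/2"]
      have "\<forall>\<^sub>F n in sequentially. M.prob {\<omega>\<in>space M. x < Y n \<omega>} \<le> N.prob {\<omega>\<in>space N. x - d/2 < Y' \<omega>} + e/2
        \<and> N.prob {\<omega>\<in>space N. x + d/2 < Y' \<omega>} \<le> M.prob {\<omega>\<in>space M. x < Y n \<omega>} + e/2"
        by (auto intro: eventually_conj)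
      then show "\<forall>\<^sub>F n in sequentially. dist (cdf (distr M borel (Y n)) x) (?c x) < e"
      proof eventually_elim
        case (elim n)
        then show ?case
          using d1 unfolding dist_real_def cM cN by linarith
      qed
    qed
  qed
qed

text \<open>
  Levy's continuity theorem for the image of the tilted law \<open>B\<close> times \<open>M\<close> under \<open>U\<close>.
\<close>

lemma weighted_levy_continuity_pos:
  fixes U :: "nat \<Rightarrow> 'a \<Rightarrow> real" and U' :: "'b \<Rightarrow> real" and h :: "real \<Rightarrow> real"
  assumes M: "prob_space M" and N: "prob_space N"
    and [measurable]: "\<And>n. U n \<in> borel_measurable M" "U' \<in> borel_measurable N"
      "\<And>n. B n \<in> borel_measurable M" "B' \<in> borel_measurable N"
    and B: "\<And>n \<omega>. 1 \<le> B n \<omega>" "\<And>n \<omega>. B n \<omega> \<le> b"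
    and B': "\<And>\<omega>. 1 \<le> B' \<omega>" "\<And>\<omega>. B' \<omega> \<le> b"
    and conv: "\<And>s. (\<lambda>n. CLINT \<omega>|M. complex_of_real (B n \<omega>) * iexp (s * U n \<omega>))
      \<longlonglongrightarrow> (CLINT \<omega>|N. complex_of_real (B' \<omega>) * iexp (s * U' \<omega>))"
    and h: "\<And>x. isCont h x" "\<And>x. \<bar>h x\<bar> \<le> 1"
  shows "(\<lambda>n. LINT \<omega>|M. B n \<omega> * h (U n \<omega>)) \<longlonglongrightarrow> (LINT \<omega>|N. B' \<omega> * h (U' \<omega>))"
proof -
  interpret M: prob_space M by fact
  interpret N: prob_space N by fact
  have hm[measurable]: "h \<in> borel_measurable borel"
    using h(1) by (intro borel_measurable_continuous_onI continuous_at_imp_continuous_on) auto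
  \<comment> \<open>Dividing the weight by its mean makes it a probability density; C \<ge> 1 keeps
    the mean at least 1, so the division is harmless. Weighted integrals become expectations under
    an image law, to which the unweighted continuity theorem applies.\<close>
  have tilt: "real_distribution (distr (density L (\<lambda>\<omega>. ennreal (C \<omega> / (LINT \<omega>|L. C \<omega>)))) borel T) \<and>
     (LINT \<omega>|L. C \<omega>) \<ge> 1 \<and>
     (\<forall>f :: real \<Rightarrow> real. f \<in> borel_measurable borel \<longrightarrow>
       integral\<^sup>L (distr (density L (\<lambda>\<omega>. ennreal (C \<omega> / (LINT \<omega>|L. C \<omega>)))) borel T) f
        = (LINT \<omega>|L. C \<omega> * f (T \<omega>)) / (LINT \<omega>|L. C \<omega>)) \<and>
     (\<forall>s. char (distr (density L (\<lambda>\<omega>. ennreal (C \<omega> / (LINT \<omega>|L. C \<omega>)))) borel T) s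
        = (CLINT \<omega>|L. complex_of_real (C \<omega>) * iexp (s * T \<omega>)) / complex_of_real (LINT \<omega>|L. C \<omega>))"
    if L: "prob_space L" and [measurable]: "T \<in> borel_measurable L" "C \<in> borel_measurable L"
      and C: "\<And>\<omega>. 1 \<le> C \<omega>" "\<And>\<omega>. C \<omega> \<le> b" for L :: "'c measure" and C T
  proof -
    interpret L: prob_space L by fact
    let ?m = "LINT \<omega>|L. C \<omega>"
    have int: "integrable L C"
      proof (rule L.integrable_const_bound[where B=b])
      have "\<bar>C \<omega>\<bar> \<le> b" for \<omega> using C[of \<omega>] by linarith
      then show "AE \<omega> in L. norm (C \<omega>) \<le> b" by simp
    qed simp
    have m1: "1 \<le> ?m"
    proof -
      have "(LINT \<omega>|L. 1) \<le> ?m" using int C by (intro integral_mono) auto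
      then show ?thesis by (simp add: L.prob_space)
    qed
    have C0: "0 \<le> C \<omega> / ?m" for \<omega> using C(1)[of \<omega>] m1 by simp
    let ?D = "density L (\<lambda>\<omega>. ennreal (C \<omega> / ?m))"
    have "emeasure ?D (space ?D) = (\<integral>\<^sup>+\<omega>. ennreal (C \<omega> / ?m) \<partial>L)"
      by (simp add: emeasure_density)
    also have "\<dots> = ennreal (LINT \<omega>|L. C \<omega> / ?m)"
      using int C0 by (intro nn_integral_eq_integral) auto
    also have "\<dots> = 1" using m1 by simp
    finally have D: "prob_space ?D" by (rule prob_spaceI)
    have "real_distribution (distr ?D borel T)"
      by (rule prob_space.real_distribution_distr[OF D]) simp
    moreover have "integral\<^sup>L (distr ?D borel T) f = (LINT \<omega>|L. C \<omega> * f (T \<omega>)) / ?m"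
      if [measurable]: "f \<in> borel_measurable borel" for f :: "real \<Rightarrow> real"
    proof -
      have "integral\<^sup>L (distr ?D borel T) f = (LINT \<omega>|L. (C \<omega> / ?m) *\<^sub>R f (T \<omega>))"
        using C0 by (simp add: integral_distr integral_density del: scaleR_conv_of_real real_scaleR_def)
      also have "\<dots> = (LINT \<omega>|L. (C \<omega> * f (T \<omega>)) / ?m)" by (simp add: field_simps)
      finally show ?thesis by simp
    qed
    moreover have "char (distr ?D borel T) s = (CLINT \<omega>|L. complex_of_real (C \<omega>) * iexp (s * T \<omega>)) / complex_of_real ?m" for s
    proof -
      have "char (distr ?D borel T) s = (LINT \<omega>|L. (C \<omega> / ?m) *\<^sub>R iexp (s * T \<omega>))"
        unfolding char_def using C0 by (simp add: integral_distr integral_density del: scaleR_conv_of_real of_real_mult)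
      also have "\<dots> = (LINT \<omega>|L. (complex_of_real (C \<omega>) * iexp (s * T \<omega>)) / complex_of_real ?m)"
        by (simp add: scaleR_conv_of_real)
      finally show ?thesis by simp
    qed
    ultimately show ?thesis using m1 by blast
  qed
  define m where "m n = (LINT \<omega>|M. B n \<omega>)" for n
  define m' where "m' = (LINT \<omega>|N. B' \<omega>)"
  note tM = tilt[OF M, of "U _" "B _", folded m_def]
  note tN = tilt[OF N, of U' B', folded m'_def]
  let ?Q = "\<lambda>n. distr (density M (\<lambda>\<omega>. ennreal (B n \<omega> / m n))) borel (U n)"
  let ?Q' = "distr (density N (\<lambda>\<omega>. ennreal (B' \<omega> / m'))) borel U'"
  have m1: "1 \<le> m n" "1 \<le> m'" for n using tM[of n n] tN B B' by auto
  \<comment> \<open>At s = 0 the hypothesis is convergence of the total weights, which allows the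
    normalization to be undone at the end.\<close>
  have "(\<lambda>n. complex_of_real (m n)) \<longlonglongrightarrow> complex_of_real m'"
    using conv[of 0] by (simp add: m_def m'_def)
  then have mc: "m \<longlonglongrightarrow> m'" by (simp add: tendsto_of_real_iff)
  have "weak_conv_m ?Q ?Q'"
  proof (rule levy_continuity)
    show "real_distribution (?Q n)" for n using tM[of n n] B by simp
    show "real_distribution ?Q'" using tN B' by simp
    fix s
    have "(\<lambda>n. (CLINT \<omega>|M. complex_of_real (B n \<omega>) * iexp (s * U n \<omega>)) / complex_of_real (m n))
      \<longlonglongrightarrow> (CLINT \<omega>|N. complex_of_real (B' \<omega>) * iexp (s * U' \<omega>)) / complex_of_real m'"
      using m1(2) by (intro tendsto_divide conv tendsto_of_real mc) auto
    then show "(\<lambda>n. char (?Q n) s) \<longlonglongrightarrow> char ?Q' s" using tM tN B B' by simp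
  qed
  then have "(\<lambda>n. integral\<^sup>L (?Q n) h) \<longlonglongrightarrow> integral\<^sup>L ?Q' h"
    using h tM tN B B' by (intro weak_conv_imp_integral_bdd_continuous_conv[where B=1]) auto
  then have "(\<lambda>n. m n * integral\<^sup>L (?Q n) h) \<longlonglongrightarrow> m' * integral\<^sup>L ?Q' h"
    by (intro tendsto_mult mc)
  moreover have "m n * integral\<^sup>L (?Q n) h = (LINT \<omega>|M. B n \<omega> * h (U n \<omega>))" for n
    using tM[of n n] B m1(1)[of n] by simp
  moreover have "m' * integral\<^sup>L ?Q' h = (LINT \<omega>|N. B' \<omega> * h (U' \<omega>))"
    using tN B' m1(2) by simp
  ultimately show ?thesis by simp
qed

text \<open>Adding 2 moves a weight from [-1, 1] to [1, 3], where the positive case applies; twice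
  the case of constant weight 1 is then subtracted. This is why unweighted convergence is assumed as
  well.\<close>

lemma weighted_levy_continuity:
  fixes U :: "nat \<Rightarrow> 'a \<Rightarrow> real" and U' :: "'b \<Rightarrow> real" and h :: "real \<Rightarrow> real"
  assumes M: "prob_space M" and N: "prob_space N"
    and [measurable]: "\<And>n. U n \<in> borel_measurable M" "U' \<in> borel_measurable N"
      "\<And>n. B n \<in> borel_measurable M" "B' \<in> borel_measurable N"
    and B: "\<And>n \<omega>. \<bar>B n \<omega>\<bar> \<le> 1" and B': "\<And>\<omega>. \<bar>B' \<omega>\<bar> \<le> 1"
    and conv: "\<And>s. (\<lambda>n. CLINT \<omega>|M. iexp (s * U n \<omega>)) \<longlonglongrightarrow> (CLINT \<omega>|N. iexp (s * U' \<omega>))"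
    and convB: "\<And>s. (\<lambda>n. CLINT \<omega>|M. complex_of_real (B n \<omega>) * iexp (s * U n \<omega>))
      \<longlonglongrightarrow> (CLINT \<omega>|N. complex_of_real (B' \<omega>) * iexp (s * U' \<omega>))"
    and h: "\<And>x. isCont h x" "\<And>x. \<bar>h x\<bar> \<le> 1"
  shows "(\<lambda>n. LINT \<omega>|M. B n \<omega> * h (U n \<omega>)) \<longlonglongrightarrow> (LINT \<omega>|N. B' \<omega> * h (U' \<omega>))"
proof -
  interpret M: prob_space M by fact
  interpret N: prob_space N by fact
  have hm[measurable]: "h \<in> borel_measurable borel"
    using h(1) by (intro borel_measurable_continuous_onI continuous_at_imp_continuous_on) auto
  have iM: "integrable M (\<lambda>\<omega>. complex_of_real (B n \<omega>) * iexp (s * U n \<omega>))" for n s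
    using B by (intro M.integrable_const_bound[where B=1]) (auto simp: norm_mult)
  have iN: "integrable N (\<lambda>\<omega>. complex_of_real (B' \<omega>) * iexp (s * U' \<omega>))" for s
    using B' by (intro N.integrable_const_bound[where B=1]) (auto simp: norm_mult)
  have iM1: "integrable M (\<lambda>\<omega>. iexp (s * U n \<omega>))" for n s
    by (intro M.integrable_const_bound[where B=1]) auto
  have iN1: "integrable N (\<lambda>\<omega>. iexp (s * U' \<omega>))" for s
    by (intro N.integrable_const_bound[where B=1]) auto
  have hB: "\<bar>B n \<omega> * h (U n \<omega>)\<bar> \<le> 1" "\<bar>B' \<omega>' * h (U' \<omega>')\<bar> \<le> 1" for n \<omega> \<omega>'
    using B B' h(2) by (simp_all add: abs_mult mult_le_one)
  have jM: "integrable M (\<lambda>\<omega>. B n \<omega> * h (U n \<omega>))" "integrable M (\<lambda>\<omega>. h (U n \<omega>))" for n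
    using hB h by (auto intro!: M.integrable_const_bound[where B=1])
  have jN: "integrable N (\<lambda>\<omega>. B' \<omega> * h (U' \<omega>))" "integrable N (\<lambda>\<omega>. h (U' \<omega>))"
    using hB h by (auto intro!: N.integrable_const_bound[where B=1])
  have 1: "(\<lambda>n. LINT \<omega>|M. (B n \<omega> + 2) * h (U n \<omega>)) \<longlonglongrightarrow> (LINT \<omega>|N. (B' \<omega> + 2) * h (U' \<omega>))"
  proof (rule weighted_levy_continuity_pos[OF M N, where b=3 and U=U and U'=U' and h=h])
    show "1 \<le> B n \<omega> + 2" "B n \<omega> + 2 \<le> 3" for n \<omega> using B[of n \<omega>] by linarith+
    show "1 \<le> B' \<omega> + 2" "B' \<omega> + 2 \<le> 3" for \<omega> using B'[of \<omega>] by linarith+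
    fix s
    have "(\<lambda>n. (CLINT \<omega>|M. complex_of_real (B n \<omega>) * iexp (s * U n \<omega>)) + 2 * (CLINT \<omega>|M. iexp (s * U n \<omega>)))
      \<longlonglongrightarrow> (CLINT \<omega>|N. complex_of_real (B' \<omega>) * iexp (s * U' \<omega>)) + 2 * (CLINT \<omega>|N. iexp (s * U' \<omega>))"
      by (intro tendsto_intros conv convB)
    then show "(\<lambda>n. CLINT \<omega>|M. complex_of_real (B n \<omega> + 2) * iexp (s * U n \<omega>))
      \<longlonglongrightarrow> (CLINT \<omega>|N. complex_of_real (B' \<omega> + 2) * iexp (s * U' \<omega>))"
      using iM iN iM1 iN1 by (simp add: distrib_right del: of_real_mult)
  qed (use h in auto)
  have 2: "(\<lambda>n. LINT \<omega>|M. 1 * h (U n \<omega>)) \<longlonglongrightarrow> (LINT \<omega>|N. 1 * h (U' \<omega>))"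
    using conv h by (intro weighted_levy_continuity_pos[OF M N, where b=1 and U=U and U'=U' and h=h]) auto
  have "(\<lambda>n. (LINT \<omega>|M. (B n \<omega> + 2) * h (U n \<omega>)) - 2 * (LINT \<omega>|M. 1 * h (U n \<omega>)))
    \<longlonglongrightarrow> (LINT \<omega>|N. (B' \<omega> + 2) * h (U' \<omega>)) - 2 * (LINT \<omega>|N. 1 * h (U' \<omega>))"
    by (intro tendsto_intros 1 2)
  then show ?thesis using jM jN by (simp add: distrib_right)
qed

text \<open>
  The factors \<open>iexp (a j * U n j)\<close> are replaced by \<open>h j (U n j)\<close> one index at a time: the product of the
  remaining ones serves as a bounded weight, so only the one-dimensional continuity theorem is needed.
\<close>

lemma cramer_wold_prod:
  fixes U :: "nat \<Rightarrow> 'j \<Rightarrow> 'a \<Rightarrow> real" and U' :: "'j \<Rightarrow> 'b \<Rightarrow> real" and h :: "'j \<Rightarrow> real \<Rightarrow> real"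
  assumes M: "prob_space M" and N: "prob_space N" and J: "finite J"
    and meas[measurable]: "\<And>n j. j \<in> J \<Longrightarrow> U n j \<in> borel_measurable M" "\<And>j. j \<in> J \<Longrightarrow> U' j \<in> borel_measurable N"
    and conv: "\<And>a. (\<lambda>n. CLINT \<omega>|M. iexp (\<Sum>j\<in>J. a j * U n j \<omega>)) \<longlonglongrightarrow> (CLINT \<omega>|N. iexp (\<Sum>j\<in>J. a j * U' j \<omega>))"
    and h: "\<And>j x. isCont (h j) x" "\<And>j x. \<bar>h j x\<bar> \<le> 1"
  shows "(\<lambda>n. LINT \<omega>|M. (\<Prod>j\<in>J. h j (U n j \<omega>))) \<longlonglongrightarrow> (LINT \<omega>|N. (\<Prod>j\<in>J. h j (U' j \<omega>)))"
proof -
  interpret M: prob_space M by fact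
  interpret N: prob_space N by fact
  have hm[measurable]: "h j \<in> borel_measurable borel" for j
    using h(1) by (intro borel_measurable_continuous_onI continuous_at_imp_continuous_on) auto
  have prod_le: "\<bar>\<Prod>j\<in>I. h j (x j)\<bar> \<le> 1" for I and x :: "'j \<Rightarrow> real"
    unfolding abs_prod using h(2) by (intro prod_le_1) auto
  \<comment> \<open>The frequencies a range over all of J and stay arbitrary in the induction,
    because the step for i uses the hypothesis with s added at i. With I = J and a = 0 only the
    product remains.\<close>
  have claim: "(\<lambda>n. CLINT \<omega>|M. complex_of_real (\<Prod>j\<in>I. h j (U n j \<omega>)) * iexp (\<Sum>j\<in>J. a j * U n j \<omega>))
     \<longlonglongrightarrow> (CLINT \<omega>|N. complex_of_real (\<Prod>j\<in>I. h j (U' j \<omega>)) * iexp (\<Sum>j\<in>J. a j * U' j \<omega>))"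
    if "finite I" "I \<subseteq> J" for I a
    using that
  proof (induction I arbitrary: a rule: finite_induct)
    case empty
    then show ?case using conv by simp
  next
    case (insert i I)
    then have i: "i \<in> J" and I: "I \<subseteq> J" by auto
    have [measurable]: "U n i \<in> borel_measurable M" "U' i \<in> borel_measurable N" for n
      using i by (simp_all add: meas)
    have [measurable]: "(\<lambda>\<omega>. \<Prod>j\<in>I. h j (U n j \<omega>)) \<in> borel_measurable M" "(\<lambda>\<omega>. \<Prod>j\<in>I. h j (U' j \<omega>)) \<in> borel_measurable N" for n
      using I by (auto intro!: borel_measurable_prod measurable_compose[OF _ hm] meas)
    have [measurable]: "(\<lambda>\<omega>. \<Sum>j\<in>J. a j * U n j \<omega>) \<in> borel_measurable M" "(\<lambda>\<omega>. \<Sum>j\<in>J. a j * U' j \<omega>) \<in> borel_measurable N" for n a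
      by (auto intro!: borel_measurable_sum borel_measurable_times meas)
    \<comment> \<open>Frequencies supported at i give convergence of the marginal, the unweighted
      hypothesis of the continuity theorem.\<close>
    have convi: "(\<lambda>n. CLINT \<omega>|M. iexp (s * U n i \<omega>)) \<longlonglongrightarrow> (CLINT \<omega>|N. iexp (s * U' i \<omega>))" for s
      using conv[of "\<lambda>j. if j = i then s else 0"] J i by (simp add: if_distrib[of "\<lambda>x. x * _"] cong: if_cong)
    have IH: "(\<lambda>n. CLINT \<omega>|M. complex_of_real (\<Prod>j\<in>I. h j (U n j \<omega>)) * iexp (\<Sum>j\<in>J. a j * U n j \<omega>))
     \<longlonglongrightarrow> (CLINT \<omega>|N. complex_of_real (\<Prod>j\<in>I. h j (U' j \<omega>)) * iexp (\<Sum>j\<in>J. a j * U' j \<omega>))" for a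
      by (rule insert.IH[OF I])
    have sumeq: "s * x i + c * (\<Sum>j\<in>J. a j * x j) = (\<Sum>j\<in>J. ((if j = i then s else 0) + c * a j) * x j)"
      for s c and x :: "'j \<Rightarrow> real"
      using J i by (simp add: distrib_right sum.distrib sum_distrib_left if_distrib[of "\<lambda>x. x * _"] mult.assoc cong: if_cong)
    note sumeqM = sumeq[of _ "\<lambda>j. U n j \<omega>" for n \<omega>] and sumeqN = sumeq[of _ "\<lambda>j. U' j \<omega>" for \<omega>]
    \<comment> \<open>Weights have to be real, so the exponential is split into cosine and sine.
      Times \<open>iexp (s * U n i \<omega>)\<close> these are again combinations of exponentials of
      linear forms, with s at i added to plus or minus a, and the induction hypothesis covers
      them.\<close>
    have cs: "complex_of_real (A * cos \<theta>) * iexp t = (complex_of_real A * iexp (t + 1 * \<theta>) + complex_of_real A * iexp (t + (-1) * \<theta>)) / 2"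
       "complex_of_real (A * sin \<theta>) * iexp t = (complex_of_real A * iexp (t + 1 * \<theta>) - complex_of_real A * iexp (t + (-1) * \<theta>)) * (- \<i> / 2)"
      for A \<theta> t :: real
      by (auto simp: complex_eq_iff Re_exp Im_exp cos_add sin_add cos_diff sin_diff field_simps)
    have intM: "integrable M (\<lambda>\<omega>. complex_of_real (\<Prod>j\<in>I. h j (U n j \<omega>)) * iexp (\<Sum>j\<in>J. a j * U n j \<omega>))" for n a
      using prod_le by (intro M.integrable_const_bound[where B=1]) (auto simp: norm_mult simp del: of_real_prod of_real_sum)
    have intN: "integrable N (\<lambda>\<omega>. complex_of_real (\<Prod>j\<in>I. h j (U' j \<omega>)) * iexp (\<Sum>j\<in>J. a j * U' j \<omega>))" for a
      using prod_le by (intro N.integrable_const_bound[where B=1]) (auto simp: norm_mult simp del: of_real_prod of_real_sum)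
    have C: "(\<lambda>n. LINT \<omega>|M. ((\<Prod>j\<in>I. h j (U n j \<omega>)) * cos (\<Sum>j\<in>J. a j * U n j \<omega>)) * h i (U n i \<omega>))
       \<longlonglongrightarrow> (LINT \<omega>|N. ((\<Prod>j\<in>I. h j (U' j \<omega>)) * cos (\<Sum>j\<in>J. a j * U' j \<omega>)) * h i (U' i \<omega>))"
    proof (rule weighted_levy_continuity[OF M N _ _ _ _ _ _ convi, where h="h i"])
      fix s
      show "(\<lambda>n. CLINT \<omega>|M. complex_of_real ((\<Prod>j\<in>I. h j (U n j \<omega>)) * cos (\<Sum>j\<in>J. a j * U n j \<omega>)) * iexp (s * U n i \<omega>))
       \<longlonglongrightarrow> (CLINT \<omega>|N. complex_of_real ((\<Prod>j\<in>I. h j (U' j \<omega>)) * cos (\<Sum>j\<in>J. a j * U' j \<omega>)) * iexp (s * U' i \<omega>))"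
        unfolding cs sumeqM sumeqN integral_divide_zero
        unfolding Bochner_Integration.integral_add[OF intM intM] Bochner_Integration.integral_add[OF intN intN]
        by (intro tendsto_intros IH) auto
    qed (use h prod_le in \<open>auto simp: abs_mult intro!: mult_le_one\<close>)
    have S: "(\<lambda>n. LINT \<omega>|M. ((\<Prod>j\<in>I. h j (U n j \<omega>)) * sin (\<Sum>j\<in>J. a j * U n j \<omega>)) * h i (U n i \<omega>))
       \<longlonglongrightarrow> (LINT \<omega>|N. ((\<Prod>j\<in>I. h j (U' j \<omega>)) * sin (\<Sum>j\<in>J. a j * U' j \<omega>)) * h i (U' i \<omega>))"
    proof (rule weighted_levy_continuity[OF M N _ _ _ _ _ _ convi, where h="h i"])
      fix s
      show "(\<lambda>n. CLINT \<omega>|M. complex_of_real ((\<Prod>j\<in>I. h j (U n j \<omega>)) * sin (\<Sum>j\<in>J. a j * U n j \<omega>)) * iexp (s * U n i \<omega>))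
       \<longlonglongrightarrow> (CLINT \<omega>|N. complex_of_real ((\<Prod>j\<in>I. h j (U' j \<omega>)) * sin (\<Sum>j\<in>J. a j * U' j \<omega>)) * iexp (s * U' i \<omega>))"
        unfolding cs sumeqM sumeqN integral_mult_left_zero
        unfolding Bochner_Integration.integral_diff[OF intM intM] Bochner_Integration.integral_diff[OF intN intN]
        by (intro tendsto_intros IH) auto
    qed (use h prod_le in \<open>auto simp: abs_mult intro!: mult_le_one\<close>)
    have split: "complex_of_real (\<Prod>j\<in>insert i I. h j (x j)) * iexp \<theta> =
      complex_of_real (((\<Prod>j\<in>I. h j (x j)) * cos \<theta>) * h i (x i)) + \<i> * complex_of_real (((\<Prod>j\<in>I. h j (x j)) * sin \<theta>) * h i (x i))"
      for x :: "'j \<Rightarrow> real" and \<theta> :: real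
      using insert.hyps by (auto simp: complex_eq_iff Re_exp Im_exp simp del: of_real_prod)
    have b: "\<bar>((\<Prod>j\<in>I. h j (x j)) * cos \<theta>) * h i (x i)\<bar> \<le> 1" "\<bar>((\<Prod>j\<in>I. h j (x j)) * sin \<theta>) * h i (x i)\<bar> \<le> 1"
      for x :: "'j \<Rightarrow> real" and \<theta>
      using prod_le h by (auto simp: abs_mult intro!: mult_le_one)
    have iM: "integrable M (\<lambda>\<omega>. complex_of_real (((\<Prod>j\<in>I. h j (U n j \<omega>)) * cos (\<Sum>j\<in>J. a j * U n j \<omega>)) * h i (U n i \<omega>)))"
       "integrable M (\<lambda>\<omega>. \<i> * complex_of_real (((\<Prod>j\<in>I. h j (U n j \<omega>)) * sin (\<Sum>j\<in>J. a j * U n j \<omega>)) * h i (U n i \<omega>)))" for n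
      using b[of "\<lambda>j. U n j \<omega>" for \<omega>] by (auto intro!: integrable_mult_right integrable_of_real M.integrable_const_bound[where B=1] simp del: of_real_mult)
    have iN: "integrable N (\<lambda>\<omega>. complex_of_real (((\<Prod>j\<in>I. h j (U' j \<omega>)) * cos (\<Sum>j\<in>J. a j * U' j \<omega>)) * h i (U' i \<omega>)))"
       "integrable N (\<lambda>\<omega>. \<i> * complex_of_real (((\<Prod>j\<in>I. h j (U' j \<omega>)) * sin (\<Sum>j\<in>J. a j * U' j \<omega>)) * h i (U' i \<omega>)))"
      using b[of "\<lambda>j. U' j \<omega>" for \<omega>] by (auto intro!: integrable_mult_right integrable_of_real N.integrable_const_bound[where B=1] simp del: of_real_mult)
    show ?case
      unfolding split Bochner_Integration.integral_add[OF iM] Bochner_Integration.integral_add[OF iN]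
        integral_mult_right_zero integral_complex_of_real
      by (intro tendsto_intros C S)
  qed
  have "(\<lambda>n. complex_of_real (LINT \<omega>|M. (\<Prod>j\<in>J. h j (U n j \<omega>)))) \<longlonglongrightarrow> complex_of_real (LINT \<omega>|N. (\<Prod>j\<in>J. h j (U' j \<omega>)))"
    using claim[OF J order_refl, of "\<lambda>_. 0"] by (simp del: of_real_prod)
  then show ?thesis by (simp add: tendsto_of_real_iff)
qed

text \<open>A continuous ramp from 0 at x to 1 at y in each coordinate gives a product lying between
  the indicators of the two orthants. The gap between x and y replaces the continuity that
  indicators lack, so mass of the limit law on the boundary of an orthant does no harm.\<close>

lemma cramer_wold_orthant:
  fixes U :: "nat \<Rightarrow> 'j \<Rightarrow> 'a \<Rightarrow> real" and U' :: "'j \<Rightarrow> 'b \<Rightarrow> real"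
  assumes M: "prob_space M" and N: "prob_space N" and J: "finite J"
    and meas: "\<And>n j. j \<in> J \<Longrightarrow> U n j \<in> borel_measurable M" "\<And>j. j \<in> J \<Longrightarrow> U' j \<in> borel_measurable N"
    and conv: "\<And>a. (\<lambda>n. CLINT \<omega>|M. iexp (\<Sum>j\<in>J. a j * U n j \<omega>)) \<longlonglongrightarrow> (CLINT \<omega>|N. iexp (\<Sum>j\<in>J. a j * U' j \<omega>))"
    and xy: "x < y" and e: "0 < e"
  shows "\<forall>\<^sub>F n in sequentially. measure M {\<omega>\<in>space M. \<forall>j\<in>J. y < U n j \<omega>} \<le> measure N {\<omega>\<in>space N. \<forall>j\<in>J. x < U' j \<omega>} + e"
    and "\<forall>\<^sub>F n in sequentially. measure N {\<omega>\<in>space N. \<forall>j\<in>J. y < U' j \<omega>} \<le> measure M {\<omega>\<in>space M. \<forall>j\<in>J. x < U n j \<omega>} + e"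
proof -
  interpret M: prob_space M by fact
  interpret N: prob_space N by fact
  define h where "h t = 1 - cts_step x y t" for t
  have h01: "0 \<le> h t" "h t \<le> 1" for t
    using xy by (auto simp: h_def cts_step_def field_simps)
  have h_cont: "isCont h t" for t
  proof -
    have "continuous_on UNIV (cts_step x y)"
      by (rule uniformly_continuous_imp_continuous[OF cts_step_uniformly_continuous[OF xy]])
    then have "continuous_on UNIV h" unfolding h_def by (intro continuous_intros)
    then show ?thesis by (simp add: continuous_on_eq_continuous_at)
  qed
  have hm: "h \<in> borel_measurable borel"
    using h_cont by (intro borel_measurable_continuous_onI continuous_at_imp_continuous_on) auto
  have sandwich: "measure L {\<omega>\<in>space L. \<forall>j\<in>J. y < T j \<omega>} \<le> (LINT \<omega>|L. (\<Prod>j\<in>J. h (T j \<omega>))) \<and>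
      (LINT \<omega>|L. (\<Prod>j\<in>J. h (T j \<omega>))) \<le> measure L {\<omega>\<in>space L. \<forall>j\<in>J. x < T j \<omega>}"
    if L: "prob_space L" and [measurable]: "\<And>j. j \<in> J \<Longrightarrow> T j \<in> borel_measurable L" for L :: "'c measure" and T
  proof -
    interpret L: prob_space L by fact
    have bd: "0 \<le> (\<Prod>j\<in>J. h (T j \<omega>)) \<and> (\<Prod>j\<in>J. h (T j \<omega>)) \<le> 1" for \<omega>
      using h01 by (auto intro!: prod_nonneg prod_le_1)
    have int: "integrable L (\<lambda>\<omega>. \<Prod>j\<in>J. h (T j \<omega>))"
      using bd by (intro L.integrable_const_bound[where B=1])
        (auto intro!: borel_measurable_prod measurable_compose[OF _ hm] that simp: abs_le_iff intro: order_trans[of _ 0])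
    have set[measurable]: "{\<omega>\<in>space L. \<forall>j\<in>J. t < T j \<omega>} \<in> sets L" for t
      using J by measurable
    have "measure L {\<omega>\<in>space L. \<forall>j\<in>J. y < T j \<omega>} = (LINT \<omega>|L. indicator {\<omega>\<in>space L. \<forall>j\<in>J. y < T j \<omega>} \<omega>)"
      by (simp add: Int_absorb1 subset_eq)
    also have "\<dots> \<le> (LINT \<omega>|L. (\<Prod>j\<in>J. h (T j \<omega>)))"
    proof (intro integral_mono int)
      show "integrable L (indicator {\<omega>\<in>space L. \<forall>j\<in>J. y < T j \<omega>} :: 'c \<Rightarrow> real)" by (simp add: L.emeasure_eq_measure)
      fix \<omega>
      have "(\<Prod>j\<in>J. h (T j \<omega>)) = 1" if "\<forall>j\<in>J. y < T j \<omega>"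
        using that xy by (intro prod.neutral) (auto simp: h_def cts_step_def)
      then show "indicator {\<omega>\<in>space L. \<forall>j\<in>J. y < T j \<omega>} \<omega> \<le> (\<Prod>j\<in>J. h (T j \<omega>))"
        using bd by (auto simp: indicator_def)
    qed
    finally have 1: "measure L {\<omega>\<in>space L. \<forall>j\<in>J. y < T j \<omega>} \<le> (LINT \<omega>|L. (\<Prod>j\<in>J. h (T j \<omega>)))" .
    have "(LINT \<omega>|L. (\<Prod>j\<in>J. h (T j \<omega>))) \<le> (LINT \<omega>|L. indicator {\<omega>\<in>space L. \<forall>j\<in>J. x < T j \<omega>} \<omega>)"
    proof (intro integral_mono int)
      show "integrable L (indicator {\<omega>\<in>space L. \<forall>j\<in>J. x < T j \<omega>} :: 'c \<Rightarrow> real)" by (simp add: L.emeasure_eq_measure)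
      fix \<omega> assume \<omega>: "\<omega> \<in> space L"
      have "(\<Prod>j\<in>J. h (T j \<omega>)) = 0" if "\<not> (\<forall>j\<in>J. x < T j \<omega>)"
        using that J by (auto simp: prod_zero_iff h_def cts_step_def not_less)
      then show "(\<Prod>j\<in>J. h (T j \<omega>)) \<le> indicator {\<omega>\<in>space L. \<forall>j\<in>J. x < T j \<omega>} \<omega>"
        using bd \<omega> by (auto simp: indicator_def)
    qed
    also have "\<dots> = measure L {\<omega>\<in>space L. \<forall>j\<in>J. x < T j \<omega>}"
      by (simp add: Int_absorb1 subset_eq)
    finally show ?thesis using 1 by simp
  qed
  have "(\<lambda>n. LINT \<omega>|M. (\<Prod>j\<in>J. h (U n j \<omega>))) \<longlonglongrightarrow> (LINT \<omega>|N. (\<Prod>j\<in>J. h (U' j \<omega>)))"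
    using h01 by (intro cramer_wold_prod[OF M N J meas conv]) (auto simp: h_cont abs_le_iff intro: order_trans[of _ 0])
  then have "\<forall>\<^sub>F n in sequentially. dist (LINT \<omega>|M. (\<Prod>j\<in>J. h (U n j \<omega>))) (LINT \<omega>|N. (\<Prod>j\<in>J. h (U' j \<omega>))) < e"
    using e by (rule tendstoD)
  then have ev: "\<forall>\<^sub>F n in sequentially. \<bar>(LINT \<omega>|M. (\<Prod>j\<in>J. h (U n j \<omega>))) - (LINT \<omega>|N. (\<Prod>j\<in>J. h (U' j \<omega>)))\<bar> < e"
    by (simp add: dist_real_def)
  have sM: "measure M {\<omega>\<in>space M. \<forall>j\<in>J. y < U n j \<omega>} \<le> (LINT \<omega>|M. (\<Prod>j\<in>J. h (U n j \<omega>))) \<and>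
      (LINT \<omega>|M. (\<Prod>j\<in>J. h (U n j \<omega>))) \<le> measure M {\<omega>\<in>space M. \<forall>j\<in>J. x < U n j \<omega>}" for n
    by (rule sandwich[OF M]) (rule meas)
  note sN = sandwich[OF N, of U', OF meas(2)]
  show "\<forall>\<^sub>F n in sequentially. measure M {\<omega>\<in>space M. \<forall>j\<in>J. y < U n j \<omega>} \<le> measure N {\<omega>\<in>space N. \<forall>j\<in>J. x < U' j \<omega>} + e"
    using ev
  proof eventually_elim
    case (elim n) then show ?case using sM[of n] sN by linarith
  qed
  show "\<forall>\<^sub>F n in sequentially. measure N {\<omega>\<in>space N. \<forall>j\<in>J. y < U' j \<omega>} \<le> measure M {\<omega>\<in>space M. \<forall>j\<in>J. x < U n j \<omega>} + e"
    using ev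
  proof eventually_elim
    case (elim n) then show ?case using sM[of n] sN by linarith
  qed
qed

section \<open>Centred normal variables\<close>

text \<open>The centred normal law of variance v, given by its characteristic function: the point
  mass at 0 is the case v = 0, and sums and limits are read off without separating degenerate
  laws.\<close>

definition normal_char :: "'a measure \<Rightarrow> ('a \<Rightarrow> real) \<Rightarrow> real \<Rightarrow> bool" where
  "normal_char M Y v \<longleftrightarrow> Y \<in> borel_measurable M \<and> 0 \<le> v \<and>
    (\<forall>t. (CLINT \<omega>|M. iexp (t * Y \<omega>)) = complex_of_real (exp (- (v * t\<^sup>2) / 2)))"

lemma char_distr:
  assumes [measurable]: "Y \<in> borel_measurable M"
  shows "char (distr M borel Y) t = (CLINT \<omega>|M. iexp (t * Y \<omega>))"
  unfolding char_def by (subst integral_distr) auto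

context prob_space
begin

lemma distributed_normal_imp_normal_char:
  assumes Y: "distributed M lborel Y (normal_density 0 \<sigma>)" and \<sigma>: "0 < \<sigma>"
  shows "normal_char M Y (\<sigma>\<^sup>2)"
proof -
  have [measurable]: "Y \<in> borel_measurable M"
    using distributed_measurable[OF Y] by simp
  have "distributed M lborel (\<lambda>\<omega>. (Y \<omega> - 0) / \<sigma>) std_normal_density"
    using normal_standard_normal_convert[OF \<sigma>, of Y 0] Y by simp
  then have "distr M lborel (\<lambda>\<omega>. Y \<omega> / \<sigma>) = std_normal_distribution"
    by (simp add: distributed_distr_eq_density)
  moreover have "distr M lborel (\<lambda>\<omega>. Y \<omega> / \<sigma>) = distr M borel (\<lambda>\<omega>. Y \<omega> / \<sigma>)"
    by (rule distr_cong) simp_all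
  ultimately have *: "distr M borel (\<lambda>\<omega>. Y \<omega> / \<sigma>) = std_normal_distribution" by simp
  have "(CLINT \<omega>|M. iexp (t * Y \<omega>)) = complex_of_real (exp (- (\<sigma>\<^sup>2 * t\<^sup>2) / 2))" for t
  proof -
    have "(CLINT \<omega>|M. iexp (t * Y \<omega>)) = (CLINT \<omega>|M. iexp ((t * \<sigma>) * (Y \<omega> / \<sigma>)))"
      using \<sigma> by simp
    also have "\<dots> = char std_normal_distribution (t * \<sigma>)"
      unfolding *[symmetric] by (rule char_distr[symmetric]) simp
    also have "\<dots> = complex_of_real (exp (- (\<sigma>\<^sup>2 * t\<^sup>2) / 2))"
      by (simp only: char_std_normal_distribution power_mult_distrib mult.commute)
    finally show ?thesis .
  qed
  then show ?thesis by (simp add: normal_char_def)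
qed

lemma normal_char_imp_distributed:
  assumes Y: "normal_char M Y v" and v: "0 < v"
  shows "distributed M lborel Y (normal_density 0 (sqrt v))"
proof -
  have [measurable]: "Y \<in> borel_measurable M" using Y by (simp add: normal_char_def)
  have "distr M borel (\<lambda>\<omega>. Y \<omega> / sqrt v) = std_normal_distribution"
  proof (rule Levy_uniqueness)
    show "real_distribution (distr M borel (\<lambda>\<omega>. Y \<omega> / sqrt v))" by simp
    show "real_distribution std_normal_distribution" by (rule real_dist_normal_dist)
    show "char (distr M borel (\<lambda>\<omega>. Y \<omega> / sqrt v)) = char std_normal_distribution"
    proof
      fix t
      have "char (distr M borel (\<lambda>\<omega>. Y \<omega> / sqrt v)) t = (CLINT \<omega>|M. iexp ((t / sqrt v) * Y \<omega>))"
        by (subst char_distr) simp_all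
      also have "\<dots> = complex_of_real (exp (- (v * (t / sqrt v)\<^sup>2) / 2))"
        using Y by (simp only: normal_char_def)
      also have "v * (t / sqrt v)\<^sup>2 = t\<^sup>2"
        using v by (simp add: power_divide)
      finally show "char (distr M borel (\<lambda>\<omega>. Y \<omega> / sqrt v)) t = char std_normal_distribution t"
        by (simp add: char_std_normal_distribution)
    qed
  qed
  moreover have "distr M lborel (\<lambda>\<omega>. (Y \<omega> - 0) / sqrt v) = distr M borel (\<lambda>\<omega>. Y \<omega> / sqrt v)"
    by (rule distr_cong) simp_all
  ultimately have "distributed M lborel (\<lambda>\<omega>. (Y \<omega> - 0) / sqrt v) std_normal_density"
    unfolding distributed_def by simp
  then show ?thesis
    using v by (subst normal_standard_normal_convert) auto
qed

lemma normal_char_0_AE: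
  assumes Y: "normal_char M Y 0"
  shows "AE \<omega> in M. Y \<omega> = 0"
proof -
  have [measurable]: "Y \<in> borel_measurable M" using Y by (simp add: normal_char_def)
  have eq: "distr M borel Y = return borel 0"
  proof (rule Levy_uniqueness)
    show "real_distribution (distr M borel Y)" by simp
    show "real_distribution (return borel 0)"
      by (intro real_distribution.intro real_distribution_axioms.intro prob_space_return) auto
    show "char (distr M borel Y) = char (return borel 0)"
    proof
      fix t
      have "char (return borel 0) t = 1"
        unfolding char_def by (subst integral_return) auto
      then show "char (distr M borel Y) t = char (return borel 0) t"
        using Y by (simp add: char_distr normal_char_def)
    qed
  qed
  have "AE x in distr M borel Y. x = 0"
    unfolding eq by (subst AE_return) auto
  then show ?thesis by (subst (asm) AE_distr_iff) auto
qed

lemma normal_char_moments: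
  assumes Y: "normal_char M Y v"
  shows "integrable M Y" "expectation Y = 0" "integrable M (\<lambda>\<omega>. (Y \<omega>)\<^sup>2)" "expectation (\<lambda>\<omega>. (Y \<omega>)\<^sup>2) = v"
    "integrable M (\<lambda>\<omega>. exp (Y \<omega>))" "expectation (\<lambda>\<omega>. exp (Y \<omega>)) = exp (v / 2)"
proof -
  have [measurable]: "Y \<in> borel_measurable M" using Y by (simp add: normal_char_def)
  have "0 \<le> v" using Y by (simp add: normal_char_def)
  then consider "v = 0" | "0 < v" by linarith
  then have "integrable M Y \<and> expectation Y = 0 \<and> integrable M (\<lambda>\<omega>. (Y \<omega>)\<^sup>2) \<and> expectation (\<lambda>\<omega>. (Y \<omega>)\<^sup>2) = v
    \<and> integrable M (\<lambda>\<omega>. exp (Y \<omega>)) \<and> expectation (\<lambda>\<omega>. exp (Y \<omega>)) = exp (v / 2)"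
  proof cases
    case 1
    then have ae: "AE \<omega> in M. Y \<omega> = 0" using normal_char_0_AE Y by simp
    have "integrable M Y \<longleftrightarrow> integrable M (\<lambda>_. 0::real)" "integrable M (\<lambda>\<omega>. (Y \<omega>)\<^sup>2) \<longleftrightarrow> integrable M (\<lambda>_. 0::real)"
      "integrable M (\<lambda>\<omega>. exp (Y \<omega>)) \<longleftrightarrow> integrable M (\<lambda>_. 1::real)"
      by (rule integrable_cong_AE; use ae in auto)+
    moreover have "expectation Y = expectation (\<lambda>_. 0)" "expectation (\<lambda>\<omega>. (Y \<omega>)\<^sup>2) = expectation (\<lambda>_. 0)"
      "expectation (\<lambda>\<omega>. exp (Y \<omega>)) = expectation (\<lambda>_. 1)"
      by (rule integral_cong_AE; use ae in auto)+
    ultimately show ?thesis using 1 by (simp add: prob_space)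
  next
    case 2
    define \<sigma> where "\<sigma> = sqrt v"
    have \<sigma>: "0 < \<sigma>" "\<sigma>\<^sup>2 = v" using 2 by (simp_all add: \<sigma>_def)
    have D: "distributed M lborel Y (normal_density 0 \<sigma>)"
      unfolding \<sigma>_def by (rule normal_char_imp_distributed[OF Y 2])
    have i1: "integrable M Y"
      using distributed_integrable[OF D, of "\<lambda>x. x"] integrable_normal_moment[OF \<sigma>(1), of 0 1] by simp
    have i2: "integrable M (\<lambda>\<omega>. (Y \<omega>)\<^sup>2)"
      using distributed_integrable[OF D, of "\<lambda>x. x\<^sup>2"] integrable_normal_moment[OF \<sigma>(1), of 0 2] by simp
    have e1: "expectation Y = 0" using normal_distributed_expectation[OF \<sigma>(1) D] .
    have e2: "expectation (\<lambda>\<omega>. (Y \<omega>)\<^sup>2) = v"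
      using normal_distributed_variance[OF \<sigma>(1) D] e1 \<sigma>(2) by simp
    \<comment> \<open>Completing the square: multiplying the density by exp x moves the mean from 0
      to the variance and costs the factor exp (v / 2).\<close>
    have tilt: "normal_density 0 \<sigma> x * exp x = exp (v / 2) * normal_density (\<sigma>\<^sup>2) \<sigma> x" for x
    proof -
      have "- (x\<^sup>2 / (2 * \<sigma>\<^sup>2)) + x = \<sigma>\<^sup>2 / 2 + - ((x - \<sigma>\<^sup>2)\<^sup>2 / (2 * \<sigma>\<^sup>2))"
        using \<sigma>(1) by (simp add: field_simps power2_eq_square)
      then have "exp (- (x\<^sup>2 / (2 * \<sigma>\<^sup>2))) * exp x = exp (\<sigma>\<^sup>2 / 2) * exp (- ((x - \<sigma>\<^sup>2)\<^sup>2 / (2 * \<sigma>\<^sup>2)))"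
        unfolding exp_add[symmetric] by (rule arg_cong)
      then show ?thesis by (simp add: normal_density_def \<sigma>(2))
    qed
    have i3: "integrable M (\<lambda>\<omega>. exp (Y \<omega>))"
      using distributed_integrable[OF D, of exp] \<sigma>(1) by (simp add: tilt)
    have e3: "expectation (\<lambda>\<omega>. exp (Y \<omega>)) = exp (v / 2)"
      using distributed_integral[OF D, of exp] \<sigma>(1) by (simp add: tilt)
    show ?thesis using i1 i2 i3 e1 e2 e3 by blast
  qed
  then show "integrable M Y" "expectation Y = 0" "integrable M (\<lambda>\<omega>. (Y \<omega>)\<^sup>2)" "expectation (\<lambda>\<omega>. (Y \<omega>)\<^sup>2) = v"
    "integrable M (\<lambda>\<omega>. exp (Y \<omega>))" "expectation (\<lambda>\<omega>. exp (Y \<omega>)) = exp (v / 2)"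
    by auto
qed

lemma normal_char_imp_gaussian_variable:
  assumes Y: "normal_char M Y v"
  shows "gaussian_variable M Y"
proof -
  consider "v = 0" | "0 < v" using Y by (force simp: normal_char_def)
  then show ?thesis
  proof cases
    case 1
    then show ?thesis using normal_char_0_AE Y by (auto simp: gaussian_variable_def normal_char_def)
  next
    case 2
    then show ?thesis
      using normal_char_imp_distributed[OF Y 2] Y real_sqrt_gt_zero[OF 2]
      unfolding gaussian_variable_def normal_char_def by blast
  qed
qed

lemma gaussian_variable_integrable:
  assumes Y: "gaussian_variable M Y"
  shows "integrable M Y" "integrable M (\<lambda>\<omega>. (Y \<omega>)\<^sup>2)"
proof -
  have [measurable]: "Y \<in> borel_measurable M" using Y by (simp add: gaussian_variable_def)
  have "integrable M Y \<and> integrable M (\<lambda>\<omega>. (Y \<omega>)\<^sup>2)"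
    using Y unfolding gaussian_variable_def
  proof (elim conjE disjE exE)
    fix c assume "AE x in M. Y x = c"
    then have ae: "AE x in M. Y x = c" .
    have "integrable M Y \<longleftrightarrow> integrable M (\<lambda>_. c)" "integrable M (\<lambda>\<omega>. (Y \<omega>)\<^sup>2) \<longleftrightarrow> integrable M (\<lambda>_. c\<^sup>2)"
      by (rule integrable_cong_AE; use ae in auto)+
    then show ?thesis by simp
  next
    fix m \<sigma> :: real assume \<sigma>: "0 < \<sigma>" and D: "distributed M lborel Y (normal_density m \<sigma>)"
    have 1: "integrable M (\<lambda>\<omega>. Y \<omega> - m)"
      using distributed_integrable[OF D, of "\<lambda>x. x - m"] integrable_normal_moment[OF \<sigma>, of m 1] by simp
    have 2: "integrable M (\<lambda>\<omega>. (Y \<omega> - m)\<^sup>2)"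
      using distributed_integrable[OF D, of "\<lambda>x. (x - m)\<^sup>2"] integrable_normal_moment[OF \<sigma>, of m 2] by simp
    have "integrable M (\<lambda>\<omega>. (Y \<omega> - m) + m)" using 1 by (intro Bochner_Integration.integrable_add) auto
    then have i: "integrable M Y" by simp
    have "integrable M (\<lambda>\<omega>. (Y \<omega> - m)\<^sup>2 + 2 * m * Y \<omega> - m\<^sup>2)"
      using 2 i by (intro Bochner_Integration.integrable_add Bochner_Integration.integrable_diff) auto
    moreover have "(\<lambda>\<omega>. (Y \<omega> - m)\<^sup>2 + 2 * m * Y \<omega> - m\<^sup>2) = (\<lambda>\<omega>. (Y \<omega>)\<^sup>2)"
      by (simp add: power2_eq_square algebra_simps)
    ultimately show ?thesis using i by simp
  qed
  then show "integrable M Y" "integrable M (\<lambda>\<omega>. (Y \<omega>)\<^sup>2)" by auto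
qed

lemma gaussian_variable_imp_normal_char:
  assumes Y: "gaussian_variable M Y" and E: "expectation Y = 0"
  shows "normal_char M Y (expectation (\<lambda>\<omega>. (Y \<omega>)\<^sup>2))"
proof -
  have [measurable]: "Y \<in> borel_measurable M" using Y by (simp add: gaussian_variable_def)
  show ?thesis
    using Y unfolding gaussian_variable_def
  proof (elim conjE disjE exE)
    fix c assume c: "AE x in M. Y x = c"
    then have "expectation Y = expectation (\<lambda>_. c)" by (intro integral_cong_AE) auto
    then have "c = 0" using E by (simp add: prob_space)
    then have ae: "AE x in M. Y x = 0" using c by simp
    then have "expectation (\<lambda>\<omega>. (Y \<omega>)\<^sup>2) = expectation (\<lambda>_. 0)" by (intro integral_cong_AE) auto
    moreover have "(CLINT \<omega>|M. iexp (t * Y \<omega>)) = (CLINT \<omega>|M. 1)" for t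
      using ae by (intro integral_cong_AE) auto
    ultimately show ?thesis by (simp add: normal_char_def prob_space)
  next
    fix m \<sigma> :: real assume \<sigma>: "0 < \<sigma>" and D: "distributed M lborel Y (normal_density m \<sigma>)"
    have m: "m = 0" using normal_distributed_expectation[OF \<sigma> D] E by simp
    have "expectation (\<lambda>\<omega>. (Y \<omega>)\<^sup>2) = \<sigma>\<^sup>2"
      using normal_distributed_variance[OF \<sigma> D] E by simp
    then show ?thesis using distributed_normal_imp_normal_char[of Y \<sigma>] D \<sigma> m by simp
  qed
qed

text \<open>Markov's inequality for exp Y and exp (- Y), with the exponent not optimized: a tail exp
  (- t) is the form that the chaining bound consumes.\<close>

lemma normal_char_tail:
  assumes Y: "normal_char M Y v"
  shows "prob {\<omega>\<in>space M. t < \<bar>Y \<omega>\<bar>} \<le> 2 * exp (v / 2) * exp (- t)"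
proof -
  have m: "Y \<in> borel_measurable M" using Y by (simp add: normal_char_def)
  have neg: "normal_char M (\<lambda>\<omega>. - Y \<omega>) v"
  proof -
    have "(CLINT \<omega>|M. iexp (t * - Y \<omega>)) = (CLINT \<omega>|M. iexp (- t * Y \<omega>))" for t by simp
    then show ?thesis using Y unfolding normal_char_def by (simp only: power2_minus) auto
  qed
  have tail: "prob {\<omega>\<in>space M. t < X \<omega>} \<le> exp (v / 2) * exp (- t)" if X: "normal_char M X v" for X
  proof -
    have [measurable]: "X \<in> borel_measurable M" using X by (simp add: normal_char_def)
    have "prob {\<omega>\<in>space M. t < X \<omega>} \<le> prob {\<omega>\<in>space M. exp t \<le> exp (X \<omega>)}"
      by (intro finite_measure_mono) auto
    also have "\<dots> \<le> expectation (\<lambda>\<omega>. exp (X \<omega>)) / exp t"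
      by (rule integral_Markov_inequality_measure[where A = "space M" and M=M, simplified]) (use normal_char_moments[OF X] in auto)
    also have "\<dots> = exp (v / 2) * exp (- t)"
      using normal_char_moments[OF X] by (simp add: exp_minus field_simps)
    finally show ?thesis .
  qed
  have "prob {\<omega>\<in>space M. t < \<bar>Y \<omega>\<bar>} \<le> prob ({\<omega>\<in>space M. t < Y \<omega>} \<union> {\<omega>\<in>space M. t < - Y \<omega>})"
    using m by (intro finite_measure_mono) auto
  also have "\<dots> \<le> prob {\<omega>\<in>space M. t < Y \<omega>} + prob {\<omega>\<in>space M. t < - Y \<omega>}"
    using m by (intro measure_Un_le) auto
  finally show ?thesis using tail[OF Y] tail[OF neg] by simp
qed

text \<open>Characteristic functions converge by dominated convergence, so normality survives almost
  sure limits; this carries the finite-dimensional laws from a countable dense set to all of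
  Z.\<close>

lemma normal_char_lim:
  assumes Y: "\<And>n. normal_char M (Y n) (v n)" and lim: "AE \<omega> in M. (\<lambda>n. Y n \<omega>) \<longlonglongrightarrow> Y' \<omega>"
    and v: "v \<longlonglongrightarrow> v'" and m[measurable]: "Y' \<in> borel_measurable M"
  shows "normal_char M Y' v'"
proof -
  have [measurable]: "Y n \<in> borel_measurable M" for n using Y by (simp add: normal_char_def)
  have v0: "0 \<le> v'"
    using v by (rule LIMSEQ_le_const) (use Y in \<open>auto simp: normal_char_def\<close>)
  have "(CLINT \<omega>|M. iexp (t * Y' \<omega>)) = complex_of_real (exp (- (v' * t\<^sup>2) / 2))" for t
  proof (rule LIMSEQ_unique)
    show "(\<lambda>n. CLINT \<omega>|M. iexp (t * Y n \<omega>)) \<longlonglongrightarrow> (CLINT \<omega>|M. iexp (t * Y' \<omega>))"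
    proof (rule integral_dominated_convergence[where w="\<lambda>_. 1"])
      show "AE \<omega> in M. (\<lambda>n. iexp (t * Y n \<omega>)) \<longlonglongrightarrow> iexp (t * Y' \<omega>)"
        using lim by eventually_elim (intro tendsto_intros)
    qed auto
    have "(\<lambda>n. complex_of_real (exp (- (v n * t\<^sup>2) / 2))) \<longlonglongrightarrow> complex_of_real (exp (- (v' * t\<^sup>2) / 2))"
      by (intro tendsto_intros v) auto
    then show "(\<lambda>n. CLINT \<omega>|M. iexp (t * Y n \<omega>)) \<longlonglongrightarrow> complex_of_real (exp (- (v' * t\<^sup>2) / 2))"
      using Y by (simp add: normal_char_def)
  qed
  then show ?thesis using v0 by (simp add: normal_char_def)
qed

lemma normal_char_sum_indep:
  assumes ind: "indep_vars (\<lambda>_. borel) X I" and fin: "finite I" and X: "\<And>i. i \<in> I \<Longrightarrow> normal_char M (X i) 1"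
  shows "normal_char M (\<lambda>\<omega>. \<Sum>i\<in>I. \<alpha> i * X i \<omega>) (\<Sum>i\<in>I. (\<alpha> i)\<^sup>2)"
proof -
  have m[measurable]: "X i \<in> borel_measurable M" if "i \<in> I" for i using X[OF that] by (simp add: normal_char_def)
  have ind': "indep_vars (\<lambda>_. borel) (\<lambda>i \<omega>. \<alpha> i * X i \<omega>) I"
    using indep_vars_compose2[OF ind, of "\<lambda>i x. \<alpha> i * x" "\<lambda>_. borel"] by simp
  have "(CLINT \<omega>|M. iexp (t * (\<Sum>i\<in>I. \<alpha> i * X i \<omega>))) = complex_of_real (exp (- ((\<Sum>i\<in>I. (\<alpha> i)\<^sup>2) * t\<^sup>2) / 2))" for t
  proof -
    have "(CLINT \<omega>|M. iexp (t * (\<Sum>i\<in>I. \<alpha> i * X i \<omega>))) = char (distr M borel (\<lambda>\<omega>. \<Sum>i\<in>I. \<alpha> i * X i \<omega>)) t"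
      by (rule char_distr[symmetric]) auto
    also have "\<dots> = (\<Prod>i\<in>I. char (distr M borel (\<lambda>\<omega>. \<alpha> i * X i \<omega>)) t)"
      by (rule char_distr_sum[OF ind'])
    also have "\<dots> = (\<Prod>i\<in>I. complex_of_real (exp (- ((\<alpha> i)\<^sup>2 * t\<^sup>2) / 2)))"
    proof (rule prod.cong[OF refl])
      fix i assume i: "i \<in> I"
      have "char (distr M borel (\<lambda>\<omega>. \<alpha> i * X i \<omega>)) t = (CLINT \<omega>|M. iexp ((t * \<alpha> i) * X i \<omega>))"
        using i by (subst char_distr) (auto simp: mult.assoc)
      also have "\<dots> = complex_of_real (exp (- (1 * (t * \<alpha> i)\<^sup>2) / 2))"
        using X[OF i] by (simp only: normal_char_def)
      finally show "char (distr M borel (\<lambda>\<omega>. \<alpha> i * X i \<omega>)) t = complex_of_real (exp (- ((\<alpha> i)\<^sup>2 * t\<^sup>2) / 2))"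
        by (simp add: power_mult_distrib mult.commute)
    qed
    also have "\<dots> = complex_of_real (exp (\<Sum>i\<in>I. - ((\<alpha> i)\<^sup>2 * t\<^sup>2) / 2))"
      using fin by (simp only: of_real_prod[symmetric] exp_sum)
    also have "(\<Sum>i\<in>I. - ((\<alpha> i)\<^sup>2 * t\<^sup>2) / 2) = - ((\<Sum>i\<in>I. (\<alpha> i)\<^sup>2) * t\<^sup>2) / 2"
      by (simp add: sum_distrib_right sum_negf sum_divide_distrib)
    finally show ?thesis .
  qed
  moreover have "0 \<le> (\<Sum>i\<in>I. (\<alpha> i)\<^sup>2)" by (intro sum_nonneg) auto
  ultimately show ?thesis by (simp add: normal_char_def)
qed

end

section \<open>Covariance matrices as bilinear forms\<close>

lemma inner_outer_product_mult:
  fixes a b u v :: "real^'n"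
  shows "inner a u * inner b v = inner a (outer_product u v *v b)"
proof -
  have "inner a (outer_product u v *v b) = (\<Sum>i\<in>UNIV. a $ i * (\<Sum>j\<in>UNIV. u $ i * v $ j * b $ j))"
    by (simp add: inner_vec_def outer_product_def matrix_vector_mult_def)
  also have "\<dots> = (\<Sum>i\<in>UNIV. a $ i * u $ i) * (\<Sum>j\<in>UNIV. b $ j * v $ j)"
    unfolding sum_product by (intro sum.cong refl) (simp add: sum_distrib_left mult_ac)
  finally show ?thesis by (simp add: inner_vec_def mult_ac)
qed

text \<open>Lets the form pass through the Bochner integral, so that matrix-valued covariances are
  handled as real integrals of products.\<close>

lemma bounded_linear_inner_matrix_vector:
  fixes a b :: "real^'n"
  shows "bounded_linear (\<lambda>A :: real^'n^'n. inner a (A *v b))"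
  unfolding linear_conv_bounded_linear[symmetric]
  by (intro linearI) (simp_all add: matrix_vector_mult_add_rdistrib inner_add_right scaleR_matrix_vector_assoc[symmetric])

lemma integral_square_sum_inner:
  fixes U :: "'j \<Rightarrow> 'a \<Rightarrow> real^'n"
  assumes int: "\<And>i j. i \<in> J \<Longrightarrow> j \<in> J \<Longrightarrow> integrable M (\<lambda>\<omega>. outer_product (U i \<omega>) (U j \<omega>))"
  shows "integrable M (\<lambda>\<omega>. (\<Sum>j\<in>J. inner (a j) (U j \<omega>))\<^sup>2)"
    "(LINT \<omega>|M. (\<Sum>j\<in>J. inner (a j) (U j \<omega>))\<^sup>2) =
      (\<Sum>i\<in>J. \<Sum>j\<in>J. inner (a i) ((LINT \<omega>|M. outer_product (U i \<omega>) (U j \<omega>)) *v a j))"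
proof -
  have eq: "(\<Sum>j\<in>J. inner (a j) (U j \<omega>))\<^sup>2 = (\<Sum>i\<in>J. \<Sum>j\<in>J. inner (a i) (outer_product (U i \<omega>) (U j \<omega>) *v a j))" for \<omega>
    unfolding power2_eq_square sum_product inner_outer_product_mult ..
  have i: "integrable M (\<lambda>\<omega>. inner (a i) (outer_product (U i \<omega>) (U j \<omega>) *v a j))" if "i \<in> J" "j \<in> J" for i j
    by (rule integrable_bounded_linear[OF bounded_linear_inner_matrix_vector int[OF that]])
  show "integrable M (\<lambda>\<omega>. (\<Sum>j\<in>J. inner (a j) (U j \<omega>))\<^sup>2)"
    unfolding eq by (intro Bochner_Integration.integrable_sum i)
  have "(LINT \<omega>|M. (\<Sum>j\<in>J. inner (a j) (U j \<omega>))\<^sup>2) =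
      (\<Sum>i\<in>J. \<Sum>j\<in>J. (LINT \<omega>|M. inner (a i) (outer_product (U i \<omega>) (U j \<omega>) *v a j)))"
    unfolding eq by (subst Bochner_Integration.integral_sum)
      (auto intro!: Bochner_Integration.integrable_sum Bochner_Integration.integral_sum i sum.cong)
  also have "\<dots> = (\<Sum>i\<in>J. \<Sum>j\<in>J. inner (a i) ((LINT \<omega>|M. outer_product (U i \<omega>) (U j \<omega>)) *v a j))"
    by (intro sum.cong refl integral_bounded_linear[OF bounded_linear_inner_matrix_vector] int)
  finally show "(LINT \<omega>|M. (\<Sum>j\<in>J. inner (a j) (U j \<omega>))\<^sup>2) =
      (\<Sum>i\<in>J. \<Sum>j\<in>J. inner (a i) ((LINT \<omega>|M. outer_product (U i \<omega>) (U j \<omega>)) *v a j))" .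
qed

section \<open>Minima of continuous functions on compact sets\<close>

lemma min_value_attained:
  fixes f :: "'z::topological_space \<Rightarrow> real"
  assumes "compact S" "S \<noteq> {}" "continuous_on S f"
  obtains z where "z \<in> S" "min_value f S = f z" "\<And>y. y \<in> S \<Longrightarrow> f z \<le> f y"
proof -
  obtain z where z: "z \<in> S" "\<forall>y\<in>S. f z \<le> f y"
    using continuous_attains_inf[OF assms] by blast
  then show ?thesis using that[of z] min_value_eqI[of z S f] by blast
qed

text \<open>By continuity a value below a on S forces one below a on a countable dense subset, so
  strict sublevel sets of the minimum are countable unions of measurable sets.\<close>

lemma borel_measurable_min_value:
  fixes h :: "'z::euclidean_space \<Rightarrow> 'a \<Rightarrow> real"
  assumes S: "compact S" "S \<noteq> {}"
    and m: "\<And>z. z \<in> S \<Longrightarrow> h z \<in> borel_measurable M"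
    and c: "\<And>\<omega>. \<omega> \<in> space M \<Longrightarrow> continuous_on S (\<lambda>z. h z \<omega>)"
  shows "(\<lambda>\<omega>. min_value (\<lambda>z. h z \<omega>) S) \<in> borel_measurable M"
proof -
  obtain D where D: "countable D" "D \<subseteq> S" "S \<subseteq> closure D" using separable by blast
  have "{\<omega>\<in>space M. min_value (\<lambda>z. h z \<omega>) S < a} = (\<Union>z\<in>D. {\<omega>\<in>space M. h z \<omega> < a})" for a
  proof (intro set_eqI iffI)
    fix \<omega> assume "\<omega> \<in> {\<omega>\<in>space M. min_value (\<lambda>z. h z \<omega>) S < a}"
    then have \<omega>: "\<omega> \<in> space M" "min_value (\<lambda>z. h z \<omega>) S < a" by auto
    obtain z where z: "z \<in> S" "min_value (\<lambda>z. h z \<omega>) S = h z \<omega>"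
      using min_value_attained[OF S c[OF \<omega>(1)]] by metis
    have "h z \<omega> < a" using z \<omega> by simp
    moreover have "((\<lambda>z. h z \<omega>) \<longlongrightarrow> h z \<omega>) (at z within S)"
      using c[OF \<omega>(1)] z(1) by (simp add: continuous_on_def)
    ultimately have "eventually (\<lambda>y. h y \<omega> < a) (at z within S)" by (intro order_tendstoD) auto
    then obtain d where d: "d > 0" "\<And>y. y \<in> S \<Longrightarrow> y \<noteq> z \<Longrightarrow> dist y z < d \<Longrightarrow> h y \<omega> < a"
      by (auto simp: eventually_at)
    obtain y where "y \<in> D" "dist y z < d" using D(3) z(1) d(1) closure_approachable by blast
    then have "y \<in> D" "h y \<omega> < a" using d(2)[of y] D(2) \<open>h z \<omega> < a\<close> by (cases "y = z"; auto)+
    then show "\<omega> \<in> (\<Union>z\<in>D. {\<omega>\<in>space M. h z \<omega> < a})" using \<omega> by auto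
  next
    fix \<omega> assume "\<omega> \<in> (\<Union>z\<in>D. {\<omega>\<in>space M. h z \<omega> < a})"
    then obtain z where z: "z \<in> D" "\<omega> \<in> space M" "h z \<omega> < a" by auto
    obtain x where "min_value (\<lambda>z. h z \<omega>) S = h x \<omega>" "\<And>y. y \<in> S \<Longrightarrow> h x \<omega> \<le> h y \<omega>"
      using min_value_attained[OF S c[OF z(2)]] by metis
    then show "\<omega> \<in> {\<omega>\<in>space M. min_value (\<lambda>z. h z \<omega>) S < a}"
      using z D(2) by (metis (mono_tags, lifting) mem_Collect_eq order_le_less_trans subsetD)
  qed
  moreover have "(\<Union>z\<in>D. {\<omega>\<in>space M. h z \<omega> < a}) \<in> sets M" for a
    using D m by (intro sets.countable_UN' D(1)) (auto simp: borel_measurable_iff_less subset_eq)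
  ultimately show ?thesis unfolding borel_measurable_iff_less by simp
qed

section \<open>First-order expansion of the optimal value\<close>

lemma GDERIV_line_DERIV:
  fixes f :: "'s::real_inner \<Rightarrow> real"
  assumes "GDERIV f (m + t *\<^sub>R v) :> D"
  shows "((\<lambda>t. f (m + t *\<^sub>R v)) has_real_derivative inner v D) (at t)"
proof -
  have 1: "((\<lambda>t. m + t *\<^sub>R v) has_derivative (\<lambda>h. h *\<^sub>R v)) (at t)"
    by (auto intro!: derivative_eq_intros)
  have "((\<lambda>t. f (m + t *\<^sub>R v)) has_derivative (\<lambda>h. inner (h *\<^sub>R v) D)) (at t)"
    using has_derivative_compose[OF 1 assms[unfolded gderiv_def]] .
  then show ?thesis by (simp add: has_field_derivative_def mult_commute_abs)
qed

text \<open>The deterministic side of the argument: \<mu> stands for the mean function, and paths of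
  the fluctuation enter as plain continuous functions w at scale s = 1 / sqrt n.\<close>

locale composite_minimization =
  fixes Z :: "'z::metric_space set" and f :: "'z \<Rightarrow> 's::euclidean_space \<Rightarrow> real" and \<mu> :: "'z \<Rightarrow> 's"
  assumes Z: "compact Z" "Z \<noteq> {}"
    and diff: "\<And>z \<eta>. z \<in> Z \<Longrightarrow> f z differentiable (at \<eta>)"
    and cont: "continuous_on (Z \<times> UNIV) (\<lambda>(z, \<eta>). f z \<eta>)"
    and cont_grad: "continuous_on (Z \<times> UNIV) (\<lambda>(z, \<eta>). gradient (f z) \<eta>)"
    and cont_\<mu>: "continuous_on Z \<mu>"
begin

definition \<rho> where "\<rho> = min_value (\<lambda>z. f z (\<mu> z)) Z"
definition Zhat where "Zhat = {z. is_arg_min (\<lambda>z. f z (\<mu> z)) (\<lambda>z. z \<in> Z) z}"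
definition g where "g z = gradient (f z) (\<mu> z)"

lemma continuous_on_f_compose:
  assumes "continuous_on Z w"
  shows "continuous_on Z (\<lambda>z. f z (w z))"
proof -
  have "continuous_on Z (\<lambda>z. (z, w z))" by (intro continuous_intros assms)
  from continuous_on_compose2[OF cont this] show ?thesis by auto
qed

lemma cont_f\<mu>: "continuous_on Z (\<lambda>z. f z (\<mu> z))"
  by (intro continuous_on_f_compose cont_\<mu>)

lemma cont_g: "continuous_on Z g"
proof -
  have "continuous_on Z (\<lambda>z. (z, \<mu> z))" by (intro continuous_intros cont_\<mu>)
  from continuous_on_compose2[OF cont_grad this] show ?thesis by (auto simp: g_def[abs_def])
qed

lemma \<rho>_le: "z \<in> Z \<Longrightarrow> \<rho> \<le> f z (\<mu> z)"
  unfolding \<rho>_def using min_value_attained[OF Z cont_f\<mu>] by metis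

lemma Zhat_eq: "Zhat = {z \<in> Z. f z (\<mu> z) = \<rho>}"
proof -
  obtain z where z: "z \<in> Z" "\<rho> = f z (\<mu> z)"
    unfolding \<rho>_def using min_value_attained[OF Z cont_f\<mu>] by metis
  show ?thesis
    unfolding Zhat_def is_arg_min_def using z \<rho>_le by (force simp: not_less)
qed

lemma Zhat_subset: "Zhat \<subseteq> Z" by (auto simp: Zhat_eq)

lemma Zhat_nonempty: "Zhat \<noteq> {}"
  unfolding Zhat_eq \<rho>_def using min_value_attained[OF Z cont_f\<mu>] by (metis (mono_tags, lifting) empty_iff mem_Collect_eq)

lemma compact_Zhat: "compact Zhat"
proof -
  have "closed (Z \<inter> (\<lambda>z. f z (\<mu> z)) -` {\<rho>})"
    by (intro continuous_closed_preimage cont_f\<mu> compact_imp_closed Z) auto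
  moreover have "Zhat = Z \<inter> (Z \<inter> (\<lambda>z. f z (\<mu> z)) -` {\<rho>})" by (auto simp: Zhat_eq)
  ultimately show ?thesis using compact_Int_closed[OF Z(1)] by metis
qed

text \<open>The mean value theorem along the segment from \<open>\<mu> z\<close> turns the increment
  into a gradient at an intermediate point, and uniform continuity of the gradient on a compact set
  makes the remainder uniform in z and v.\<close>

lemma first_order_expansion:
  assumes "0 < R" "0 < e"
  obtains s0 where "0 < s0" "\<And>s z v. 0 < s \<Longrightarrow> s < s0 \<Longrightarrow> z \<in> Z \<Longrightarrow> norm v \<le> R \<Longrightarrow>
    \<bar>f z (\<mu> z + s *\<^sub>R v) - f z (\<mu> z) - s * inner (g z) v\<bar> \<le> s * e"
proof -
  obtain B where B: "\<And>z. z \<in> Z \<Longrightarrow> norm (\<mu> z) \<le> B"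
    using compact_imp_bounded[OF compact_continuous_image[OF cont_\<mu> Z(1)]] by (auto simp: bounded_iff)
  \<comment> \<open>Contains every segment of length at most R that starts at
    \<open>\<mu> z\<close>.\<close>
  let ?C = "Z \<times> cball (0::'s) (B + R)"
  have "uniformly_continuous_on ?C (\<lambda>(z, \<eta>). gradient (f z) \<eta>)"
    by (intro compact_uniformly_continuous continuous_on_subset[OF cont_grad] compact_Times Z compact_cball) auto
  moreover have "0 < e / R" using assms by simp
  ultimately obtain d where d: "0 < d" "\<And>p q. p \<in> ?C \<Longrightarrow> q \<in> ?C \<Longrightarrow> dist p q < d \<Longrightarrow>
      dist ((\<lambda>(z, \<eta>). gradient (f z) \<eta>) p) ((\<lambda>(z, \<eta>). gradient (f z) \<eta>) q) < e / R"
    unfolding uniformly_continuous_on_def by (metis dist_commute)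
  show ?thesis
  \<comment> \<open>s < 1 keeps the segment in \<open>?C\<close>, and s < d / R makes it shorter
    than d.\<close>
  proof (rule that[of "min 1 (d / R)"])
    show "0 < min 1 (d / R)" using d assms by simp
    fix s z and v :: 's assume s: "0 < s" "s < min 1 (d / R)" and z: "z \<in> Z" and v: "norm v \<le> R"
    have deriv: "((\<lambda>t. f z (\<mu> z + t *\<^sub>R v)) has_real_derivative inner v (gradient (f z) (\<mu> z + t *\<^sub>R v))) (at t)" for t
      by (intro GDERIV_line_DERIV GDERIV_gradient diff z)
    obtain t where t: "0 < t" "t < s"
      "f z (\<mu> z + s *\<^sub>R v) - f z (\<mu> z + 0 *\<^sub>R v) = (s - 0) * inner v (gradient (f z) (\<mu> z + t *\<^sub>R v))"
      using MVT2[OF s(1), of "\<lambda>t. f z (\<mu> z + t *\<^sub>R v)" "\<lambda>t. inner v (gradient (f z) (\<mu> z + t *\<^sub>R v))"] deriv by blast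
    have tv: "norm (t *\<^sub>R v) \<le> s * R" using t v s by (auto intro!: mult_mono)
    have "s * R < d" using s assms by (simp add: field_simps)
    have "s * R \<le> R" using s assms by simp
    have "dist (gradient (f z) (\<mu> z + t *\<^sub>R v)) (g z) < e / R"
    proof -
      have "norm (\<mu> z + t *\<^sub>R v) \<le> B + R"
        using norm_triangle_ineq[of "\<mu> z" "t *\<^sub>R v"] B[OF z] tv \<open>s * R \<le> R\<close> by linarith
      then have "(z, \<mu> z + t *\<^sub>R v) \<in> ?C" "(z, \<mu> z) \<in> ?C"
        using z B[OF z] assms(1) by auto
      moreover have "dist (z, \<mu> z + t *\<^sub>R v) (z, \<mu> z) < d"
        using tv \<open>s * R < d\<close> by (simp add: dist_Pair_Pair dist_norm)
      ultimately show ?thesis using d(2) unfolding g_def by fastforce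
    qed
    then have "norm v * norm (gradient (f z) (\<mu> z + t *\<^sub>R v) - g z) \<le> R * (e / R)"
      using v assms by (intro mult_mono) (auto simp: dist_norm)
    then have *: "\<bar>inner v (gradient (f z) (\<mu> z + t *\<^sub>R v) - g z)\<bar> \<le> e"
      using assms Cauchy_Schwarz_ineq2[of v "gradient (f z) (\<mu> z + t *\<^sub>R v) - g z"] by simp
    have "f z (\<mu> z + s *\<^sub>R v) - f z (\<mu> z) - s * inner (g z) v = s * inner v (gradient (f z) (\<mu> z + t *\<^sub>R v) - g z)"
      using t(3) by (simp add: inner_diff_right right_diff_distrib inner_commute)
    then show "\<bar>f z (\<mu> z + s *\<^sub>R v) - f z (\<mu> z) - s * inner (g z) v\<bar> \<le> s * e"
      using * s(1) by (simp add: abs_mult)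
  qed
qed

lemma g_modulus:
  assumes "0 < R" "0 < e"
  obtains r where "0 < r" "\<And>u v. u \<in> Z \<Longrightarrow> v \<in> Z \<Longrightarrow> dist u v < r \<Longrightarrow> R * norm (g u - g v) \<le> e"
proof -
  have "uniformly_continuous_on Z g" by (intro compact_uniformly_continuous cont_g Z)
  moreover have "0 < e / R" using assms by simp
  ultimately obtain r where r: "0 < r" "\<And>u v. u \<in> Z \<Longrightarrow> v \<in> Z \<Longrightarrow> dist u v < r \<Longrightarrow> dist (g u) (g v) < e / R"
    unfolding uniformly_continuous_on_def by (metis dist_commute)
  show ?thesis
  proof (rule that[OF r(1)])
    fix u v assume "u \<in> Z" "v \<in> Z" "dist u v < r"
    then have "norm (g u - g v) < e / R" using r(2) by (simp add: dist_norm)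
    then show "R * norm (g u - g v) \<le> e" using assms by (simp add: field_simps)
  qed
qed

lemma inner_g_modulus:
  assumes R: "R * norm (g u - g v) \<le> e" and "norm (w u) \<le> R" "norm (w u - w v) \<le> e" "norm (g v) \<le> G" "0 \<le> G" "0 \<le> e"
  shows "\<bar>inner (g u) (w u) - inner (g v) (w v)\<bar> \<le> (G + 1) * e"
proof -
  have "inner (g u) (w u) - inner (g v) (w v) = inner (g u - g v) (w u) + inner (g v) (w u - w v)"
    by (simp add: inner_diff_left inner_diff_right)
  then have "\<bar>inner (g u) (w u) - inner (g v) (w v)\<bar> \<le> norm (g u - g v) * norm (w u) + norm (g v) * norm (w u - w v)"
    using Cauchy_Schwarz_ineq2[of "g u - g v" "w u"] Cauchy_Schwarz_ineq2[of "g v" "w u - w v"] by linarith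
  also have "\<dots> \<le> norm (g u - g v) * R + G * e"
    using assms by (intro add_mono mult_mono) auto
  also have "\<dots> \<le> (G + 1) * e" using R by (simp add: algebra_simps)
  finally show ?thesis .
qed

text \<open>Upper bound: a minimizer of the linear form on \<open>Zhat\<close> is tested in the
  perturbed problem. Lower bound: a minimizer of the perturbed problem lies either close to
  \<open>Zhat\<close>, where the moduli of g and w compare it with a point of \<open>Zhat\<close>,
  or far away, where the objective exceeds the optimum by a fixed gap that a perturbation of order s
  cannot close. The modulus of w is required at a single scale \<delta>, the form in which it is
  available with high probability.\<close>

lemma optimal_value_expansion:
  assumes R: "0 < R" and e: "0 < e" and \<delta>: "0 < \<delta>" and G: "0 \<le> G" "\<And>z. z \<in> Z \<Longrightarrow> norm (g z) \<le> G"
  shows "\<exists>s0>0. \<forall>s w. 0 < s \<longrightarrow> s < s0 \<longrightarrow> continuous_on Z w \<longrightarrow> (\<forall>z\<in>Z. norm (w z) \<le> R) \<longrightarrow>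
      (\<forall>u\<in>Z. \<forall>v\<in>Z. dist u v \<le> \<delta> \<longrightarrow> norm (w u - w v) \<le> e) \<longrightarrow>
      \<bar>(min_value (\<lambda>z. f z (\<mu> z + s *\<^sub>R w z)) Z - \<rho>) / s - min_value (\<lambda>z. inner (g z) (w z)) Zhat\<bar> \<le> (G + 2) * e"
proof -
  obtain s1 where s1: "0 < s1" "\<And>s z v. 0 < s \<Longrightarrow> s < s1 \<Longrightarrow> z \<in> Z \<Longrightarrow> norm v \<le> R \<Longrightarrow>
    \<bar>f z (\<mu> z + s *\<^sub>R v) - f z (\<mu> z) - s * inner (g z) v\<bar> \<le> s * e"
    using first_order_expansion[OF R e] by blast
  obtain r where r: "0 < r" "\<And>u v. u \<in> Z \<Longrightarrow> v \<in> Z \<Longrightarrow> dist u v < r \<Longrightarrow> R * norm (g u - g v) \<le> e"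
    using g_modulus[OF R e] by blast
  define r' where "r' = min r \<delta>"
  have r': "0 < r'" using r \<delta> by (simp add: r'_def)
  \<comment> \<open>A compact set disjoint from \<open>Zhat\<close>, so on it the unperturbed
    objective stays above \<rho> by a fixed a.\<close>
  define Far where "Far = Z - (\<Union>z\<in>Zhat. ball z r')"
  have Far: "compact Far" "Far \<subseteq> Z" unfolding Far_def by (auto intro!: compact_diff Z)
  have "\<exists>a>0. \<forall>z\<in>Far. \<rho> + a \<le> f z (\<mu> z)"
  proof (cases "Far = {}")
    case False
    obtain z where z: "z \<in> Far" "\<And>y. y \<in> Far \<Longrightarrow> f z (\<mu> z) \<le> f y (\<mu> y)"
      using min_value_attained[OF Far(1) False continuous_on_subset[OF cont_f\<mu> Far(2)]] by metis
    have "z \<notin> Zhat" using z(1) r' by (force simp: Far_def)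
    then have "f z (\<mu> z) \<noteq> \<rho>" using z(1) Far(2) by (auto simp: Zhat_eq)
    then have "\<rho> < f z (\<mu> z)" using \<rho>_le[of z] z(1) Far(2) by force
    then show ?thesis using z(2) by (intro exI[of _ "f z (\<mu> z) - \<rho>"]) auto
  qed (auto intro: exI[of _ 1])
  then obtain a where a: "0 < a" "\<And>z. z \<in> Far \<Longrightarrow> \<rho> + a \<le> f z (\<mu> z)" by blast
  \<comment> \<open>Makes 2 s G R \<le> a, enough to absorb the linear terms at both
    \<open>zn\<close> and \<open>zh\<close>; the summand 1 keeps the denominator positive when G =
    0.\<close>
  define s0 where "s0 = min s1 (a / (2 * G * R + 1))"
  have GR: "0 \<le> G * R" using G R by simp
  show ?thesis
  proof (intro exI[of _ s0] conjI allI impI)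
    have "0 < a / (2 * G * R + 1)" using a GR by (intro divide_pos_pos) auto
    then show "0 < s0" using s1 by (simp add: s0_def)
    fix s and w :: "'z \<Rightarrow> 's" assume s: "0 < s" "s < s0" and w': "continuous_on Z w" "\<forall>z\<in>Z. norm (w z) \<le> R"
      "\<forall>u\<in>Z. \<forall>v\<in>Z. dist u v \<le> \<delta> \<longrightarrow> norm (w u - w v) \<le> e"
    note w = w'[rule_format]
    have "s * (2 * G * R + 1) < a"
      using s GR by (simp add: s0_def pos_less_divide_eq)
    then have sa: "2 * (s * (G * R)) \<le> a" using s by (simp add: algebra_simps)
    have exp1: "\<bar>f z (\<mu> z + s *\<^sub>R w z) - f z (\<mu> z) - s * inner (g z) (w z)\<bar> \<le> s * e" if "z \<in> Z" for z
      using s1(2)[of s z "w z"] s w(2) that by (simp add: s0_def)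
    have ip: "\<bar>inner (g z) (w z)\<bar> \<le> G * R" if "z \<in> Z" for z
      using Cauchy_Schwarz_ineq2[of "g z" "w z"] mult_mono[OF G(2)[OF that] w(2)[OF that]] G(1) by simp
    define T where "T = min_value (\<lambda>z. inner (g z) (w z)) Zhat"
    have czh: "continuous_on Zhat (\<lambda>z. inner (g z) (w z))"
      by (intro continuous_intros continuous_on_subset[OF cont_g Zhat_subset] continuous_on_subset[OF w(1) Zhat_subset])
    obtain zh where "zh \<in> Zhat \<and> T = inner (g zh) (w zh) \<and> (\<forall>y\<in>Zhat. inner (g zh) (w zh) \<le> inner (g y) (w y))"
      unfolding T_def by (rule min_value_attained[OF compact_Zhat Zhat_nonempty czh]) auto
    then have zh: "zh \<in> Zhat" "T = inner (g zh) (w zh)" "\<And>y. y \<in> Zhat \<Longrightarrow> inner (g zh) (w zh) \<le> inner (g y) (w y)"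
      by auto
    define m where "m = min_value (\<lambda>z. f z (\<mu> z + s *\<^sub>R w z)) Z"
    have cw: "continuous_on Z (\<lambda>z. f z (\<mu> z + s *\<^sub>R w z))"
      by (intro continuous_on_f_compose continuous_intros cont_\<mu> w(1))
    obtain zn where "zn \<in> Z \<and> m = f zn (\<mu> zn + s *\<^sub>R w zn) \<and>
        (\<forall>y\<in>Z. f zn (\<mu> zn + s *\<^sub>R w zn) \<le> f y (\<mu> y + s *\<^sub>R w y))"
      unfolding m_def by (rule min_value_attained[OF Z cw]) auto
    then have zn: "zn \<in> Z" "m = f zn (\<mu> zn + s *\<^sub>R w zn)"
        "\<And>y. y \<in> Z \<Longrightarrow> f zn (\<mu> zn + s *\<^sub>R w zn) \<le> f y (\<mu> y + s *\<^sub>R w y)"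
      by auto
    have zhZ: "zh \<in> Z" "f zh (\<mu> zh) = \<rho>" using zh(1) by (auto simp: Zhat_eq)
    have upper: "m \<le> \<rho> + s * (T + e)"
      using zn(3)[OF zhZ(1)] exp1[OF zhZ(1)] zhZ(2) zn(2) zh(2) by (simp add: abs_le_iff algebra_simps)
    have lower: "\<rho> + s * (T - (G + 2) * e) \<le> m"
    proof (cases "zn \<in> Far")
      case True
      have "\<rho> + a \<le> f zn (\<mu> zn)" by (rule a(2)[OF True])
      moreover have "f zn (\<mu> zn) + s * inner (g zn) (w zn) - s * e \<le> m"
        using exp1[OF zn(1)] zn(2) by (simp add: abs_le_iff)
      moreover have "s * - (G * R) \<le> s * inner (g zn) (w zn)"
        using ip[OF zn(1)] s(1) by (intro mult_left_mono) (auto simp: abs_le_iff)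
      moreover have "s * T \<le> s * (G * R)"
        using ip[OF zhZ(1)] zh(2) s(1) by (intro mult_left_mono) (auto simp: abs_le_iff)
      moreover have "s * e \<le> s * ((G + 2) * e)"
        using s(1) G(1) e by (intro mult_left_mono) (auto simp: algebra_simps)
      ultimately have "\<rho> + (s * T - s * ((G + 2) * e)) \<le> m" using sa by linarith
      then show ?thesis by (simp add: right_diff_distrib)
    next
      case False
      then obtain z where z: "z \<in> Zhat" "dist z zn < r'" using zn(1) by (auto simp: Far_def)
      have zZ: "z \<in> Z" using z Zhat_subset by auto
      \<comment> \<open>Moving from \<open>zn\<close> to z costs (G + 1) e; the remaining e of (G +
        2) e is the expansion error.\<close>
      have "\<bar>inner (g zn) (w zn) - inner (g z) (w z)\<bar> \<le> (G + 1) * e"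
        using z zn(1) zZ G e w r(2)[of zn z] by (intro inner_g_modulus[where R=R]) (auto simp: r'_def dist_commute)
      then have "T - (G + 1) * e \<le> inner (g zn) (w zn)"
        using zh(2) zh(3)[OF z(1)] by (simp add: abs_le_iff)
      then have "s * (T - (G + 1) * e) \<le> s * inner (g zn) (w zn)"
        using s(1) by (intro mult_left_mono) auto
      moreover have "f zn (\<mu> zn) + s * inner (g zn) (w zn) - s * e \<le> m"
        using exp1[OF zn(1)] zn(2) by (simp add: abs_le_iff)
      ultimately have "\<rho> + s * (T - (G + 1) * e) - s * e \<le> m" using \<rho>_le[OF zn(1)] by linarith
      then show ?thesis by (simp add: algebra_simps)
    qed
    have "e \<le> (G + 2) * e" using G e by (simp add: algebra_simps)
    have "(m - \<rho>) / s \<le> T + e" using upper s(1) by (simp add: pos_divide_le_eq algebra_simps)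
    moreover have "T - (G + 2) * e \<le> (m - \<rho>) / s" using lower unfolding pos_le_divide_eq[OF s(1)] mult.commute[of _ s] by linarith
    ultimately show "\<bar>(min_value (\<lambda>z. f z (\<mu> z + s *\<^sub>R w z)) Z - \<rho>) / s - min_value (\<lambda>z. inner (g z) (w z)) Zhat\<bar> \<le> (G + 2) * e"
      unfolding m_def[symmetric] T_def[symmetric] using \<open>e \<le> (G + 2) * e\<close> by (intro abs_leI) linarith+
  qed
qed

end

section \<open>Gaussian families\<close>

definition square_integrable :: "'a measure \<Rightarrow> ('a \<Rightarrow> real) \<Rightarrow> bool" where
  "square_integrable M f \<longleftrightarrow> f \<in> borel_measurable M \<and> integrable M (\<lambda>x. (f x)\<^sup>2)"

lemma square_integrable_measurable: "square_integrable M f \<Longrightarrow> f \<in> borel_measurable M"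
  by (simp add: square_integrable_def)

lemma square_integrable_mult:
  assumes "square_integrable M f" "square_integrable M g"
  shows "integrable M (\<lambda>x. f x * g x)"
proof (rule Bochner_Integration.integrable_bound)
  show "integrable M (\<lambda>x. (f x)\<^sup>2 + (g x)\<^sup>2)" using assms by (simp add: square_integrable_def)
  show "(\<lambda>x. f x * g x) \<in> borel_measurable M"
    using assms by (auto simp: square_integrable_def)
  have "\<bar>f x * g x\<bar> \<le> (f x)\<^sup>2 + (g x)\<^sup>2" for x
    using zero_le_power2[of "\<bar>f x\<bar> - \<bar>g x\<bar>"] mult_nonneg_nonneg[of "\<bar>f x\<bar>" "\<bar>g x\<bar>"]
    unfolding power2_diff power2_abs abs_mult by linarith
  then show "AE x in M. norm (f x * g x) \<le> norm ((f x)\<^sup>2 + (g x)\<^sup>2)"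
    by (auto intro: order_trans[OF _ abs_ge_self])
qed

lemma square_integrable_bound:
  assumes "square_integrable M f" "g \<in> borel_measurable M" "\<And>x. x \<in> space M \<Longrightarrow> \<bar>g x\<bar> \<le> f x"
  shows "square_integrable M g"
  unfolding square_integrable_def
proof
  show "integrable M (\<lambda>x. (g x)\<^sup>2)"
  proof (rule Bochner_Integration.integrable_bound)
    show "integrable M (\<lambda>x. (f x)\<^sup>2)" using assms by (simp add: square_integrable_def)
    show "(\<lambda>x. (g x)\<^sup>2) \<in> borel_measurable M" using assms by simp
    show "AE x in M. norm ((g x)\<^sup>2) \<le> norm ((f x)\<^sup>2)"
      using assms(3) by (auto intro!: AE_I2 abs_le_square_iff[THEN iffD1] order_trans[OF _ abs_ge_self])
  qed
qed fact

lemma square_integrable_cmult: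
  "square_integrable M f \<Longrightarrow> square_integrable M (\<lambda>x. c * f x)"
  by (auto simp: square_integrable_def power_mult_distrib)

lemma square_integrable_add:
  assumes "square_integrable M f" "square_integrable M g"
  shows "square_integrable M (\<lambda>x. f x + g x)"
proof -
  have "integrable M (\<lambda>x. 2 * (f x * g x))"
    by (intro integrable_mult_right square_integrable_mult assms)
  then show ?thesis using assms by (auto simp: square_integrable_def power2_sum mult.assoc)
qed

lemma square_integrable_diff:
  assumes "square_integrable M f" "square_integrable M g"
  shows "square_integrable M (\<lambda>x. f x - g x)"
  using square_integrable_add[OF assms(1) square_integrable_cmult[OF assms(2), of "-1"]] by simp

lemma square_integrable_sum:
  "(\<And>i. i \<in> I \<Longrightarrow> square_integrable M (f i)) \<Longrightarrow> square_integrable M (\<lambda>x. \<Sum>i\<in>I. f i x)"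
proof (induction I rule: infinite_finite_induct)
  case (insert i I)
  then show ?case by (simp add: square_integrable_add)
qed (simp_all add: square_integrable_def)

text \<open>
  Orthogonal but not normalized; a function of norm 0 contributes nothing because \<open>x / 0 = 0\<close>.
\<close>

fun gram_schmidt :: "'a measure \<Rightarrow> (nat \<Rightarrow> 'a \<Rightarrow> real) \<Rightarrow> nat \<Rightarrow> 'a \<Rightarrow> real" where
  "gram_schmidt M g n = (\<lambda>x. g n x - (\<Sum>k<n. (LINT y|M. g n y * gram_schmidt M g k y) /
      (LINT y|M. (gram_schmidt M g k y)\<^sup>2) * gram_schmidt M g k x))"

declare gram_schmidt.simps[simp del]

lemma square_integrable_gram_schmidt:
  assumes "\<And>i. square_integrable M (g i)"
  shows "square_integrable M (gram_schmidt M g n)"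
proof (induction n rule: less_induct)
  case (less n)
  then show ?case
    by (subst gram_schmidt.simps)
      (intro square_integrable_diff square_integrable_sum square_integrable_cmult assms, auto)
qed

lemma integral_mult_null:
  assumes f: "square_integrable M f" and h: "square_integrable M h" "(LINT x|M. (h x)\<^sup>2) = 0"
  shows "(LINT x|M. f x * h x) = 0"
proof -
  have "AE x in M. (h x)\<^sup>2 = 0"
    using h by (subst integral_nonneg_eq_0_iff_AE[symmetric]) (auto simp: square_integrable_def)
  then have "AE x in M. f x * h x = 0" by eventually_elim simp
  then show ?thesis by (rule integral_eq_zero_AE)
qed

lemma gram_schmidt_orthogonal:
  assumes g: "\<And>i. square_integrable M (g i)" and "j < n"
  shows "(LINT x|M. gram_schmidt M g n x * gram_schmidt M g j x) = 0"
  using \<open>j < n\<close>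
proof (induction n arbitrary: j rule: less_induct)
  case (less n)
  let ?h = "gram_schmidt M g"
  note sq = square_integrable_gram_schmidt[of M g, OF g]
  let ?c = "\<lambda>k. (LINT y|M. g n y * ?h k y) / (LINT y|M. (?h k y)\<^sup>2)"
  have sym: "(LINT x|M. ?h k x * ?h j x) = 0" if "k < n" "k \<noteq> j" for k
    using less.IH[of k j] less.IH[of j k] that less.prems by (cases "k < j") (auto simp: mult.commute)
  have int: "integrable M (\<lambda>x. ?c k * (?h k x * ?h j x))" for k
    by (intro integrable_mult_right square_integrable_mult sq)
  have "?h n x * ?h j x = g n x * ?h j x - (\<Sum>k<n. ?c k * (?h k x * ?h j x))" for x
    by (subst (1) gram_schmidt.simps) (simp only: left_diff_distrib sum_distrib_right mult.assoc)
  then have "(LINT x|M. ?h n x * ?h j x) = (LINT x|M. g n x * ?h j x - (\<Sum>k<n. ?c k * (?h k x * ?h j x)))"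
    by (simp only:)
  also have "\<dots> = (LINT x|M. g n x * ?h j x) - (LINT x|M. (\<Sum>k<n. ?c k * (?h k x * ?h j x)))"
    by (intro Bochner_Integration.integral_diff square_integrable_mult g sq Bochner_Integration.integrable_sum int)
  also have "(LINT x|M. (\<Sum>k<n. ?c k * (?h k x * ?h j x))) = (\<Sum>k<n. ?c k * (LINT x|M. ?h k x * ?h j x))"
    by (subst Bochner_Integration.integral_sum[OF int]) (simp only: integral_mult_right_zero)
  also have "(\<Sum>k<n. ?c k * (LINT x|M. ?h k x * ?h j x)) = (\<Sum>k<n. if k = j then ?c j * (LINT x|M. (?h j x)\<^sup>2) else 0)"
    using sym by (intro sum.cong refl) (auto simp: power2_eq_square)
  also have "\<dots> = ?c j * (LINT x|M. (?h j x)\<^sup>2)" using less.prems by simp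
  \<comment> \<open>If \<open>?h j\<close> has norm 0 the quotient is 0 by convention, but then
    \<open>?h j\<close> vanishes almost everywhere and the integral on the right is 0 too.\<close>
  also have "\<dots> = (LINT x|M. g n x * ?h j x)"
    using integral_mult_null[OF g[of n] sq[of j]] by (cases "(LINT x|M. (?h j x)\<^sup>2) = 0") auto
  finally show ?case by simp
qed

text \<open>Coefficients can be taken to vanish beyond n, so a single upper limit m serves finitely
  many functions at once.\<close>

lemma gram_schmidt_expansion:
  assumes g: "\<And>i. square_integrable M (g i)"
  obtains c where "\<And>n m x. n \<le> m \<Longrightarrow> g n x = (\<Sum>k\<le>m. c n k * gram_schmidt M g k x)"
proof -
  define d where "d n k = (LINT y|M. g n y * gram_schmidt M g k y) / (LINT y|M. (gram_schmidt M g k y)\<^sup>2)" for n k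
  define c where "c n k = (if k < n then d n k else if k = n then 1 else 0)" for n k
  show ?thesis
  proof (rule that[of c])
    fix n m :: nat and x assume "n \<le> m"
    have "(\<Sum>k\<le>m. c n k * gram_schmidt M g k x) = (\<Sum>k\<le>n. c n k * gram_schmidt M g k x)"
      using \<open>n \<le> m\<close> by (intro sum.mono_neutral_right) (auto simp: c_def)
    also have "\<dots> = (\<Sum>k<n. d n k * gram_schmidt M g k x) + gram_schmidt M g n x"
      by (simp add: lessThan_Suc_atMost[symmetric] c_def)
    also have "\<dots> = g n x"
      by (subst (2) gram_schmidt.simps) (simp add: d_def)
    finally show "g n x = (\<Sum>k\<le>m. c n k * gram_schmidt M g k x)" by simp
  qed
qed

lemma integral_square_gram_schmidt_sum:
  assumes g: "\<And>i. square_integrable M (g i)"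
  shows "(LINT x|M. (\<Sum>k\<le>m. \<beta> k * gram_schmidt M g k x)\<^sup>2) = (\<Sum>k\<le>m. (\<beta> k)\<^sup>2 * (LINT x|M. (gram_schmidt M g k x)\<^sup>2))"
proof -
  let ?h = "gram_schmidt M g"
  note sq = square_integrable_gram_schmidt[of M g, OF g]
  have int: "integrable M (\<lambda>x. (\<beta> i * \<beta> j) * (?h i x * ?h j x))" for i j
    by (intro integrable_mult_right square_integrable_mult sq)
  have orth: "(LINT x|M. ?h i x * ?h j x) = 0" if "i \<noteq> j" for i j
    using gram_schmidt_orthogonal[of M g, OF g, of i j] gram_schmidt_orthogonal[of M g, OF g, of j i] that
    by (cases "i < j") (auto simp: mult.commute)
  have "(LINT x|M. (\<Sum>k\<le>m. \<beta> k * ?h k x)\<^sup>2) = (LINT x|M. (\<Sum>i\<le>m. \<Sum>j\<le>m. (\<beta> i * \<beta> j) * (?h i x * ?h j x)))"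
    by (simp add: power2_eq_square sum_product mult_ac)
  also have "\<dots> = (\<Sum>i\<le>m. \<Sum>j\<le>m. (LINT x|M. (\<beta> i * \<beta> j) * (?h i x * ?h j x)))"
    by (subst Bochner_Integration.integral_sum)
      (intro Bochner_Integration.integrable_sum int sum.cong refl Bochner_Integration.integral_sum)+
  also have "\<dots> = (\<Sum>i\<le>m. \<Sum>j\<le>m. if j = i then (\<beta> i)\<^sup>2 * (LINT x|M. (?h i x)\<^sup>2) else 0)"
    using orth by (intro sum.cong refl) (auto simp: power2_eq_square)
  finally show ?thesis by simp
qed

section \<open>Gaussian families from independent normal variables\<close>

lemma standard_normal_sequence_exists:
  assumes inf: "infinite (UNIV :: 'i set)"
  shows "\<exists>(N :: ('i \<Rightarrow> real^'s) measure) \<xi>. prob_space N \<and>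
    (\<forall>\<alpha> m. normal_char N (\<lambda>\<omega>. \<Sum>k\<le>(m::nat). \<alpha> k * \<xi> k \<omega>) (\<Sum>k\<le>m. (\<alpha> k)\<^sup>2))"
proof -
  \<comment> \<open>The sample space is a product indexed by 'i; an injection of the naturals
    selects the coordinates that form the sequence, which is where 'i has to be infinite.\<close>
  obtain pt :: "nat \<Rightarrow> 'i" where pt: "inj pt"
    using infinite_countable_subset[OF inf] by auto
  define c0 where "c0 = (undefined :: 's)"
  \<comment> \<open>Every factor \<open>real^'s\<close> carries one standard normal variable copied
    into all components. Only component \<open>c0\<close> is read off later, so any
    \<open>c0\<close> will do.\<close>
  define Q where "Q = distr std_normal_distribution borel (\<lambda>x::real. (\<chi> i::'s. x))"
  have vec_m[measurable]: "(\<lambda>x::real. (\<chi> i::'s. x)) \<in> borel_measurable borel"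
    by (intro borel_measurable_continuous_onI continuous_intros)
  have setsQ[measurable_cong]: "sets Q = sets borel" by (simp add: Q_def)
  interpret S: prob_space std_normal_distribution
    using real_dist_normal_dist by (simp add: real_distribution_def)
  have Q: "prob_space Q" unfolding Q_def by (rule S.prob_space_distr) simp
  define N where "N = PiM (UNIV :: 'i set) (\<lambda>_. Q)"
  have N: "prob_space N" unfolding N_def by (rule prob_space_PiM) (rule Q)
  interpret N: prob_space N by fact
  have comp[measurable]: "(\<lambda>\<omega>. \<omega> i) \<in> measurable N Q" for i
    unfolding N_def by measurable
  have marg: "distr N Q (\<lambda>\<omega>. \<omega> i) = Q" for i
    unfolding N_def by (rule distr_PiM_component) (auto intro: Q)
  have ind: "N.indep_vars (\<lambda>_. Q) (\<lambda>i \<omega>. \<omega> i) UNIV"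
  proof (subst N.indep_vars_iff_distr_eq_PiM)
    have "distr N (PiM UNIV (\<lambda>_. Q)) (\<lambda>x. \<lambda>i\<in>UNIV. x i) = distr N N (\<lambda>x. x)"
      unfolding N_def by (intro distr_cong) auto
    then show "distr N (PiM UNIV (\<lambda>_. Q)) (\<lambda>x. \<lambda>i\<in>UNIV. x i) = PiM UNIV (\<lambda>i. distr N Q (\<lambda>\<omega>. \<omega> i))"
      unfolding marg by (simp add: distr_id N_def)
  qed (auto intro: comp)
  define X where "X i \<omega> = (\<omega> i :: real^'s) $ c0" for i :: 'i and \<omega>
  have X_m[measurable]: "X i \<in> borel_measurable N" for i unfolding X_def
    by (rule measurable_compose[OF comp]) (simp add: measurable_cong_sets[OF setsQ refl])
  have indX: "N.indep_vars (\<lambda>_. borel) X UNIV"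
    unfolding X_def using N.indep_vars_compose2[OF ind, of "\<lambda>_ v. v $ c0" "\<lambda>_. borel"] by simp
  have X1: "normal_char N (X i) 1" for i
  proof -
    have "(CLINT \<omega>|N. iexp (t * X i \<omega>)) = complex_of_real (exp (- (1 * t\<^sup>2) / 2))" for t
    proof -
      have "(CLINT \<omega>|N. iexp (t * X i \<omega>)) = (CLINT v|distr N Q (\<lambda>\<omega>. \<omega> i). iexp (t * v $ c0))"
        unfolding X_def by (subst integral_distr) auto
      also have "\<dots> = (CLINT x|std_normal_distribution. iexp (t * x))"
        unfolding marg unfolding Q_def by (subst integral_distr) auto
      also have "\<dots> = complex_of_real (exp (- (1 * t\<^sup>2) / 2))"
        using fun_cong[OF char_std_normal_distribution, of t] by (simp add: char_def)
      finally show ?thesis .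
    qed
    then show ?thesis by (simp add: normal_char_def)
  qed
  show ?thesis
  proof (intro exI[of _ N] exI[of _ "\<lambda>k. X (pt k)"] conjI allI N)
    fix \<alpha> :: "nat \<Rightarrow> real" and m :: nat
    have inj: "inj_on pt {..m}" using pt by (rule inj_on_subset) simp
    have "normal_char N (\<lambda>\<omega>. \<Sum>i\<in>pt ` {..m}. \<alpha> (the_inv pt i) * X i \<omega>) (\<Sum>i\<in>pt ` {..m}. (\<alpha> (the_inv pt i))\<^sup>2)"
      by (intro N.normal_char_sum_indep N.indep_vars_subset[OF indX] X1) auto
    then show "normal_char N (\<lambda>\<omega>. \<Sum>k\<le>m. \<alpha> k * X (pt k) \<omega>) (\<Sum>k\<le>m. (\<alpha> k)\<^sup>2)"
      by (simp add: sum.reindex[OF inj] the_inv_f_f[OF pt])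
  qed
qed

text \<open>Each Gram-Schmidt function is replaced by an independent normal variable times its norm.
  This preserves inner products, so the variance of a combination of the V is the squared L2 norm of
  the same combination of the k. The map \<open>zz\<close> may repeat points, as happens when
  distinct points of Z share an approximation in D.\<close>

lemma gaussian_family_on_countable:
  fixes k :: "'z \<Rightarrow> 'x \<Rightarrow> real^'s"
  assumes inf: "infinite (UNIV :: 'i set)"
    and D: "countable D" and k: "\<forall>z\<in>D. \<forall>c. square_integrable P (\<lambda>x. k z x $ c)"
  shows "\<exists>(N :: ('i \<Rightarrow> real^'s) measure) V. prob_space N \<and> (\<forall>z. V z \<in> borel_measurable N) \<and>
    (\<forall>(J :: 'z set) a zz. finite J \<longrightarrow> zz ` J \<subseteq> D \<longrightarrow>
      normal_char N (\<lambda>\<omega>. \<Sum>j\<in>J. inner (a j) (V (zz j) \<omega>)) (LINT x|P. (\<Sum>j\<in>J. inner (a j) (k (zz j) x))\<^sup>2))"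
proof -
  obtain N :: "('i \<Rightarrow> real^'s) measure" and \<xi> :: "nat \<Rightarrow> ('i \<Rightarrow> real^'s) \<Rightarrow> real" where *: "prob_space N \<and>
    (\<forall>\<alpha> m. normal_char N (\<lambda>\<omega>. \<Sum>k\<le>(m::nat). \<alpha> k * \<xi> k \<omega>) (\<Sum>k\<le>m. (\<alpha> k)\<^sup>2))"
    using standard_normal_sequence_exists[OF inf, where ?'s='s] by (elim exE)
  note N = *[THEN conjunct1] and \<xi> = *[THEN conjunct2, rule_format]
  let ?I = "D \<times> (UNIV :: 's set)"
  have cI: "countable ?I" using D by (intro countable_SIGMA) auto
  define p where "p = to_nat_on ?I"
  have p: "from_nat_into ?I (p y) = y" if "y \<in> ?I" for y
    unfolding p_def by (rule from_nat_into_to_nat_on[OF cI that])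
  \<comment> \<open>An empty D has nothing to enumerate, hence the default 0.\<close>
  define g where "g n = (if D = {} then (\<lambda>_. 0) else (\<lambda>x. k (fst (from_nat_into ?I n)) x $ snd (from_nat_into ?I n)))" for n
  have g: "square_integrable P (g n)" for n
  proof (cases "D = {}")
    case False
    then have "from_nat_into ?I n \<in> ?I" by (intro from_nat_into) auto
    then have "fst (from_nat_into ?I n) \<in> D" by auto
    then show ?thesis using k False by (simp add: g_def)
  qed (simp add: g_def square_integrable_def)
  have gp: "g (p (z, c)) x = k z x $ c" if "z \<in> D" for z c x
    using p[of "(z, c)"] that by (auto simp: g_def)
  obtain c where c: "\<And>n m x. n \<le> m \<Longrightarrow> g n x = (\<Sum>i\<le>m. c n i * gram_schmidt P g i x)"
    using gram_schmidt_expansion[of P g, OF g] by blast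
  \<comment> \<open>The case m = n of the expansion uses \<open>c n i\<close> for i \<le> n only, so
    the other coefficients may be set to 0; then V has the same expansion for every sufficiently
    large cut-off m.\<close>
  define c' where "c' n i = (if i \<le> n then c n i else 0)" for n i
  have c': "g n x = (\<Sum>i\<le>m. c' n i * gram_schmidt P g i x)" if "n \<le> m" for n m x
  proof -
    have "(\<Sum>i\<le>m. c' n i * gram_schmidt P g i x) = (\<Sum>i\<le>n. c n i * gram_schmidt P g i x)"
      using that by (intro sum.mono_neutral_cong_right) (auto simp: c'_def)
    then show ?thesis using c[of n n x] by simp
  qed
  define \<sigma> where "\<sigma> i = sqrt (LINT x|P. (gram_schmidt P g i x)\<^sup>2)" for i
  have \<sigma>2: "(\<sigma> i)\<^sup>2 = (LINT x|P. (gram_schmidt P g i x)\<^sup>2)" for i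
    by (simp add: \<sigma>_def)
  define V where "V z \<omega> = (\<chi> d. \<Sum>i\<le>p (z, d). c' (p (z, d)) i * \<sigma> i * \<xi> i \<omega>)" for z \<omega>
  have V: "V z \<omega> $ d = (\<Sum>i\<le>m. c' (p (z, d)) i * \<sigma> i * \<xi> i \<omega>)" if "p (z, d) \<le> m" for z \<omega> d m
    unfolding V_def vec_lambda_beta using that
    by (intro sum.mono_neutral_left) (auto simp: c'_def)
  show ?thesis
  proof (intro exI[of _ N] exI[of _ V] conjI allI impI N)
    fix z
    have "(\<lambda>\<omega>. \<Sum>i\<le>p (z, d). (c' (p (z, d)) i * \<sigma> i) * \<xi> i \<omega>) \<in> borel_measurable N" for d
      using \<xi>[of "\<lambda>i. c' (p (z, d)) i * \<sigma> i" "p (z, d)"] by (simp add: normal_char_def)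
    then show "V z \<in> borel_measurable N"
      by (subst borel_measurable_euclidean_space) (auto simp: V_def Basis_vec_def inner_axis)
  next
    fix J :: "'z set" and a zz assume J: "finite J" "zz ` J \<subseteq> D"
    define m where "m = Max (insert 0 ((\<lambda>(j, d). p (zz j, d)) ` (J \<times> UNIV)))"
    have m: "p (zz j, d) \<le> m" if "j \<in> J" for j d
      unfolding m_def using that J(1) by (intro Max_ge) auto
    \<comment> \<open>The same coefficients describe the combination of the V in terms of \<xi> and
      that of the k in terms of the Gram-Schmidt functions, which makes the variances agree.\<close>
    define \<beta> where "\<beta> i = (\<Sum>j\<in>J. \<Sum>d\<in>UNIV. a j $ d * c' (p (zz j, d)) i)" for i
    have VJ: "(\<Sum>j\<in>J. inner (a j) (V (zz j) \<omega>)) = (\<Sum>i\<le>m. (\<beta> i * \<sigma> i) * \<xi> i \<omega>)" for \<omega>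
    proof -
      have "(\<Sum>j\<in>J. inner (a j) (V (zz j) \<omega>)) =
          (\<Sum>j\<in>J. \<Sum>d\<in>UNIV. \<Sum>i\<le>m. a j $ d * (c' (p (zz j, d)) i * \<sigma> i * \<xi> i \<omega>))"
        by (intro sum.cong refl) (simp add: inner_vec_def V[OF m] sum_distrib_left)
      also have "\<dots> = (\<Sum>j\<in>J. \<Sum>i\<le>m. \<Sum>d\<in>UNIV. a j $ d * (c' (p (zz j, d)) i * \<sigma> i * \<xi> i \<omega>))"
        by (intro sum.cong refl sum.swap)
      also have "\<dots> = (\<Sum>i\<le>m. \<Sum>j\<in>J. \<Sum>d\<in>UNIV. a j $ d * (c' (p (zz j, d)) i * \<sigma> i * \<xi> i \<omega>))"
        by (rule sum.swap)
      finally show ?thesis by (simp add: \<beta>_def sum_distrib_right mult.assoc)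
    qed
    have kJ: "(\<Sum>j\<in>J. inner (a j) (k (zz j) x)) = (\<Sum>i\<le>m. \<beta> i * gram_schmidt P g i x)" for x
    proof -
      have "(\<Sum>j\<in>J. inner (a j) (k (zz j) x)) =
          (\<Sum>j\<in>J. \<Sum>d\<in>UNIV. \<Sum>i\<le>m. a j $ d * (c' (p (zz j, d)) i * gram_schmidt P g i x))"
      proof (intro sum.cong refl)
        fix j assume j: "j \<in> J"
        then have "k (zz j) x $ d = (\<Sum>i\<le>m. c' (p (zz j, d)) i * gram_schmidt P g i x)" for d
          using gp[of "zz j" d x] c'[OF m[OF j, of d], of x] J(2) by (metis image_subset_iff)
        then show "inner (a j) (k (zz j) x) = (\<Sum>d\<in>UNIV. \<Sum>i\<le>m. a j $ d * (c' (p (zz j, d)) i * gram_schmidt P g i x))"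
          by (simp add: inner_vec_def sum_distrib_left)
      qed
      also have "\<dots> = (\<Sum>j\<in>J. \<Sum>i\<le>m. \<Sum>d\<in>UNIV. a j $ d * (c' (p (zz j, d)) i * gram_schmidt P g i x))"
        by (intro sum.cong refl sum.swap)
      also have "\<dots> = (\<Sum>i\<le>m. \<Sum>j\<in>J. \<Sum>d\<in>UNIV. a j $ d * (c' (p (zz j, d)) i * gram_schmidt P g i x))"
        by (rule sum.swap)
      finally show ?thesis by (simp add: \<beta>_def sum_distrib_right mult.assoc)
    qed
    have "(LINT x|P. (\<Sum>j\<in>J. inner (a j) (k (zz j) x))\<^sup>2) = (\<Sum>i\<le>m. (\<beta> i * \<sigma> i)\<^sup>2)"
      unfolding kJ integral_square_gram_schmidt_sum[of P g, OF g] by (simp add: power_mult_distrib \<sigma>2)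
    then show "normal_char N (\<lambda>\<omega>. \<Sum>j\<in>J. inner (a j) (V (zz j) \<omega>)) (LINT x|P. (\<Sum>j\<in>J. inner (a j) (k (zz j) x))\<^sup>2)"
      unfolding VJ using \<xi>[of "\<lambda>i. \<beta> i * \<sigma> i" m] by simp
  qed
qed

section \<open>Continuous Gaussian processes\<close>

lemma (in prob_space) prob_norm_gt_le_components:
  fixes X :: "'a \<Rightarrow> real^'n" and t B :: real
  assumes [measurable]: "X \<in> borel_measurable M" and B: "\<And>c. prob {\<omega>\<in>space M. t < \<bar>X \<omega> $ c\<bar>} \<le> B"
  shows "prob {\<omega>\<in>space M. CARD('n) * t < norm (X \<omega>)} \<le> CARD('n) * B"
proof -
  have "{\<omega>\<in>space M. CARD('n) * t < norm (X \<omega>)} \<subseteq> (\<Union>c\<in>UNIV. {\<omega>\<in>space M. t < \<bar>X \<omega> $ c\<bar>})"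
  proof (rule subsetI, rule ccontr)
    fix \<omega> assume \<omega>: "\<omega> \<in> {\<omega>\<in>space M. CARD('n) * t < norm (X \<omega>)}"
      and "\<omega> \<notin> (\<Union>c\<in>UNIV. {\<omega>\<in>space M. t < \<bar>X \<omega> $ c\<bar>})"
    then have "\<bar>X \<omega> $ c\<bar> \<le> t" for c by (auto simp: not_less)
    then have "(\<Sum>c\<in>UNIV. \<bar>X \<omega> $ c\<bar>) \<le> (\<Sum>c\<in>(UNIV::'n set). t)" by (intro sum_mono)
    then show False using norm_le_l1_cart[of "X \<omega>"] \<omega> by simp
  qed
  then have "prob {\<omega>\<in>space M. CARD('n) * t < norm (X \<omega>)} \<le> prob (\<Union>c\<in>UNIV. {\<omega>\<in>space M. t < \<bar>X \<omega> $ c\<bar>})"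
    by (intro finite_measure_mono) auto
  also have "\<dots> \<le> (\<Sum>c\<in>UNIV. prob {\<omega>\<in>space M. t < \<bar>X \<omega> $ c\<bar>})"
    by (intro finite_measure_subadditive_finite) auto
  also have "\<dots> \<le> (\<Sum>c\<in>(UNIV::'n set). B)" by (intro sum_mono B)
  finally show ?thesis by simp
qed

text \<open>Dividing by \<open>dist u v\<close> makes the component variances at most b uniformly in
  u and v. The norm is then controlled by a union bound over components, which costs CARD('n) both
  in front and in the exponent.\<close>

lemma (in prob_space) gaussian_increment_tail:
  fixes V :: "'z::metric_space \<Rightarrow> 'a \<Rightarrow> real^'n"
  assumes [measurable]: "V u \<in> borel_measurable M" "V v \<in> borel_measurable M"
    and comp: "\<And>c. u \<noteq> v \<Longrightarrow> \<exists>w\<le>b. normal_char M (\<lambda>\<omega>. (V u \<omega> - V v \<omega>) $ c / dist u v) w"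
  shows "prob {\<omega>\<in>space M. t * dist u v < norm (V u \<omega> - V v \<omega>)}
    \<le> (CARD('n) * (2 * exp (b / 2))) * exp (- (1 / CARD('n)) * t)"
proof (cases "u = v")
  case False
  define n where "n = real CARD('n)"
  have n: "0 < n" by (simp add: n_def)
  have d: "0 < dist u v" using False by simp
  have "prob {\<omega>\<in>space M. t / n < \<bar>((1 / dist u v) *\<^sub>R (V u \<omega> - V v \<omega>)) $ c\<bar>} \<le> 2 * exp (b / 2) * exp (- (t / n))" for c
  proof -
    obtain w where w: "w \<le> b" "normal_char M (\<lambda>\<omega>. (V u \<omega> - V v \<omega>) $ c / dist u v) w"
      using comp[OF False] by blast
    have "prob {\<omega>\<in>space M. t / n < \<bar>(V u \<omega> - V v \<omega>) $ c / dist u v\<bar>} \<le> 2 * exp (w / 2) * exp (- (t / n))"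
      by (rule normal_char_tail[OF w(2)])
    also have "\<dots> \<le> 2 * exp (b / 2) * exp (- (t / n))" using w(1) by simp
    finally show ?thesis by simp
  qed
  then have "prob {\<omega>\<in>space M. n * (t / n) < norm ((1 / dist u v) *\<^sub>R (V u \<omega> - V v \<omega>))} \<le> n * (2 * exp (b / 2) * exp (- (t / n)))"
    unfolding n_def by (intro prob_norm_gt_le_components) auto
  moreover have "n * (t / n) < norm ((1 / dist u v) *\<^sub>R (V u \<omega> - V v \<omega>)) \<longleftrightarrow> t * dist u v < norm (V u \<omega> - V v \<omega>)" for \<omega>
    using n d by (simp add: pos_less_divide_eq)
  ultimately show ?thesis by (simp add: n_def mult.assoc)
qed simp

text \<open>The Lipschitz bound on k gives increments over distance d a standard deviation of order
  d, so paths on a countable dense set are almost surely uniformly continuous and extend; the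
  variances of linear combinations follow by dominated convergence.\<close>

theorem continuous_gaussian_process_exists:
  fixes Z :: "(real^'d) set" and k :: "real^'d \<Rightarrow> 'x \<Rightarrow> real^'s"
  assumes Z: "compact Z" and inf: "infinite (UNIV :: 'i set)"
    and k: "\<And>z. z \<in> Z \<Longrightarrow> k z \<in> borel_measurable P" "\<And>z. z \<in> Z \<Longrightarrow> square_integrable P (\<lambda>x. norm (k z x))"
    and L: "square_integrable P L"
    and lip: "\<And>u v x. u \<in> Z \<Longrightarrow> v \<in> Z \<Longrightarrow> x \<in> space P \<Longrightarrow> norm (k u x - k v x) \<le> L x * dist u v"
    and L0: "\<And>x. 0 \<le> L x"
  shows "\<exists>(N :: ('i \<Rightarrow> real^'s) measure) W. prob_space N \<and> (\<forall>z\<in>Z. W z \<in> borel_measurable N) \<and>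
    (\<forall>\<omega>. continuous_on Z (\<lambda>z. W z \<omega>)) \<and>
    (\<forall>J a. finite J \<longrightarrow> J \<subseteq> Z \<longrightarrow>
      normal_char N (\<lambda>\<omega>. \<Sum>z\<in>J. inner (a z) (W z \<omega>)) (LINT x|P. (\<Sum>z\<in>J. inner (a z) (k z x))\<^sup>2))"
proof -
  obtain K Q :: real and F :: "nat \<Rightarrow> (real^'d) set"
  where net: "\<forall>j. finite (F j) \<and> F j \<subseteq> Z \<and> F j \<subseteq> F (Suc j) \<and> real (card (F j)) \<le> K * Q ^ j \<and>
    (\<forall>z\<in>Z. \<exists>y\<in>F j. dist z y \<le> (1/4)^j)"
    using compact_nets[OF Z] by (elim exE)
  have F: "finite (F j)" "F j \<subseteq> Z" "F j \<subseteq> F (Suc j)" "real (card (F j)) \<le> K * Q ^ j"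
    "z \<in> Z \<Longrightarrow> \<exists>y\<in>F j. dist z y \<le> (1/4)^j" for j z
    using net by blast+
  define D where "D = (\<Union>j. F j)"
  have DZ: "D \<subseteq> Z" using F(2) by (auto simp: D_def)
  have D: "countable D" using F(1) by (auto simp: D_def intro: countable_finite)
  have k_inner: "square_integrable P (\<lambda>x. inner a (k z x))" if "z \<in> Z" for a z
    using k(1)[OF that]
    by (intro square_integrable_bound[OF square_integrable_cmult[OF k(2)[OF that], of "norm a"]])
      (auto simp: Cauchy_Schwarz_ineq2)
  have k_comp: "\<forall>z\<in>D. \<forall>c. square_integrable P (\<lambda>x. k z x $ c)"
    using k_inner[of _ "axis _ 1"] DZ by (auto simp: inner_axis')
  obtain N :: "('i \<Rightarrow> real^'s) measure" and V where *: "prob_space N \<and> (\<forall>z. V z \<in> borel_measurable N) \<and>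
    (\<forall>(J :: (real^'d) set) a zz. finite J \<longrightarrow> zz ` J \<subseteq> D \<longrightarrow>
      normal_char N (\<lambda>\<omega>. \<Sum>j\<in>J. inner (a j) (V (zz j) \<omega>)) (LINT x|P. (\<Sum>j\<in>J. inner (a j) (k (zz j) x))\<^sup>2))"
    using gaussian_family_on_countable[where k=k and P=P, OF inf D k_comp] by (elim exE)
  note N = *[THEN conjunct1] and V_m[measurable] = *[THEN conjunct2, THEN conjunct1, rule_format]
    and V = *[THEN conjunct2, THEN conjunct2, rule_format]
  interpret N: prob_space N by (rule N)
  define l2 where "l2 = (LINT x|P. (L x)\<^sup>2)"
  have tail: "N.prob {\<omega>\<in>space N. t * dist u v < norm (V u \<omega> - V v \<omega>)}
      \<le> (CARD('s) * (2 * exp (l2 / 2))) * exp (- (1 / CARD('s)) * t)" if uv: "u \<in> D" "v \<in> D" for u v t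
  proof (rule N.gaussian_increment_tail)
    fix c assume "u \<noteq> v"
    then have d: "0 < dist u v" by simp
    \<comment> \<open>Opposite coefficients at u and v, scaled by \<open>1 / dist u v\<close>, write
      the normalized component of the increment as a linear combination covered by V.\<close>
    define a :: "real^'d \<Rightarrow> real^'s" where "a j = (if j = u then 1 else - 1) *\<^sub>R axis c (1 / dist u v)" for j
    have *: "(\<Sum>j\<in>{u, v}. inner (a j) (X j)) = (X u - X v) $ c / dist u v" for X :: "real^'d \<Rightarrow> real^'s"
      using \<open>u \<noteq> v\<close> by (simp add: a_def inner_axis' diff_divide_distrib)
    have "normal_char N (\<lambda>\<omega>. \<Sum>j\<in>{u, v}. inner (a j) (V j \<omega>)) (LINT x|P. (\<Sum>j\<in>{u, v}. inner (a j) (k j x))\<^sup>2)"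
      using uv by (intro V) auto
    then have "normal_char N (\<lambda>\<omega>. (V u \<omega> - V v \<omega>) $ c / dist u v) (LINT x|P. ((k u x - k v x) $ c / dist u v)\<^sup>2)"
      unfolding * .
    moreover have "(LINT x|P. ((k u x - k v x) $ c / dist u v)\<^sup>2) \<le> l2"
      unfolding l2_def
    proof (rule integral_mono')
      show "integrable P (\<lambda>x. (L x)\<^sup>2)" using L by (simp add: square_integrable_def)
      fix x assume x: "x \<in> space P"
      have "\<bar>(k u x - k v x) $ c\<bar> \<le> L x * dist u v"
        using lip[of u v x] component_le_norm_cart[of "k u x - k v x" c] uv DZ x by fastforce
      then have "\<bar>(k u x - k v x) $ c / dist u v\<bar> \<le> \<bar>L x\<bar>"
        using d L0[of x] by (simp add: pos_divide_le_eq)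
      then show "((k u x - k v x) $ c / dist u v)\<^sup>2 \<le> (L x)\<^sup>2"
        by (simp only: abs_le_square_iff)
    qed simp
    ultimately show "\<exists>w\<le>l2. normal_char N (\<lambda>\<omega>. (V u \<omega> - V v \<omega>) $ c / dist u v) w" by blast
  qed auto
  have netD: "\<exists>y\<in>F j. dist z y \<le> (1/4)^j" if "z \<in> (\<Union>i. F i)" for j z
    using F(5)[of z j] that F(2) by blast
  \<comment> \<open>Tolerance (1/2)^i for every i: the exceptional probabilities are summable and
    the tolerances tend to 0, so the Borel-Cantelli lemma yields uniform continuity outside a null
    set.\<close>
  have "\<exists>\<delta>>0. \<exists>A\<in>sets N. N.prob A \<le> (1/2)^i \<and>
      (\<forall>\<omega>\<in>space N - A. \<forall>u\<in>D. \<forall>v\<in>D. dist u v \<le> \<delta> \<longrightarrow> norm (V u \<omega> - V v \<omega>) \<le> (1/2)^i)" for i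
  proof -
    have c: "0 < 1 / real CARD('s)" and e: "(0::real) < (1/2)^i" by simp_all
    obtain \<delta> where \<delta>: "\<delta> > 0 \<and> (\<forall>(M :: ('i \<Rightarrow> real^'s) measure) (V :: real^'d \<Rightarrow> ('i \<Rightarrow> real^'s) \<Rightarrow> real^'s).
      prob_space M \<longrightarrow> (\<forall>z\<in>(\<Union>i. F i). V z \<in> borel_measurable M) \<longrightarrow>
      (\<forall>u\<in>(\<Union>i. F i). \<forall>v\<in>(\<Union>i. F i). \<forall>t>0.
        measure M {\<omega>\<in>space M. t * dist u v < norm (V u \<omega> - V v \<omega>)}
          \<le> (CARD('s) * (2 * exp (l2 / 2))) * exp (- (1 / CARD('s)) * t)) \<longrightarrow>
      (\<exists>A\<in>sets M. measure M A \<le> (1/2)^i \<and>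
        (\<forall>\<omega>\<in>space M - A. \<forall>u\<in>(\<Union>i. F i). \<forall>v\<in>(\<Union>i. F i). dist u v \<le> \<delta> \<longrightarrow> norm (V u \<omega> - V v \<omega>) \<le> (1/2)^i)))"
      by (rule exE[OF chaining_modulus[OF F(1,3,4) netD c e, where C = "CARD('s) * (2 * exp (l2 / 2))"]],
          assumption, rule that)
    have "\<exists>A\<in>sets N. N.prob A \<le> (1/2)^i \<and>
      (\<forall>\<omega>\<in>space N - A. \<forall>u\<in>D. \<forall>v\<in>D. dist u v \<le> \<delta> \<longrightarrow> norm (V u \<omega> - V v \<omega>) \<le> (1/2)^i)"
      unfolding D_def using tail unfolding D_def
      by (intro \<delta>[THEN conjunct2, rule_format] N V_m) auto
    then show ?thesis using \<delta> by blast
  qed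
  then obtain \<delta> A where \<delta>: "\<And>i. 0 < \<delta> i" and A_m[measurable]: "\<And>i. A i \<in> sets N" and A: "\<And>i. N.prob (A i) \<le> (1/2)^i"
    and mod: "\<And>i \<omega> u v. \<omega> \<in> space N - A i \<Longrightarrow> u \<in> D \<Longrightarrow> v \<in> D \<Longrightarrow> dist u v \<le> \<delta> i \<Longrightarrow> norm (V u \<omega> - V v \<omega>) \<le> (1/2)^i"
    by metis
  define G where "G = {\<omega>\<in>space N. \<exists>m. \<forall>i\<ge>m. \<omega> \<notin> A i}"
  have G_m[measurable]: "G \<in> sets N" unfolding G_def by measurable
  have G_AE: "AE \<omega> in N. \<omega> \<in> G"
  proof -
    have "summable (\<lambda>i. N.prob (A i))"
      using A by (intro summable_comparison_test[OF _ summable_geometric[of "1/2::real"]]) auto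
    then have "AE \<omega> in N. \<forall>\<^sub>F i in sequentially. \<omega> \<in> space N - A i"
      by (intro borel_cantelli_AE1) (auto simp: N.emeasure_eq_measure)
    then show ?thesis
      by eventually_elim (auto simp: G_def eventually_sequentially)
  qed
  have uc: "uniformly_continuous_on D (\<lambda>z. V z \<omega>)" if \<omega>: "\<omega> \<in> G" for \<omega>
    unfolding uniformly_continuous_on_def
  proof (intro allI impI)
    fix e :: real assume e: "0 < e"
    obtain m where m: "\<And>i. i \<ge> m \<Longrightarrow> \<omega> \<notin> A i" using \<omega> by (auto simp: G_def)
    obtain i0 where i0: "(1/2::real)^i0 < e" using real_arch_pow_inv[OF e, of "1/2"] by auto
    define i where "i = max m i0"
    have "(1/2::real)^i \<le> (1/2)^i0" by (intro power_decreasing) (auto simp: i_def)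
    then have "(1/2::real)^i < e" using i0 by linarith
    moreover have "\<omega> \<in> space N - A i" using m[of i] \<omega> by (auto simp: i_def G_def)
    ultimately have i: "(1/2::real)^i < e" "\<omega> \<in> space N - A i" by auto
    show "\<exists>d>0. \<forall>x\<in>D. \<forall>x'\<in>D. dist x' x < d \<longrightarrow> dist (V x' \<omega>) (V x \<omega>) < e"
      using mod[OF i(2)] i(1) \<delta>[of i] by (intro exI[of _ "\<delta> i"]) (force simp: dist_norm)
  qed
  define ext where "ext \<omega> = (SOME g. continuous_on (closure D) g \<and> (\<forall>x\<in>D. V x \<omega> = g x))" for \<omega>
  have ext: "continuous_on (closure D) (ext \<omega>) \<and> (\<forall>x\<in>D. V x \<omega> = ext \<omega> x)" if \<omega>: "\<omega> \<in> G" for \<omega>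
  proof -
    have "\<exists>g. continuous_on (closure D) g \<and> (\<forall>x\<in>D. V x \<omega> = g x)"
    proof (rule uniformly_continuous_on_extension_on_closure[OF uc[OF \<omega>]])
      fix g assume "uniformly_continuous_on (closure D) g" "\<And>x. x \<in> D \<Longrightarrow> V x \<omega> = g x"
      then show ?thesis using uniformly_continuous_imp_continuous by blast
    qed
    then show ?thesis unfolding ext_def by (rule someI_ex)
  qed
  have seq: "\<exists>y. (\<forall>n. y n \<in> D) \<and> (\<forall>n. dist z (y n) \<le> (1/4)^n)" if "z \<in> Z" for z
  proof -
    have "\<forall>n. \<exists>y. y \<in> D \<and> dist z y \<le> (1/4)^n" using F(5)[OF that] unfolding D_def by blast
    then show ?thesis by metis
  qed
  then obtain y where y: "\<And>z n. z \<in> Z \<Longrightarrow> y z n \<in> D" "\<And>z n. z \<in> Z \<Longrightarrow> dist z (y z n) \<le> (1/4)^n" by metis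
  have y_lim: "y z \<longlonglongrightarrow> z" if "z \<in> Z" for z
  proof (rule metric_tendsto_imp_tendsto)
    show "(\<lambda>n. (1/4::real)^n) \<longlonglongrightarrow> 0" by (intro LIMSEQ_realpow_zero) auto
    show "\<forall>\<^sub>F n in sequentially. dist (y z n) z \<le> dist ((1/4::real)^n) 0"
      using y(2)[OF that] by (intro always_eventually) (simp add: dist_commute)
  qed
  have ZD: "Z \<subseteq> closure D" using y(1) y_lim closure_sequential by blast
  \<comment> \<open>The value 0 off G makes every path continuous, not only almost every
    one.\<close>
  define W where "W z \<omega> = (if \<omega> \<in> G then ext \<omega> z else 0)" for z \<omega>
  have W_cont: "continuous_on Z (\<lambda>z. W z \<omega>)" for \<omega>
    using continuous_on_subset[OF _ ZD] ext[of \<omega>] by (cases "\<omega> \<in> G") (auto simp: W_def)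
  have W_lim: "(\<lambda>n. V (y z n) \<omega>) \<longlonglongrightarrow> W z \<omega>" if "\<omega> \<in> G" "z \<in> Z" for \<omega> z
  proof -
    have "((ext \<omega>) \<circ> y z) \<longlonglongrightarrow> ext \<omega> z"
      using ext[OF that(1)] y(1)[OF that(2)] y_lim[OF that(2)] ZD that(2) closure_subset[of D]
      unfolding continuous_on_sequentially by blast
    moreover have "ext \<omega> (y z n) = V (y z n) \<omega>" for n using ext[OF that(1)] y(1)[OF that(2)] by simp
    ultimately show ?thesis using that by (simp add: W_def o_def)
  qed
  \<comment> \<open>\<open>ext\<close> is an arbitrary choice for each \<omega>, so measurability is
    drawn from \<open>W z\<close> being a pointwise limit of measurable functions built from
    V.\<close>
  have W_m: "W z \<in> borel_measurable N" if "z \<in> Z" for z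
  proof (rule borel_measurable_LIMSEQ_metric)
    show "(\<lambda>\<omega>. indicator G \<omega> *\<^sub>R V (y z n) \<omega>) \<in> borel_measurable N" for n by measurable
    show "(\<lambda>n. indicator G \<omega> *\<^sub>R V (y z n) \<omega>) \<longlonglongrightarrow> W z \<omega>" for \<omega>
      using W_lim[OF _ that, of \<omega>] by (cases "\<omega> \<in> G") (auto simp: W_def)
  qed
  show ?thesis
  proof (intro exI[of _ N] exI[of _ W] conjI N ballI allI impI W_m W_cont)
    fix J and a :: "real^'d \<Rightarrow> real^'s" assume J: "finite J" "J \<subseteq> Z"
    show "normal_char N (\<lambda>\<omega>. \<Sum>z\<in>J. inner (a z) (W z \<omega>)) (LINT x|P. (\<Sum>z\<in>J. inner (a z) (k z x))\<^sup>2)"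
    proof (rule N.normal_char_lim)
      show "normal_char N (\<lambda>\<omega>. \<Sum>z\<in>J. inner (a z) (V (y z n) \<omega>)) (LINT x|P. (\<Sum>z\<in>J. inner (a z) (k (y z n) x))\<^sup>2)" for n
        using y(1) J by (intro V) auto
      show "AE \<omega> in N. (\<lambda>n. \<Sum>z\<in>J. inner (a z) (V (y z n) \<omega>)) \<longlonglongrightarrow> (\<Sum>z\<in>J. inner (a z) (W z \<omega>))"
        using G_AE
      proof eventually_elim
        case (elim \<omega>)
        then show ?case using W_lim[OF elim] J by (intro tendsto_sum tendsto_inner tendsto_const) auto
      qed
      show "(\<lambda>\<omega>. \<Sum>z\<in>J. inner (a z) (W z \<omega>)) \<in> borel_measurable N"
        using W_m J by (intro borel_measurable_sum borel_measurable_inner) auto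
      \<comment> \<open>Dominating function: \<open>y z n\<close> is within (1/4)^n \<le> 1 of z, so
        \<open>k (y z n) x\<close> exceeds \<open>k z x\<close> in norm by at most
        \<open>L x\<close>.\<close>
      define w where "w x = (\<Sum>z\<in>J. norm (a z) * (norm (k z x) + L x))" for x
      have w: "square_integrable P w"
        unfolding w_def using J by (intro square_integrable_sum square_integrable_cmult square_integrable_add k(2) L) auto
      have kc: "norm (k (y z n) x - k z x) \<le> L x * (1/4)^n" if "z \<in> Z" "x \<in> space P" for z n x
      proof -
        have "norm (k (y z n) x - k z x) \<le> L x * dist (y z n) z"
          using lip y(1)[OF that(1)] DZ that by blast
        also have "\<dots> \<le> L x * (1/4)^n"
          using y(2)[OF that(1), of n] L0 by (intro mult_left_mono) (auto simp: dist_commute)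
        finally show ?thesis .
      qed
      show "(\<lambda>n. LINT x|P. (\<Sum>z\<in>J. inner (a z) (k (y z n) x))\<^sup>2) \<longlonglongrightarrow> (LINT x|P. (\<Sum>z\<in>J. inner (a z) (k z x))\<^sup>2)"
      proof (rule integral_dominated_convergence[where w = "\<lambda>x. (w x)\<^sup>2"])
        show "integrable P (\<lambda>x. (w x)\<^sup>2)" using w by (simp add: square_integrable_def)
        show "(\<lambda>x. (\<Sum>z\<in>J. inner (a z) (k z x))\<^sup>2) \<in> borel_measurable P"
          using k(1) J by (intro borel_measurable_power borel_measurable_sum borel_measurable_inner) auto
        show "(\<lambda>x. (\<Sum>z\<in>J. inner (a z) (k (y z n) x))\<^sup>2) \<in> borel_measurable P" for n
          using J y(1) DZ by (intro borel_measurable_power borel_measurable_sum borel_measurable_inner k(1)) auto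
        show "AE x in P. (\<lambda>n. (\<Sum>z\<in>J. inner (a z) (k (y z n) x))\<^sup>2) \<longlonglongrightarrow> (\<Sum>z\<in>J. inner (a z) (k z x))\<^sup>2"
        proof (rule AE_I2)
          fix x assume x: "x \<in> space P"
          have "(\<lambda>n. k (y z n) x) \<longlonglongrightarrow> k z x" if "z \<in> J" for z
          proof (rule Lim_transform_bound[where g="\<lambda>n. L x * (1/4)^n", THEN LIM_zero_cancel])
            show "\<forall>\<^sub>F n in sequentially. norm (k (y z n) x - k z x) \<le> norm (L x * (1/4)^n)"
              using kc[of z x] that J x by (intro always_eventually) (auto intro: order_trans[OF _ abs_ge_self])
            have "(\<lambda>n. L x * (1/4)^n) \<longlonglongrightarrow> L x * 0"
              by (intro tendsto_intros LIMSEQ_realpow_zero) auto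
            then show "(\<lambda>n. L x * (1/4)^n) \<longlonglongrightarrow> 0" by simp
          qed
          then show "(\<lambda>n. (\<Sum>z\<in>J. inner (a z) (k (y z n) x))\<^sup>2) \<longlonglongrightarrow> (\<Sum>z\<in>J. inner (a z) (k z x))\<^sup>2"
            by (intro tendsto_power tendsto_sum tendsto_inner tendsto_const) auto
        qed
        show "AE x in P. norm ((\<Sum>z\<in>J. inner (a z) (k (y z n) x))\<^sup>2) \<le> (w x)\<^sup>2" for n
        proof (rule AE_I2)
          fix x assume x: "x \<in> space P"
          have "\<bar>\<Sum>z\<in>J. inner (a z) (k (y z n) x)\<bar> \<le> (\<Sum>z\<in>J. \<bar>inner (a z) (k (y z n) x)\<bar>)"
            by (rule sum_abs)
          also have "\<dots> \<le> w x"
            unfolding w_def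
          proof (rule sum_mono)
            fix z assume "z \<in> J"
            then have z: "z \<in> Z" using J by auto
            have "norm (k (y z n) x) \<le> norm (k z x) + norm (k (y z n) x - k z x)"
              by (rule norm_triangle_sub)
            also have "norm (k (y z n) x - k z x) \<le> L x * (1/4)^n" by (rule kc[OF z x])
            also have "L x * (1/4)^n \<le> L x * 1" using L0 by (intro mult_left_mono power_le_one) auto
            finally have "norm (k (y z n) x) \<le> norm (k z x) + L x" by simp
            then have "norm (a z) * norm (k (y z n) x) \<le> norm (a z) * (norm (k z x) + L x)"
              by (intro mult_left_mono) auto
            then show "\<bar>inner (a z) (k (y z n) x)\<bar> \<le> norm (a z) * (norm (k z x) + L x)"
              using Cauchy_Schwarz_ineq2[of "a z" "k (y z n) x"] by linarith
          qed
          finally have "\<bar>\<Sum>z\<in>J. inner (a z) (k (y z n) x)\<bar> \<le> \<bar>w x\<bar>" by linarith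
          then show "norm ((\<Sum>z\<in>J. inner (a z) (k (y z n) x))\<^sup>2) \<le> (w x)\<^sup>2"
            by (simp add: abs_le_square_iff)
        qed
      qed
    qed
  qed
qed

section \<open>The delta method for optimal values\<close>

lemma modulus_from_dense:
  fixes w :: "'z::metric_space \<Rightarrow> 'b::real_normed_vector"
  assumes D: "D \<subseteq> Z" "Z \<subseteq> closure D" and w: "continuous_on Z w"
    and mod: "\<And>u v. u \<in> D \<Longrightarrow> v \<in> D \<Longrightarrow> dist u v \<le> \<delta> \<Longrightarrow> norm (w u - w v) \<le> \<eta>"
    and uv: "u \<in> Z" "v \<in> Z" "dist u v < \<delta>"
  shows "norm (w u - w v) \<le> \<eta>"
proof -
  obtain x where x: "\<And>n. x n \<in> D" "x \<longlonglongrightarrow> u" using D(2) uv(1) closure_sequential by blast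
  obtain y where y: "\<And>n. y n \<in> D" "y \<longlonglongrightarrow> v" using D(2) uv(2) closure_sequential by blast
  have wl: "(\<lambda>n. w (x n)) \<longlonglongrightarrow> w u" "(\<lambda>n. w (y n)) \<longlonglongrightarrow> w v"
    using x y D(1) uv by (auto intro!: continuous_on_tendsto_compose[OF w] always_eventually)
  \<comment> \<open>Strictness of dist u v < \<delta> lets the approximating pairs satisfy the same
    bound eventually; it is the source of the halved radii in the applications.\<close>
  have "(\<lambda>n. dist (x n) (y n)) \<longlonglongrightarrow> dist u v" by (intro tendsto_dist x y)
  then have "\<forall>\<^sub>F n in sequentially. dist (x n) (y n) < \<delta>" using uv(3) by (rule order_tendstoD)
  then have ev: "\<forall>\<^sub>F n in sequentially. norm (w (x n) - w (y n)) \<le> \<eta>"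
    by eventually_elim (intro mod x y less_imp_le)
  have "(\<lambda>n. norm (w (x n) - w (y n))) \<longlonglongrightarrow> norm (w u - w v)" by (intro tendsto_intros wl)
  then show ?thesis using ev by (intro tendsto_upperbound[of _ _ sequentially]) auto
qed

lemma (in prob_space) prob_decseq_tendsto_empty:
  assumes A: "\<And>j. A j \<in> sets M" and dec: "decseq A" and empty: "(\<Inter>j. A j) = {}" and \<eta>: "0 < \<eta>"
  shows "\<exists>j. prob (A j) \<le> \<eta>"
proof -
  have "(\<lambda>j. prob (A j)) \<longlonglongrightarrow> prob (\<Inter>j. A j)"
    using A dec by (intro finite_Lim_measure_decseq) auto
  then have "(\<lambda>j. prob (A j)) \<longlonglongrightarrow> 0" using empty by simp
  then have "\<forall>\<^sub>F j in sequentially. prob (A j) < \<eta>" using \<eta> by (rule order_tendstoD)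
  then show ?thesis by (auto simp: eventually_sequentially intro: less_imp_le)
qed

text \<open>Each path is uniformly continuous, so the bad events for the radii 1 / (j + 1) decrease
  to the empty set, and continuity of the measure from above picks one radius. Restricting to a
  countable dense set makes the events measurable.\<close>

lemma (in prob_space) continuous_process_modulus:
  fixes W :: "'z::euclidean_space \<Rightarrow> 'a \<Rightarrow> 'b::euclidean_space"
  assumes Z: "compact Z" and W: "\<And>z. z \<in> Z \<Longrightarrow> W z \<in> borel_measurable M"
    and cont: "\<And>\<omega>. \<omega> \<in> space M \<Longrightarrow> continuous_on Z (\<lambda>z. W z \<omega>)" and \<eta>: "0 < \<eta>"
  shows "\<exists>\<delta>>0. \<exists>A\<in>sets M. prob A \<le> \<eta> \<and>
    (\<forall>\<omega>\<in>space M - A. \<forall>u\<in>Z. \<forall>v\<in>Z. dist u v \<le> \<delta> \<longrightarrow> norm (W u \<omega> - W v \<omega>) \<le> \<eta>)"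
proof -
  obtain D where D: "countable D" "D \<subseteq> Z" "Z \<subseteq> closure D" using separable by blast
  define r where "r j = 1 / real (Suc j)" for j
  define A where "A j = {\<omega>\<in>space M. \<exists>u\<in>D. \<exists>v\<in>D. dist u v \<le> r j \<and> \<eta> < norm (W u \<omega> - W v \<omega>)}" for j
  have A_m: "A j \<in> sets M" for j
  proof -
    have "A j = (\<Union>u\<in>D. \<Union>v\<in>D. {\<omega>\<in>space M. dist u v \<le> r j \<and> \<eta> < norm (W u \<omega> - W v \<omega>)})"
      by (auto simp: A_def)
    also have "\<dots> \<in> sets M"
    proof (intro sets.countable_UN'' D(1))
      fix u v assume "u \<in> D" "v \<in> D"
      then have [measurable]: "W u \<in> borel_measurable M" "W v \<in> borel_measurable M" using W D(2) by auto
      show "{\<omega>\<in>space M. dist u v \<le> r j \<and> \<eta> < norm (W u \<omega> - W v \<omega>)} \<in> sets M" by measurable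
    qed
    finally show ?thesis .
  qed
  have r_dec: "r j \<le> r i" if "i \<le> j" for i j using that by (simp add: r_def frac_le)
  have dec: "decseq A"
    unfolding decseq_def
  proof (intro allI impI subsetI)
    fix i j \<omega> assume ij: "i \<le> j" and "\<omega> \<in> A j"
    then obtain u v where "\<omega> \<in> space M" "u \<in> D" "v \<in> D" "dist u v \<le> r j" "\<eta> < norm (W u \<omega> - W v \<omega>)"
      unfolding A_def by blast
    moreover have "dist u v \<le> r i" using r_dec[OF ij] calculation(4) by linarith
    ultimately show "\<omega> \<in> A i" unfolding A_def by blast
  qed
  have "(\<Inter>j. A j) = {}"
  proof (rule ccontr)
    assume "(\<Inter>j. A j) \<noteq> {}"
    then obtain \<omega> where \<omega>: "\<And>j. \<omega> \<in> A j" by auto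
    then have sp: "\<omega> \<in> space M" by (auto simp: A_def)
    have "uniformly_continuous_on Z (\<lambda>z. W z \<omega>)" by (intro compact_uniformly_continuous cont sp Z)
    then obtain d where d: "0 < d" "\<And>u v. u \<in> Z \<Longrightarrow> v \<in> Z \<Longrightarrow> dist u v < d \<Longrightarrow> dist (W u \<omega>) (W v \<omega>) < \<eta>"
      using \<eta> unfolding uniformly_continuous_on_def by (metis dist_commute)
    obtain j where "r j < d" using nat_approx_posE[OF d(1)] by (auto simp: r_def)
    moreover obtain u v where "u \<in> D" "v \<in> D" "dist u v \<le> r j" "\<eta> < norm (W u \<omega> - W v \<omega>)"
      using \<omega>[of j] by (auto simp: A_def)
    ultimately show False using d(2)[of u v] D(2) by (force simp: dist_norm)
  qed
  then obtain j where j: "prob (A j) \<le> \<eta>"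
    using prob_decseq_tendsto_empty[OF A_m dec _ \<eta>] by blast
  have rj: "0 < r j" by (simp add: r_def)
  show ?thesis
  proof (intro exI[of _ "r j / 2"] conjI bexI[OF _ A_m[of j]] ballI impI j)
    fix \<omega> u v assume \<omega>: "\<omega> \<in> space M - A j" and uv: "u \<in> Z" "v \<in> Z" "dist u v \<le> r j / 2"
    show "norm (W u \<omega> - W v \<omega>) \<le> \<eta>"
    proof (rule modulus_from_dense[OF D(2,3), where w="\<lambda>z. W z \<omega>" and \<delta>="r j"])
      show "continuous_on Z (\<lambda>z. W z \<omega>)" using \<omega> cont by auto
      show "norm (W u \<omega> - W v \<omega>) \<le> \<eta>" if "u \<in> D" "v \<in> D" "dist u v \<le> r j" for u v
        using \<omega> that by (force simp: A_def not_less)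
    qed (use uv rj in auto)
  qed (use rj in auto)
qed

text \<open>Continuity from above once more: each path is bounded on the compact Z, so the events
  that the norm exceeds j somewhere on a countable dense set decrease to the empty set.\<close>

lemma (in prob_space) continuous_process_bounded:
  fixes W :: "'z::euclidean_space \<Rightarrow> 'a \<Rightarrow> 'b::euclidean_space"
  assumes Z: "compact Z" and W: "\<And>z. z \<in> Z \<Longrightarrow> W z \<in> borel_measurable M"
    and cont: "\<And>\<omega>. \<omega> \<in> space M \<Longrightarrow> continuous_on Z (\<lambda>z. W z \<omega>)" and \<eta>: "0 < \<eta>"
  shows "\<exists>R. \<exists>A\<in>sets M. prob A \<le> \<eta> \<and> (\<forall>\<omega>\<in>space M - A. \<forall>z\<in>Z. norm (W z \<omega>) \<le> R)"
proof -
  obtain D where D: "countable D" "D \<subseteq> Z" "Z \<subseteq> closure D" using separable by blast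
  define A where "A j = {\<omega>\<in>space M. \<exists>u\<in>D. real j < norm (W u \<omega>)}" for j
  have A_m: "A j \<in> sets M" for j
  proof -
    have "A j = (\<Union>u\<in>D. {\<omega>\<in>space M. real j < norm (W u \<omega>)})" by (auto simp: A_def)
    also have "\<dots> \<in> sets M"
    proof (intro sets.countable_UN'' D(1))
      fix u assume "u \<in> D"
      then have [measurable]: "W u \<in> borel_measurable M" using W D(2) by auto
      show "{\<omega>\<in>space M. real j < norm (W u \<omega>)} \<in> sets M" by measurable
    qed
    finally show ?thesis .
  qed
  have dec: "decseq A"
    unfolding decseq_def
  proof (intro allI impI subsetI)
    fix i j :: nat and \<omega> assume ij: "i \<le> j" and "\<omega> \<in> A j"
    then obtain u where "\<omega> \<in> space M" "u \<in> D" "real j < norm (W u \<omega>)" unfolding A_def by blast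
    moreover have "real i < norm (W u \<omega>)" using ij calculation(3) by linarith
    ultimately show "\<omega> \<in> A i" unfolding A_def by blast
  qed
  have "(\<Inter>j. A j) = {}"
  proof (rule ccontr)
    assume "(\<Inter>j. A j) \<noteq> {}"
    then obtain \<omega> where \<omega>: "\<And>j. \<omega> \<in> A j" by auto
    then have sp: "\<omega> \<in> space M" by (auto simp: A_def)
    obtain b where b: "\<And>z. z \<in> Z \<Longrightarrow> norm (W z \<omega>) \<le> b"
      using compact_imp_bounded[OF compact_continuous_image[OF cont[OF sp] Z]] by (auto simp: bounded_iff)
    obtain j where "b < real j" using reals_Archimedean2 by blast
    moreover obtain u where "u \<in> D" "real j < norm (W u \<omega>)" using \<omega>[of j] by (auto simp: A_def)
    ultimately show False using b[of u] D(2) by force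
  qed
  then obtain j where j: "prob (A j) \<le> \<eta>"
    using prob_decseq_tendsto_empty[OF A_m dec _ \<eta>] by blast
  show ?thesis
  proof (intro exI[of _ "real j"] conjI bexI[OF _ A_m[of j]] ballI j)
    fix \<omega> z assume \<omega>: "\<omega> \<in> space M - A j" and z: "z \<in> Z"
    obtain x where x: "\<And>n. x n \<in> D" "x \<longlonglongrightarrow> z" using D(3) z closure_sequential by blast
    have "(\<lambda>n. W (x n) \<omega>) \<longlonglongrightarrow> W z \<omega>"
      using x D(2) z \<omega> by (auto intro!: continuous_on_tendsto_compose[OF cont] always_eventually)
    then have "(\<lambda>n. norm (W (x n) \<omega>)) \<longlonglongrightarrow> norm (W z \<omega>)" by (rule tendsto_norm)
    moreover have "norm (W (x n) \<omega>) \<le> real j" for n using \<omega> x(1) by (force simp: A_def not_less)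
    ultimately show "norm (W z \<omega>) \<le> real j" by (intro tendsto_upperbound[of _ _ sequentially]) auto
  qed
qed

section \<open>Reduction to finite nets and the weak limit\<close>

context composite_minimization
begin

text \<open>Passing to fewer points can only raise a minimum, so the first direction is exact; the
  second loses the oscillation (G + 1) e over one ball of the net.\<close>

lemma min_value_finite_net:
  assumes w: "continuous_on Z w" and bd: "\<And>z. z \<in> Z \<Longrightarrow> norm (w z) \<le> R"
    and mod: "\<And>u v. u \<in> Z \<Longrightarrow> v \<in> Z \<Longrightarrow> dist u v \<le> \<delta> \<Longrightarrow> norm (w u - w v) \<le> e"
    and gmod: "\<And>u v. u \<in> Z \<Longrightarrow> v \<in> Z \<Longrightarrow> dist u v < r \<Longrightarrow> R * norm (g u - g v) \<le> e"
    and G: "0 \<le> G" "\<And>z. z \<in> Z \<Longrightarrow> norm (g z) \<le> G" and e: "0 \<le> e"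
    and J: "J \<subseteq> Zhat" "Zhat \<subseteq> (\<Union>z\<in>J. ball z (min r \<delta>))"
  shows "y < min_value (\<lambda>z. inner (g z) (w z)) Zhat \<Longrightarrow> \<forall>j\<in>J. y < inner (g j) (w j)"
    "\<forall>j\<in>J. y < inner (g j) (w j) \<Longrightarrow> y - (G + 1) * e < min_value (\<lambda>z. inner (g z) (w z)) Zhat"
proof -
  have cz: "continuous_on Zhat (\<lambda>z. inner (g z) (w z))"
    by (intro continuous_intros continuous_on_subset[OF cont_g Zhat_subset] continuous_on_subset[OF w Zhat_subset])
  obtain zh where "zh \<in> Zhat \<and> min_value (\<lambda>z. inner (g z) (w z)) Zhat = inner (g zh) (w zh) \<and>
      (\<forall>y\<in>Zhat. inner (g zh) (w zh) \<le> inner (g y) (w y))"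
    by (rule min_value_attained[OF compact_Zhat Zhat_nonempty cz]) auto
  then have zh: "zh \<in> Zhat" "min_value (\<lambda>z. inner (g z) (w z)) Zhat = inner (g zh) (w zh)"
      "\<And>y. y \<in> Zhat \<Longrightarrow> inner (g zh) (w zh) \<le> inner (g y) (w y)" by auto
  show "\<forall>j\<in>J. y < inner (g j) (w j)" if "y < min_value (\<lambda>z. inner (g z) (w z)) Zhat"
    using that zh J(1) by force
  show "y - (G + 1) * e < min_value (\<lambda>z. inner (g z) (w z)) Zhat" if *: "\<forall>j\<in>J. y < inner (g j) (w j)"
  proof -
    obtain j where j: "j \<in> J" "dist j zh < min r \<delta>" using J(2) zh(1) by auto
    have jZ: "j \<in> Z" "zh \<in> Z" using j zh(1) J(1) Zhat_subset by auto
    have "\<bar>inner (g j) (w j) - inner (g zh) (w zh)\<bar> \<le> (G + 1) * e"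
      using j jZ G e by (intro inner_g_modulus[where R=R] gmod mod bd) auto
    moreover have "y < inner (g j) (w j)" using * j(1) by simp
    ultimately show ?thesis unfolding zh(2) by linarith
  qed
qed

text \<open>For large n, the value \<open>Y n\<close>, the minimum over \<open>Zhat\<close> of the
  linear form in \<open>S n\<close>, and its minimum over a finite net J agree up to a small
  constant outside a small event; the same J works for W. What remains is to compare vectors indexed
  by J, which is the orthant form of the Cramer-Wold theorem.\<close>

theorem delta_method_weak_conv:
  fixes S :: "nat \<Rightarrow> 'z \<Rightarrow> 'a \<Rightarrow> 's" and W :: "'z \<Rightarrow> 'b \<Rightarrow> 's" and Y :: "nat \<Rightarrow> 'a \<Rightarrow> real"
  assumes M: "prob_space M" and N: "prob_space N"
    and S_m: "\<And>n z. z \<in> Z \<Longrightarrow> S n z \<in> borel_measurable M" and W_m: "\<And>z. z \<in> Z \<Longrightarrow> W z \<in> borel_measurable N"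
    and S_cont: "\<And>n \<omega>. \<omega> \<in> space M \<Longrightarrow> continuous_on Z (\<lambda>z. S n z \<omega>)"
    and W_cont: "\<And>\<omega>. \<omega> \<in> space N \<Longrightarrow> continuous_on Z (\<lambda>z. W z \<omega>)"
    and fidi: "\<And>J a. finite J \<Longrightarrow> J \<subseteq> Z \<Longrightarrow> (\<lambda>n. CLINT \<omega>|M. iexp (\<Sum>z\<in>J. inner (a z) (S n z \<omega>)))
      \<longlonglongrightarrow> (CLINT \<omega>|N. iexp (\<Sum>z\<in>J. inner (a z) (W z \<omega>)))"
    and S_mod: "\<And>\<eta>. 0 < \<eta> \<Longrightarrow> \<exists>\<delta>>0. \<exists>n0. \<forall>n\<ge>n0. \<exists>A\<in>sets M. measure M A \<le> \<eta> \<and>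
      (\<forall>\<omega>\<in>space M - A. \<forall>u\<in>Z. \<forall>v\<in>Z. dist u v \<le> \<delta> \<longrightarrow> norm (S n u \<omega> - S n v \<omega>) \<le> \<eta>)"
    and S_bd: "\<And>\<eta>. 0 < \<eta> \<Longrightarrow> \<exists>R n0. \<forall>n\<ge>n0. \<exists>A\<in>sets M. measure M A \<le> \<eta> \<and>
      (\<forall>\<omega>\<in>space M - A. \<forall>z\<in>Z. norm (S n z \<omega>) \<le> R)"
    and W_mod: "\<And>\<eta>. 0 < \<eta> \<Longrightarrow> \<exists>\<delta>>0. \<exists>A\<in>sets N. measure N A \<le> \<eta> \<and>
      (\<forall>\<omega>\<in>space N - A. \<forall>u\<in>Z. \<forall>v\<in>Z. dist u v \<le> \<delta> \<longrightarrow> norm (W u \<omega> - W v \<omega>) \<le> \<eta>)"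
    and W_bd: "\<And>\<eta>. 0 < \<eta> \<Longrightarrow> \<exists>R. \<exists>A\<in>sets N. measure N A \<le> \<eta> \<and>
      (\<forall>\<omega>\<in>space N - A. \<forall>z\<in>Z. norm (W z \<omega>) \<le> R)"
    and Y_m: "\<And>n. Y n \<in> borel_measurable M"
    and T_m: "(\<lambda>\<omega>. min_value (\<lambda>z. inner (g z) (W z \<omega>)) Zhat) \<in> borel_measurable N"
    and Y: "\<And>n \<omega>. 1 \<le> n \<Longrightarrow> \<omega> \<in> space M \<Longrightarrow>
      Y n \<omega> = sqrt n * (min_value (\<lambda>z. f z (\<mu> z + (1 / sqrt n) *\<^sub>R S n z \<omega>)) Z - \<rho>)"
  shows "weak_conv_m (\<lambda>n. distr M borel (Y n)) (distr N borel (\<lambda>\<omega>. min_value (\<lambda>z. inner (g z) (W z \<omega>)) Zhat))"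
proof -
  interpret M: prob_space M by fact
  interpret N: prob_space N by fact
  define T where "T w = min_value (\<lambda>z. inner (g z) (w z)) Zhat" for w
  obtain G where G: "0 \<le> G" "\<And>z. z \<in> Z \<Longrightarrow> norm (g z) \<le> G"
    using compact_imp_bounded[OF compact_continuous_image[OF cont_g Z(1)]] Z(2)
    by (auto simp: bounded_iff intro: order_trans[OF norm_ge_zero])
  \<comment> \<open>J is chosen before n, and for each n one exceptional event serves all levels y
    at once.\<close>
  have main: "\<exists>J n0. finite J \<and> J \<subseteq> Z \<and> (\<forall>n\<ge>n0. \<exists>A\<in>sets M. M.prob A \<le> \<eta> \<and>
       (\<forall>\<omega>\<in>space M - A. \<forall>y. (y < Y n \<omega> \<longrightarrow> (\<forall>j\<in>J. y - \<kappa> < inner (g j) (S n j \<omega>))) \<and>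
          ((\<forall>j\<in>J. y < inner (g j) (S n j \<omega>)) \<longrightarrow> y - 2 * \<kappa> < Y n \<omega>))) \<and>
     (\<exists>A\<in>sets N. N.prob A \<le> \<eta> \<and>
       (\<forall>\<omega>\<in>space N - A. \<forall>y. (y < T (\<lambda>z. W z \<omega>) \<longrightarrow> (\<forall>j\<in>J. y < inner (g j) (W j \<omega>))) \<and>
          ((\<forall>j\<in>J. y < inner (g j) (W j \<omega>)) \<longrightarrow> y - \<kappa> < T (\<lambda>z. W z \<omega>))))"
    if \<kappa>: "0 < \<kappa>" and \<eta>: "0 < \<eta>" for \<kappa> \<eta>
  proof -
    \<comment> \<open>Chosen so that the expansion error (G + 2) e equals \<kappa>; the net error (G
      + 1) e is then smaller.\<close>
    define e where "e = \<kappa> / (G + 2)"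
    have e: "0 < e" "(G + 2) * e = \<kappa>" using \<kappa> G(1) by (simp_all add: e_def)
    then have e1: "(G + 1) * e \<le> \<kappa>" by (simp add: algebra_simps)
    \<comment> \<open>One number serves as probability and as oscillation: at most e as a modulus,
      and at most \<eta> / 2 because two exceptional sets are joined.\<close>
    define \<eta>' where "\<eta>' = min e (\<eta> / 2)"
    have \<eta>': "0 < \<eta>'" "\<eta>' \<le> e" "\<eta>' \<le> \<eta> / 2" using e \<eta> by (auto simp: \<eta>'_def)
    obtain \<delta>1 n1 where 1: "0 < \<delta>1" "\<And>n. n \<ge> n1 \<Longrightarrow> \<exists>A\<in>sets M. M.prob A \<le> \<eta>' \<and>
      (\<forall>\<omega>\<in>space M - A. \<forall>u\<in>Z. \<forall>v\<in>Z. dist u v \<le> \<delta>1 \<longrightarrow> norm (S n u \<omega> - S n v \<omega>) \<le> \<eta>')"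
      using S_mod[OF \<eta>'(1)] by blast
    obtain R1 n2 where 2: "\<And>n. n \<ge> n2 \<Longrightarrow> \<exists>A\<in>sets M. M.prob A \<le> \<eta>' \<and>
      (\<forall>\<omega>\<in>space M - A. \<forall>z\<in>Z. norm (S n z \<omega>) \<le> R1)"
      using S_bd[OF \<eta>'(1)] by blast
    obtain \<delta>2 A1 where 3: "0 < \<delta>2" "A1 \<in> sets N" "N.prob A1 \<le> \<eta>'"
      "\<And>\<omega> u v. \<omega> \<in> space N - A1 \<Longrightarrow> u \<in> Z \<Longrightarrow> v \<in> Z \<Longrightarrow> dist u v \<le> \<delta>2 \<Longrightarrow> norm (W u \<omega> - W v \<omega>) \<le> \<eta>'"
      using W_mod[OF \<eta>'(1)] by blast
    obtain R2 A2 where 4: "A2 \<in> sets N" "N.prob A2 \<le> \<eta>'"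
      "\<And>\<omega> z. \<omega> \<in> space N - A2 \<Longrightarrow> z \<in> Z \<Longrightarrow> norm (W z \<omega>) \<le> R2"
      using W_bd[OF \<eta>'(1)] by blast
    define R where "R = max 1 (max R1 R2)"
    define \<delta> where "\<delta> = min \<delta>1 \<delta>2"
    have R: "0 < R" "R1 \<le> R" "R2 \<le> R" by (auto simp: R_def)
    have \<delta>: "0 < \<delta>" "\<delta> \<le> \<delta>1" "\<delta> \<le> \<delta>2" using 1 3 by (auto simp: \<delta>_def)
    obtain r where r: "0 < r" "\<And>u v. u \<in> Z \<Longrightarrow> v \<in> Z \<Longrightarrow> dist u v < r \<Longrightarrow> R * norm (g u - g v) \<le> e"
      using g_modulus[OF R(1) e(1)] by blast
    obtain s0 where s0': "0 < s0 \<and> (\<forall>s w. 0 < s \<longrightarrow> s < s0 \<longrightarrow> continuous_on Z w \<longrightarrow> (\<forall>z\<in>Z. norm (w z) \<le> R) \<longrightarrow>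
      (\<forall>u\<in>Z. \<forall>v\<in>Z. dist u v \<le> \<delta> \<longrightarrow> norm (w u - w v) \<le> e) \<longrightarrow>
      \<bar>(min_value (\<lambda>z. f z (\<mu> z + s *\<^sub>R w z)) Z - \<rho>) / s - T w\<bar> \<le> (G + 2) * e)"
      by (rule exE[OF optimal_value_expansion[OF R(1) e(1) \<delta>(1) G, folded T_def]], assumption, rule that)
    note s0 = s0'[THEN conjunct1] s0'[THEN conjunct2, rule_format]
    have "seq_compact Zhat" "0 < min r \<delta>"
      using compact_Zhat r \<delta> by (simp_all add: compact_eq_seq_compact_metric)
    then obtain J where "finite J \<and> J \<subseteq> Zhat \<and> Zhat \<subseteq> (\<Union>z\<in>J. ball z (min r \<delta>))"
      using seq_compact_imp_totally_bounded by metis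
    then have J: "finite J" "J \<subseteq> Zhat" "Zhat \<subseteq> (\<Union>z\<in>J. ball z (min r \<delta>))" by auto
    have "(\<lambda>n. 1 / sqrt (real n)) \<longlonglongrightarrow> 0"
      by (intro tendsto_divide_0[OF tendsto_const] filterlim_at_top_imp_at_infinity
          filterlim_compose[OF sqrt_at_top filterlim_real_sequentially])
    then have "\<forall>\<^sub>F n in sequentially. 1 / sqrt (real n) < s0" using s0(1) by (rule order_tendstoD)
    then obtain n3 where n3: "\<And>n. n \<ge> n3 \<Longrightarrow> 1 / sqrt (real n) < s0" by (auto simp: eventually_sequentially)
    define n0 where "n0 = max (max n1 n2) (max n3 1)"
    \<comment> \<open>Stated for a single continuous function, so that it applies to paths of
      \<open>S n\<close> and of W alike.\<close>
    have net: "\<forall>y. (y < T w \<longrightarrow> (\<forall>j\<in>J. y < inner (g j) (w j))) \<and>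
          ((\<forall>j\<in>J. y < inner (g j) (w j)) \<longrightarrow> y - \<kappa> < T w)"
      if w: "continuous_on Z w" "\<And>z. z \<in> Z \<Longrightarrow> norm (w z) \<le> R"
        "\<And>u v. u \<in> Z \<Longrightarrow> v \<in> Z \<Longrightarrow> dist u v \<le> \<delta> \<Longrightarrow> norm (w u - w v) \<le> e" for w
    proof (intro allI conjI impI)
      fix y
      show "\<forall>j\<in>J. y < inner (g j) (w j)" if "y < T w"
        by (rule min_value_finite_net(1)[where w=w and R=R and \<delta>=\<delta> and e=e and r=r and G=G,
              OF w(1) w(2) w(3) r(2) G(1) G(2) less_imp_le[OF e(1)] J(2,3) that[unfolded T_def]])
      show "y - \<kappa> < T w" if "\<forall>j\<in>J. y < inner (g j) (w j)"
      proof -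
        have "y - (G + 1) * e < T w"
          unfolding T_def
          by (rule min_value_finite_net(2)[where w=w and R=R and \<delta>=\<delta> and e=e and r=r and G=G,
              OF w(1) w(2) w(3) r(2) G(1) G(2) less_imp_le[OF e(1)] J(2,3) that])
        then show ?thesis using e1 by linarith
      qed
    qed
    show ?thesis
    proof (intro exI[of _ J] exI[of _ n0] conjI allI impI)
      show "finite J" "J \<subseteq> Z" using J Zhat_subset by auto
      show "\<exists>A\<in>sets M. M.prob A \<le> \<eta> \<and>
       (\<forall>\<omega>\<in>space M - A. \<forall>y. (y < Y n \<omega> \<longrightarrow> (\<forall>j\<in>J. y - \<kappa> < inner (g j) (S n j \<omega>))) \<and>
          ((\<forall>j\<in>J. y < inner (g j) (S n j \<omega>)) \<longrightarrow> y - 2 * \<kappa> < Y n \<omega>))" if n: "n0 \<le> n" for n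
      proof -
        have n': "n1 \<le> n" "n2 \<le> n" "n3 \<le> n" "1 \<le> n" using n by (auto simp: n0_def)
        obtain B1 where B1: "B1 \<in> sets M" "M.prob B1 \<le> \<eta>'"
          "\<And>\<omega> u v. \<omega> \<in> space M - B1 \<Longrightarrow> u \<in> Z \<Longrightarrow> v \<in> Z \<Longrightarrow> dist u v \<le> \<delta>1 \<Longrightarrow> norm (S n u \<omega> - S n v \<omega>) \<le> \<eta>'"
          using 1(2)[OF n'(1)] by blast
        obtain B2 where B2: "B2 \<in> sets M" "M.prob B2 \<le> \<eta>'"
          "\<And>\<omega> z. \<omega> \<in> space M - B2 \<Longrightarrow> z \<in> Z \<Longrightarrow> norm (S n z \<omega>) \<le> R1"
          using 2[OF n'(2)] by blast
        show ?thesis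
        proof (rule bexI[of _ "B1 \<union> B2"], rule conjI, goal_cases)
          case 1
          show ?case using measure_Un_le[OF B1(1) B2(1)] B1(2) B2(2) \<eta>'(3) by linarith
        next
          case 2
          show ?case
          proof
            fix \<omega> assume \<omega>: "\<omega> \<in> space M - (B1 \<union> B2)"
            define w where "w z = S n z \<omega>" for z
            have w: "continuous_on Z w" "\<And>z. z \<in> Z \<Longrightarrow> norm (w z) \<le> R"
              "\<And>u v. u \<in> Z \<Longrightarrow> v \<in> Z \<Longrightarrow> dist u v \<le> \<delta> \<Longrightarrow> norm (w u - w v) \<le> e"
            proof -
              show "continuous_on Z w" unfolding w_def using S_cont \<omega> by auto
              show "norm (w z) \<le> R" if "z \<in> Z" for z
                using B2(3)[of \<omega> z] \<omega> that R(2) by (auto simp: w_def)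
              show "norm (w u - w v) \<le> e" if "u \<in> Z" "v \<in> Z" "dist u v \<le> \<delta>" for u v
                using B1(3)[of \<omega> u v] \<omega> that \<delta>(2) \<eta>'(2) by (auto simp: w_def)
            qed
            have s: "0 < 1 / sqrt n" "1 / sqrt n < s0" using n' n3 by auto
            have "Y n \<omega> = (min_value (\<lambda>z. f z (\<mu> z + (1 / sqrt n) *\<^sub>R w z)) Z - \<rho>) / (1 / sqrt n)"
              using Y[OF n'(4), of \<omega>] \<omega> by (simp add: w_def mult.commute)
            then have YT: "\<bar>Y n \<omega> - T w\<bar> \<le> \<kappa>" using s0(2)[OF s w] e(2) by simp
            have "\<forall>y. (y < Y n \<omega> \<longrightarrow> (\<forall>j\<in>J. y - \<kappa> < inner (g j) (w j))) \<and>
              ((\<forall>j\<in>J. y < inner (g j) (w j)) \<longrightarrow> y - 2 * \<kappa> < Y n \<omega>)"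
            proof (intro allI conjI impI)
              fix y
              note nw = net[OF w, THEN spec]
              show "\<forall>j\<in>J. y - \<kappa> < inner (g j) (w j)" if "y < Y n \<omega>"
              proof -
                have "y - \<kappa> < T w" using that YT by linarith
                then show ?thesis using nw[of "y - \<kappa>"] by blast
              qed
              show "y - 2 * \<kappa> < Y n \<omega>" if "\<forall>j\<in>J. y < inner (g j) (w j)"
              proof -
                have "y - \<kappa> < T w" using nw[of y] that by blast
                then show ?thesis using YT by linarith
              qed
            qed
            then show "\<forall>y. (y < Y n \<omega> \<longrightarrow> (\<forall>j\<in>J. y - \<kappa> < inner (g j) (S n j \<omega>))) \<and>
              ((\<forall>j\<in>J. y < inner (g j) (S n j \<omega>)) \<longrightarrow> y - 2 * \<kappa> < Y n \<omega>)" by (simp add: w_def)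
          qed
        next
          case 3
          show ?case using B1(1) B2(1) by auto
        qed
      qed
      show "\<exists>A\<in>sets N. N.prob A \<le> \<eta> \<and>
       (\<forall>\<omega>\<in>space N - A. \<forall>y. (y < T (\<lambda>z. W z \<omega>) \<longrightarrow> (\<forall>j\<in>J. y < inner (g j) (W j \<omega>))) \<and>
          ((\<forall>j\<in>J. y < inner (g j) (W j \<omega>)) \<longrightarrow> y - \<kappa> < T (\<lambda>z. W z \<omega>)))"
      proof (rule bexI[of _ "A1 \<union> A2"], rule conjI, goal_cases)
        case 1
        show ?case using measure_Un_le[OF 3(2) 4(1)] 3(3) 4(2) \<eta>'(3) by linarith
      next
        case 2
        show ?case
        proof
          fix \<omega> assume \<omega>: "\<omega> \<in> space N - (A1 \<union> A2)"
          show "\<forall>y. (y < T (\<lambda>z. W z \<omega>) \<longrightarrow> (\<forall>j\<in>J. y < inner (g j) (W j \<omega>))) \<and>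
             ((\<forall>j\<in>J. y < inner (g j) (W j \<omega>)) \<longrightarrow> y - \<kappa> < T (\<lambda>z. W z \<omega>))"
          proof (rule net)
            show "continuous_on Z (\<lambda>z. W z \<omega>)" using W_cont \<omega> by auto
            show "norm (W z \<omega>) \<le> R" if "z \<in> Z" for z using 4(3)[of \<omega> z] \<omega> that R(3) by auto
            show "norm (W u \<omega> - W v \<omega>) \<le> e" if "u \<in> Z" "v \<in> Z" "dist u v \<le> \<delta>" for u v
              using 3(4)[of \<omega> u v] \<omega> that \<delta>(3) \<eta>'(2) by auto
          qed
        qed
      next
        case 3
        show ?case using \<open>A1 \<in> sets N\<close> 4(1) by auto
      qed
    qed
  qed
  have U_m: "(\<lambda>\<omega>. inner (g j) (S n j \<omega>)) \<in> borel_measurable M" "(\<lambda>\<omega>. inner (g j) (W j \<omega>)) \<in> borel_measurable N"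
    if "j \<in> Z" for j n using S_m[OF that] W_m[OF that] by auto
  have conv: "(\<lambda>n. CLINT \<omega>|M. iexp (\<Sum>j\<in>J. a j * inner (g j) (S n j \<omega>)))
      \<longlonglongrightarrow> (CLINT \<omega>|N. iexp (\<Sum>j\<in>J. a j * inner (g j) (W j \<omega>)))" if "finite J" "J \<subseteq> Z" for J a
    using fidi[OF that, of "\<lambda>j. a j *\<^sub>R g j"] by simp
  have setM: "{\<omega>\<in>space M. \<forall>j\<in>J. c < inner (g j) (S n j \<omega>)} \<in> sets M" if "finite J" "J \<subseteq> Z" for J c n
  proof -
    have [measurable]: "\<And>j. j \<in> J \<Longrightarrow> (\<lambda>\<omega>. inner (g j) (S n j \<omega>)) \<in> borel_measurable M" using U_m that by auto
    show ?thesis using that(1) by measurable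
  qed
  have setN: "{\<omega>\<in>space N. \<forall>j\<in>J. c < inner (g j) (W j \<omega>)} \<in> sets N" if "finite J" "J \<subseteq> Z" for J c
  proof -
    have [measurable]: "\<And>j. j \<in> J \<Longrightarrow> (\<lambda>\<omega>. inner (g j) (W j \<omega>)) \<in> borel_measurable N" using U_m that by auto
    show ?thesis using that(1) by measurable
  qed
  note Y_m[measurable] and T_m[folded T_def, measurable]
  have subM: "M.prob A \<le> M.prob B + \<eta>" if "A - C \<subseteq> B" "A \<in> sets M" "B \<in> sets M" "C \<in> sets M" "M.prob C \<le> \<eta>" for A B C \<eta>
  proof -
    have "M.prob A \<le> M.prob (B \<union> C)" using that by (intro M.finite_measure_mono) auto
    also have "\<dots> \<le> M.prob B + M.prob C" using that by (intro measure_Un_le) auto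
    finally show ?thesis using that by linarith
  qed
  have subN: "N.prob A \<le> N.prob B + \<eta>" if "A - C \<subseteq> B" "A \<in> sets N" "B \<in> sets N" "C \<in> sets N" "N.prob C \<le> \<eta>" for A B C \<eta>
  proof -
    have "N.prob A \<le> N.prob (B \<union> C)" using that by (intro N.finite_measure_mono) auto
    also have "\<dots> \<le> N.prob B + N.prob C" using that by (intro measure_Un_le) auto
    finally show ?thesis using that by linarith
  qed
  show ?thesis
    unfolding T_def[symmetric]
  proof (rule weak_conv_m_distrI[OF M N])
    fix x y e :: real assume xy: "x < y" and e: "0 < e"
    \<comment> \<open>Budget for the gap y - x: one \<kappa> from \<open>Y n\<close> to the net and
      one from the net of W to T, with the orthants compared across the remaining half; in the other
      direction 2 \<kappa> are spent on the way back to \<open>Y n\<close>. Likewise e is shared by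
      two exceptional events and the orthant comparison.\<close>
    define \<kappa> where "\<kappa> = (y - x) / 4"
    have \<kappa>: "0 < \<kappa>" "4 * \<kappa> = y - x" using xy by (simp_all add: \<kappa>_def)
    have e3: "0 < e / 3" using e by simp
    obtain J n0 where JN: "finite J \<and> J \<subseteq> Z \<and> (\<forall>n\<ge>n0. \<exists>A\<in>sets M. M.prob A \<le> e / 3 \<and>
       (\<forall>\<omega>\<in>space M - A. \<forall>y. (y < Y n \<omega> \<longrightarrow> (\<forall>j\<in>J. y - \<kappa> < inner (g j) (S n j \<omega>))) \<and>
          ((\<forall>j\<in>J. y < inner (g j) (S n j \<omega>)) \<longrightarrow> y - 2 * \<kappa> < Y n \<omega>))) \<and>
     (\<exists>A\<in>sets N. N.prob A \<le> e / 3 \<and>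
       (\<forall>\<omega>\<in>space N - A. \<forall>y. (y < T (\<lambda>z. W z \<omega>) \<longrightarrow> (\<forall>j\<in>J. y < inner (g j) (W j \<omega>))) \<and>
          ((\<forall>j\<in>J. y < inner (g j) (W j \<omega>)) \<longrightarrow> y - \<kappa> < T (\<lambda>z. W z \<omega>))))"
      using main[OF \<kappa>(1) e3] by (elim exE)
    then have J: "finite J" "J \<subseteq> Z" by (rule conjunct1, elim conjE)
    note 1 = JN[THEN conjunct2, THEN conjunct2, THEN conjunct1, THEN spec, THEN mp]
    obtain A where AN: "A \<in> sets N \<and> N.prob A \<le> e / 3 \<and>
       (\<forall>\<omega>\<in>space N - A. \<forall>y. (y < T (\<lambda>z. W z \<omega>) \<longrightarrow> (\<forall>j\<in>J. y < inner (g j) (W j \<omega>))) \<and>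
          ((\<forall>j\<in>J. y < inner (g j) (W j \<omega>)) \<longrightarrow> y - \<kappa> < T (\<lambda>z. W z \<omega>)))"
      using JN[THEN conjunct2, THEN conjunct2, THEN conjunct2] unfolding Bex_def by (elim exE)
    note A = AN[THEN conjunct1] AN[THEN conjunct2, THEN conjunct1]
      and 2 = AN[THEN conjunct2, THEN conjunct2, THEN bspec, THEN spec]
    note cw = cramer_wold_orthant[OF M N J(1), where U="\<lambda>n j \<omega>. inner (g j) (S n j \<omega>)" and U'="\<lambda>j \<omega>. inner (g j) (W j \<omega>)", OF _ _ conv[OF J] _ e3]
    have "\<forall>\<^sub>F n in sequentially. M.prob {\<omega>\<in>space M. \<forall>j\<in>J. y - \<kappa> < inner (g j) (S n j \<omega>)}
        \<le> N.prob {\<omega>\<in>space N. \<forall>j\<in>J. x + \<kappa> < inner (g j) (W j \<omega>)} + e / 3"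
      using J \<kappa> by (intro cw(1) U_m) auto
    then show "\<forall>\<^sub>F n in sequentially. M.prob {\<omega>\<in>space M. y < Y n \<omega>} \<le> N.prob {\<omega>\<in>space N. x < T (\<lambda>z. W z \<omega>)} + e"
      using eventually_ge_at_top[of n0]
    proof eventually_elim
      case (elim n)
      obtain B where B: "B \<in> sets M" "M.prob B \<le> e / 3" "\<And>\<omega> y. \<omega> \<in> space M - B \<Longrightarrow>
        (y < Y n \<omega> \<longrightarrow> (\<forall>j\<in>J. y - \<kappa> < inner (g j) (S n j \<omega>)))"
        using 1[OF elim(2)] by blast
      have "M.prob {\<omega>\<in>space M. y < Y n \<omega>} \<le> M.prob {\<omega>\<in>space M. \<forall>j\<in>J. y - \<kappa> < inner (g j) (S n j \<omega>)} + e / 3"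
        using B by (intro subM[of _ B] setM J) auto
      moreover have "N.prob {\<omega>\<in>space N. \<forall>j\<in>J. x + \<kappa> < inner (g j) (W j \<omega>)} \<le> N.prob {\<omega>\<in>space N. x < T (\<lambda>z. W z \<omega>)} + e / 3"
        using 2[of _ "x + \<kappa>"] A by (intro subN[of _ A] setN J) auto
      ultimately show ?case using elim(1) by linarith
    qed
    have "\<forall>\<^sub>F n in sequentially. N.prob {\<omega>\<in>space N. \<forall>j\<in>J. y < inner (g j) (W j \<omega>)}
        \<le> M.prob {\<omega>\<in>space M. \<forall>j\<in>J. x + 2 * \<kappa> < inner (g j) (S n j \<omega>)} + e / 3"
      using J \<kappa> by (intro cw(2) U_m) auto
    then show "\<forall>\<^sub>F n in sequentially. N.prob {\<omega>\<in>space N. y < T (\<lambda>z. W z \<omega>)} \<le> M.prob {\<omega>\<in>space M. x < Y n \<omega>} + e"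
      using eventually_ge_at_top[of n0]
    proof eventually_elim
      case (elim n)
      obtain B where B: "B \<in> sets M" "M.prob B \<le> e / 3" "\<And>\<omega> y. \<omega> \<in> space M - B \<Longrightarrow>
        ((\<forall>j\<in>J. y < inner (g j) (S n j \<omega>)) \<longrightarrow> y - 2 * \<kappa> < Y n \<omega>)"
        using 1[OF elim(2)] by blast
      have "M.prob {\<omega>\<in>space M. \<forall>j\<in>J. x + 2 * \<kappa> < inner (g j) (S n j \<omega>)} \<le> M.prob {\<omega>\<in>space M. x < Y n \<omega>} + e / 3"
        using B(1,2) B(3)[of _ "x + 2 * \<kappa>"] by (intro subM[of _ B] setM J) auto
      moreover have "N.prob {\<omega>\<in>space N. y < T (\<lambda>z. W z \<omega>)} \<le> N.prob {\<omega>\<in>space N. \<forall>j\<in>J. y < inner (g j) (W j \<omega>)} + e / 3"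
        using 2[of _ y] A by (intro subN[of _ A] setN J) auto
      ultimately show ?case using elim(1) by linarith
    qed
  qed (use Y_m T_m[folded T_def] in auto)
qed

end

section \<open>Empirical processes with Lipschitz paths\<close>

lemma exp_le_quadratic:
  fixes u :: real
  assumes "u \<le> 1"
  shows "exp u \<le> 1 + u + u\<^sup>2"
proof (cases "0 \<le> u")
  case True
  then show ?thesis using assms by (intro exp_bound)
next
  case False
  \<comment> \<open>For u < 0 the product with 1 - u is 1 - u^3 \<ge> 1, and 1 - u \<le> exp (- u)
    leads back to the exponential.\<close>
  have "1 * 1 \<le> (1 + u + u\<^sup>2) * (1 - u)"
  proof -
    have "(1 + u + u\<^sup>2) * (1 - u) = 1 - u ^ 3" by (simp add: algebra_simps power2_eq_square power3_eq_cube)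
    moreover have "u ^ 3 \<le> 0" using False by (simp add: power_le_zero_eq)
    ultimately show ?thesis by simp
  qed
  also have "\<dots> \<le> (1 + u + u\<^sup>2) * exp (- u)"
  proof (intro mult_left_mono)
    show "1 - u \<le> exp (- u)" using exp_ge_add_one_self[of "- u"] by simp
    have "0 \<le> (u + 1/2)\<^sup>2" by simp
    then show "0 \<le> 1 + u + u\<^sup>2" by (simp add: power2_eq_square algebra_simps)
  qed
  finally have "1 \<le> (1 + u + u\<^sup>2) * exp (- u)" by simp
  then show ?thesis by (simp add: exp_minus field_simps)
qed

text \<open>With the exponent parameter fixed at 1, E exp X \<le> 1 + E X + E X^2 \<le> exp w, and
  independence multiplies these bounds. If \<open>card I * w\<close> stays bounded, as for a sum
  normalized by sqrt n, the factor in front is a constant.\<close>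

lemma (in prob_space) bernstein_tail:
  fixes X :: "'i \<Rightarrow> 'a \<Rightarrow> real" and t w :: real
  assumes ind: "indep_vars (\<lambda>_. borel) X I" and I: "finite I"
    and bd: "\<And>i \<omega>. i \<in> I \<Longrightarrow> \<omega> \<in> space M \<Longrightarrow> \<bar>X i \<omega>\<bar> \<le> 1"
    and mean: "\<And>i. i \<in> I \<Longrightarrow> expectation (X i) = 0"
    and var: "\<And>i. i \<in> I \<Longrightarrow> expectation (\<lambda>\<omega>. (X i \<omega>)\<^sup>2) \<le> w"
  shows "prob {\<omega>\<in>space M. t < \<bar>\<Sum>i\<in>I. X i \<omega>\<bar>} \<le> 2 * exp (card I * w) * exp (- t)"
proof -
  have one_sided: "prob {\<omega>\<in>space M. t < (\<Sum>i\<in>I. T i \<omega>)} \<le> exp (card I * w) * exp (- t)"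
    if ind: "indep_vars (\<lambda>_. borel) T I"
      and bd: "\<And>i \<omega>. i \<in> I \<Longrightarrow> \<omega> \<in> space M \<Longrightarrow> \<bar>T i \<omega>\<bar> \<le> 1"
      and mean: "\<And>i. i \<in> I \<Longrightarrow> expectation (T i) = 0"
      and var: "\<And>i. i \<in> I \<Longrightarrow> expectation (\<lambda>\<omega>. (T i \<omega>)\<^sup>2) \<le> w" for T
  proof -
    have T_m[measurable]: "T i \<in> borel_measurable M" if "i \<in> I" for i
      using ind that by (simp add: indep_vars_def2)
    have exp_int: "integrable M (\<lambda>\<omega>. exp (T i \<omega>))" if "i \<in> I" for i
      using bd[OF that] T_m[OF that]
      by (intro integrable_const_bound[where B="exp 1"]) (auto intro!: AE_I2 dest: abs_le_D1)
    have T_int: "integrable M (T i)" "integrable M (\<lambda>\<omega>. (T i \<omega>)\<^sup>2)" if "i \<in> I" for i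
    proof -
      show "integrable M (T i)"
        using bd[OF that] T_m[OF that] by (intro integrable_const_bound[where B=1]) auto
      show "integrable M (\<lambda>\<omega>. (T i \<omega>)\<^sup>2)"
        using bd[OF that] T_m[OF that] by (intro integrable_const_bound[where B=1]) (auto simp: abs_square_le_1)
    qed
    have ind_exp: "indep_vars (\<lambda>_. borel) (\<lambda>i \<omega>. exp (T i \<omega>)) I"
      using indep_vars_compose2[OF ind, of "\<lambda>_. exp" "\<lambda>_. borel"] by simp
    have mgf: "expectation (\<lambda>\<omega>. exp (T i \<omega>)) \<le> exp w" if i: "i \<in> I" for i
    proof -
      have "expectation (\<lambda>\<omega>. exp (T i \<omega>)) \<le> expectation (\<lambda>\<omega>. 1 + T i \<omega> + (T i \<omega>)\<^sup>2)"
        using T_int[OF i] exp_int[OF i] bd[OF i]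
        by (intro integral_mono exp_le_quadratic) (auto dest: abs_le_D1)
      also have "\<dots> = 1 + expectation (T i) + expectation (\<lambda>\<omega>. (T i \<omega>)\<^sup>2)"
        using T_int[OF i] by (simp add: prob_space)
      also have "\<dots> \<le> 1 + w" using mean[OF i] var[OF i] by simp
      also have "\<dots> \<le> exp w" by simp
      finally show ?thesis .
    qed
    have prod: "expectation (\<lambda>\<omega>. \<Prod>i\<in>I. exp (T i \<omega>)) = (\<Prod>i\<in>I. expectation (\<lambda>\<omega>. exp (T i \<omega>)))"
      "integrable M (\<lambda>\<omega>. \<Prod>i\<in>I. exp (T i \<omega>))"
      by (rule indep_vars_lebesgue_integral[OF I ind_exp exp_int] indep_vars_integrable[OF I ind_exp exp_int]; assumption)+
    have "prob {\<omega>\<in>space M. t < (\<Sum>i\<in>I. T i \<omega>)} \<le> prob {\<omega>\<in>space M. exp t \<le> (\<Prod>i\<in>I. exp (T i \<omega>))}"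
      using I by (intro finite_measure_mono) (auto simp: exp_sum[symmetric])
    also have "\<dots> \<le> expectation (\<lambda>\<omega>. \<Prod>i\<in>I. exp (T i \<omega>)) / exp t"
      by (rule integral_Markov_inequality_measure[where A = "space M" and M=M, simplified])
        (use prod(2) in \<open>auto intro!: prod_nonneg\<close>)
    also have "\<dots> \<le> (\<Prod>i\<in>I. exp w) / exp t"
      unfolding prod(1) by (intro divide_right_mono prod_mono conjI mgf integral_nonneg_AE) auto
    also have "\<dots> = exp (card I * w) * exp (- t)"
      by (simp only: prod_constant exp_of_nat_mult[symmetric] exp_minus divide_inverse)
    finally show ?thesis .
  qed
  have m[measurable]: "X i \<in> borel_measurable M" if "i \<in> I" for i
    using ind that by (simp add: indep_vars_def2)
  have ind': "indep_vars (\<lambda>_. borel) (\<lambda>i \<omega>. - X i \<omega>) I"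
    using indep_vars_compose2[OF ind, of "\<lambda>_ x. - x" "\<lambda>_. borel"] by simp
  have "prob {\<omega>\<in>space M. t < \<bar>\<Sum>i\<in>I. X i \<omega>\<bar>}
    \<le> prob ({\<omega>\<in>space M. t < (\<Sum>i\<in>I. X i \<omega>)} \<union> {\<omega>\<in>space M. t < (\<Sum>i\<in>I. - X i \<omega>)})"
    by (intro finite_measure_mono) (auto simp: sum_negf)
  also have "\<dots> \<le> prob {\<omega>\<in>space M. t < (\<Sum>i\<in>I. X i \<omega>)} + prob {\<omega>\<in>space M. t < (\<Sum>i\<in>I. - X i \<omega>)}"
    by (intro measure_Un_le) auto
  finally show ?thesis
    using one_sided[OF ind bd mean var] one_sided[OF ind'] bd mean var by simp
qed

lemma (in prob_space) second_moment_sum_indep: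
  fixes X :: "'i \<Rightarrow> 'a \<Rightarrow> real"
  assumes "finite I" and ind: "indep_vars (\<lambda>_. borel) X I"
    and sq: "\<And>i. i \<in> I \<Longrightarrow> square_integrable M (X i)" and mean: "\<And>i. i \<in> I \<Longrightarrow> expectation (X i) = 0"
  shows "square_integrable M (\<lambda>\<omega>. \<Sum>i\<in>I. X i \<omega>)"
    "expectation (\<lambda>\<omega>. (\<Sum>i\<in>I. X i \<omega>)\<^sup>2) = (\<Sum>i\<in>I. expectation (\<lambda>\<omega>. (X i \<omega>)\<^sup>2))"
proof -
  show "square_integrable M (\<lambda>\<omega>. \<Sum>i\<in>I. X i \<omega>)" by (intro square_integrable_sum sq)
  show "expectation (\<lambda>\<omega>. (\<Sum>i\<in>I. X i \<omega>)\<^sup>2) = (\<Sum>i\<in>I. expectation (\<lambda>\<omega>. (X i \<omega>)\<^sup>2))"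
    using assms
  proof (induction I rule: finite_induct)
    case (insert i I)
    have S: "square_integrable M (\<lambda>\<omega>. \<Sum>i\<in>I. X i \<omega>)" and Xi: "square_integrable M (X i)"
      using insert.prems(2) by (auto intro!: square_integrable_sum)
    have int: "integrable M (X i)" "integrable M (\<lambda>\<omega>. \<Sum>i\<in>I. X i \<omega>)"
      using S Xi by (auto simp: square_integrable_def intro: square_integrable_imp_integrable)
    have "indep_var borel (X i) borel (\<lambda>\<omega>. \<Sum>i\<in>I. X i \<omega>)"
      using insert by (intro indep_vars_sum) auto
    then have "expectation (\<lambda>\<omega>. X i \<omega> * (\<Sum>i\<in>I. X i \<omega>)) = 0"
      using indep_var_lebesgue_integral[OF _ int] insert.prems(3) by simp
    moreover have "expectation (\<lambda>\<omega>. (\<Sum>i\<in>insert i I. X i \<omega>)\<^sup>2) =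
        expectation (\<lambda>\<omega>. (X i \<omega>)\<^sup>2 + (\<Sum>i\<in>I. X i \<omega>)\<^sup>2 + 2 * (X i \<omega> * (\<Sum>i\<in>I. X i \<omega>)))"
      using insert.hyps by (simp add: power2_sum mult.assoc)
    moreover have "\<dots> = expectation (\<lambda>\<omega>. (X i \<omega>)\<^sup>2) + expectation (\<lambda>\<omega>. (\<Sum>i\<in>I. X i \<omega>)\<^sup>2)
        + 2 * expectation (\<lambda>\<omega>. X i \<omega> * (\<Sum>i\<in>I. X i \<omega>))"
      using S Xi square_integrable_mult[OF Xi S] by (simp add: square_integrable_def)
    moreover have "expectation (\<lambda>\<omega>. (\<Sum>i\<in>I. X i \<omega>)\<^sup>2) = (\<Sum>i\<in>I. expectation (\<lambda>\<omega>. (X i \<omega>)\<^sup>2))"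
      using insert.prems indep_vars_subset[OF insert.prems(1)] by (intro insert.IH) auto
    ultimately show ?case using insert.hyps by simp
  qed simp
qed

text \<open>The sample is numbered from 1, while the central limit theorem takes a sequence numbered
  from 0.\<close>

lemma (in prob_space) indep_vars_Suc:
  assumes ind: "indep_vars (\<lambda>_. N) X {1..}"
  shows "indep_vars (\<lambda>_. N) (\<lambda>n. X (Suc n)) UNIV"
proof -
  let ?F = "\<lambda>i. {X i -` A \<inter> space M |A. A \<in> sets N}"
  have rv: "random_variable N (X (Suc n))" for n using ind by (simp add: indep_vars_def2)
  have F: "indep_sets ?F {1..}" using ind by (simp add: indep_vars_def2)
  have "indep_sets (\<lambda>n. ?F (Suc n)) UNIV"
  proof (rule indep_setsI)
    show "?F (Suc n) \<subseteq> events" for n using F by (auto simp: indep_sets_def)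
    fix A J assume J: "J \<noteq> {}" "finite J" and A: "\<forall>j\<in>J. A j \<in> ?F (Suc j)"
    have "prob (\<Inter>j\<in>Suc ` J. A (j - 1)) = (\<Prod>j\<in>Suc ` J. prob (A (j - 1)))"
      using J A by (intro indep_setsD[OF F]) auto
    then show "prob (\<Inter>j\<in>J. A j) = (\<Prod>j\<in>J. prob (A j))"
      by (simp add: prod.reindex)
  qed
  then show ?thesis using rv by (simp add: indep_vars_def2)
qed

section \<open>The empirical process of a centred Lipschitz family\<close>

locale lipschitz_sample = prob_space M for M :: "'a measure" +
  fixes P :: "'x measure" and Xs :: "nat \<Rightarrow> 'a \<Rightarrow> 'x" and Z :: "(real^'d) set"
    and k :: "real^'d \<Rightarrow> 'x \<Rightarrow> real^'s" and L :: "'x \<Rightarrow> real"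
  assumes ind: "indep_vars (\<lambda>_. P) Xs {1..}" and distr_Xs: "\<And>i. 1 \<le> i \<Longrightarrow> distr M P (Xs i) = P"
    and compact_Z: "compact Z"
    and k_m: "\<And>z. z \<in> Z \<Longrightarrow> k z \<in> borel_measurable P"
    and k_sq: "\<And>z. z \<in> Z \<Longrightarrow> square_integrable P (\<lambda>x. norm (k z x))"
    and k_mean: "\<And>z. z \<in> Z \<Longrightarrow> (LINT x|P. k z x) = 0"
    and L_sq: "square_integrable P L" and L0: "\<And>x. 0 \<le> L x"
    and lip: "\<And>u v x. u \<in> Z \<Longrightarrow> v \<in> Z \<Longrightarrow> x \<in> space P \<Longrightarrow> norm (k u x - k v x) \<le> L x * dist u v"
begin

lemma Xs_m: "1 \<le> i \<Longrightarrow> Xs i \<in> measurable M P"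
  using ind by (simp add: indep_vars_def2)

lemma prob_space_P: "prob_space P"
  using prob_space_distr[OF Xs_m[of 1]] distr_Xs[of 1] by simp

sublocale P: prob_space P by (rule prob_space_P)

lemma expectation_Xs:
  fixes h :: "'x \<Rightarrow> 'b::{banach, second_countable_topology}"
  assumes "1 \<le> i" "h \<in> borel_measurable P"
  shows "expectation (\<lambda>\<omega>. h (Xs i \<omega>)) = (LINT x|P. h x)"
  using integral_distr[OF Xs_m[OF assms(1)] assms(2)] distr_Xs[OF assms(1)] by simp

lemma integrable_Xs:
  fixes h :: "'x \<Rightarrow> 'b::{banach, second_countable_topology}"
  assumes "1 \<le> i" "h \<in> borel_measurable P"
  shows "integrable M (\<lambda>\<omega>. h (Xs i \<omega>)) \<longleftrightarrow> integrable P h"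
  using integrable_distr_eq[OF Xs_m[OF assms(1)] assms(2)] distr_Xs[OF assms(1)] by simp

lemma indep_Xs:
  assumes "h \<in> borel_measurable P"
  shows "indep_vars (\<lambda>_. borel) (\<lambda>i \<omega>. h (Xs i \<omega>)) {1..n}"
  using indep_vars_compose2[OF indep_vars_subset[OF ind, of "{1..n}"], of "\<lambda>_. h" "\<lambda>_. borel"] assms by auto

lemma k_inner_sq: "z \<in> Z \<Longrightarrow> square_integrable P (\<lambda>x. inner a (k z x))"
  using k_m[of z]
  by (intro square_integrable_bound[OF square_integrable_cmult[OF k_sq[of z], of "norm a"]])
    (auto simp: Cauchy_Schwarz_ineq2)

lemma k_int: "z \<in> Z \<Longrightarrow> integrable P (k z)"
  using P.square_integrable_imp_integrable[of "\<lambda>x. norm (k z x)"] k_sq[of z] k_m[of z]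
  by (auto simp: square_integrable_def integrable_norm_iff)

lemma sum_k_inner_sq:
  "J \<subseteq> Z \<Longrightarrow> square_integrable P (\<lambda>x. \<Sum>z\<in>J. inner (a z) (k z x))"
  by (intro square_integrable_sum k_inner_sq) auto

lemma sum_k_inner_mean:
  assumes "J \<subseteq> Z"
  shows "(LINT x|P. (\<Sum>z\<in>J. inner (a z) (k z x))) = 0"
proof -
  have "(LINT x|P. (\<Sum>z\<in>J. inner (a z) (k z x))) = (\<Sum>z\<in>J. inner (a z) (LINT x|P. k z x))"
    using assms k_int by (subst Bochner_Integration.integral_sum) (auto simp: subset_eq)
  then show ?thesis using assms k_mean by (simp add: subset_eq)
qed

definition emp :: "nat \<Rightarrow> real^'d \<Rightarrow> 'a \<Rightarrow> real^'s" where
  "emp n z \<omega> = (1 / sqrt n) *\<^sub>R (\<Sum>i=1..n. k z (Xs i \<omega>))"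

lemma emp_m: "z \<in> Z \<Longrightarrow> emp n z \<in> borel_measurable M"
  unfolding emp_def using Xs_m k_m
  by (auto intro!: borel_measurable_scaleR borel_measurable_sum measurable_compose[of "Xs _" M P])

lemma k_continuous: "x \<in> space P \<Longrightarrow> continuous_on Z (\<lambda>z. k z x)"
  using lip L0 by (intro lipschitz_on_continuous_on[of "L x"] lipschitz_onI) (auto simp: dist_norm)

lemma emp_continuous: "\<omega> \<in> space M \<Longrightarrow> continuous_on Z (\<lambda>z. emp n z \<omega>)"
  unfolding emp_def using Xs_m by (intro continuous_intros k_continuous) (auto dest: measurable_space)

text \<open>Since a is arbitrary, frequency 1 already gives all finite-dimensional characteristic
  functions. The combination is a normalized sum of centred i.i.d. variables; variance 0 is treated
  apart because the central limit theorem divides by the standard deviation.\<close>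

lemma emp_fidi:
  assumes J: "finite J" "J \<subseteq> Z"
  shows "(\<lambda>n. CLINT \<omega>|M. iexp (\<Sum>z\<in>J. inner (a z) (emp n z \<omega>)))
    \<longlonglongrightarrow> complex_of_real (exp (- (LINT x|P. (\<Sum>z\<in>J. inner (a z) (k z x))\<^sup>2) / 2))"
proof -
  define h where "h x = (\<Sum>z\<in>J. inner (a z) (k z x))" for x
  define v where "v = (LINT x|P. (h x)\<^sup>2)"
  have h_sq: "square_integrable P h" unfolding h_def by (rule sum_k_inner_sq[OF J(2)])
  have h_m[measurable]: "h \<in> borel_measurable P" by (rule square_integrable_measurable[OF h_sq])
  have h_mean: "(LINT x|P. h x) = 0" unfolding h_def by (rule sum_k_inner_mean[OF J(2)])
  have Sh: "(\<Sum>z\<in>J. inner (a z) (emp n z \<omega>)) = (\<Sum>i=1..n. h (Xs i \<omega>)) / sqrt n" for n \<omega>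
    unfolding emp_def h_def
    by (subst sum.swap) (simp add: inner_sum_right sum_divide_distrib sum_distrib_left field_simps)
  have "0 \<le> v" by (simp add: v_def)
  then consider "v = 0" | "0 < v" by linarith
  then have "(\<lambda>n. CLINT \<omega>|M. iexp ((\<Sum>i=1..n. h (Xs i \<omega>)) / sqrt n)) \<longlonglongrightarrow> complex_of_real (exp (- v / 2))"
  proof cases
    case 1
    have "AE x in P. (h x)\<^sup>2 = 0"
      using 1 h_sq unfolding v_def by (subst integral_nonneg_eq_0_iff_AE[symmetric]) (auto simp: square_integrable_def)
    then have "AE x in distr M P (Xs i). h x = 0" if "1 \<le> i" for i
      unfolding distr_Xs[OF that] by simp
    then have ae: "AE \<omega> in M. h (Xs i \<omega>) = 0" if "1 \<le> i" for i
      using AE_distrD[OF Xs_m[OF that]] that by blast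
    have sum_AE: "AE \<omega> in M. (\<Sum>i=1..n. h (Xs i \<omega>)) = 0" for n
    proof -
      have "AE \<omega> in M. \<forall>i\<in>{1..n}. h (Xs i \<omega>) = 0"
        by (rule AE_finite_allI) (auto intro: ae)
      then show ?thesis by eventually_elim simp
    qed
    have "(CLINT \<omega>|M. iexp ((\<Sum>i=1..n. h (Xs i \<omega>)) / sqrt n)) = (CLINT \<omega>|M. 1)" for n
    proof (rule integral_cong_AE)
      have "(\<lambda>\<omega>. \<Sum>i=1..n. h (Xs i \<omega>)) \<in> borel_measurable M"
        by (intro borel_measurable_sum measurable_compose[OF Xs_m h_m]) auto
      then show "(\<lambda>\<omega>. iexp ((\<Sum>i=1..n. h (Xs i \<omega>)) / sqrt n)) \<in> borel_measurable M"
        by measurable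
      show "AE \<omega> in M. iexp ((\<Sum>i=1..n. h (Xs i \<omega>)) / sqrt n) = 1"
        using sum_AE[of n] by eventually_elim (simp only: div_0 of_real_0 mult_zero_right exp_zero)
    qed simp
    then show ?thesis using 1 by (simp add: prob_space)
  next
    case 2
    define X where "X n \<omega> = h (Xs (Suc n) \<omega>)" for n \<omega>
    have X_m[measurable]: "X n \<in> borel_measurable M" for n
      unfolding X_def by (rule measurable_compose[OF Xs_m h_m]) simp
    have X_ind: "indep_vars (\<lambda>_. borel) X UNIV"
      unfolding X_def using indep_vars_compose2[OF indep_vars_Suc[OF ind], of "\<lambda>_. h" "\<lambda>_. borel"] by simp
    have X_sum: "(\<Sum>i<n. X i \<omega>) = (\<Sum>i=1..n. h (Xs i \<omega>))" for n \<omega>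
      unfolding X_def by (simp add: sum.atLeast1_atMost_eq)
    have mean: "expectation (X n) = 0" for n
      unfolding X_def using expectation_Xs[of "Suc n" h] h_mean by simp
    have "weak_conv_m (\<lambda>n. distr M borel (\<lambda>\<omega>. (\<Sum>i<n. X i \<omega>) / sqrt (real n * (sqrt v)\<^sup>2))) std_normal_distribution"
    proof (rule central_limit_theorem_zero_mean[OF X_ind mean])
      show "0 < sqrt v" using 2 by simp
      show "integrable M (\<lambda>x. (X n x)\<^sup>2)" for n
        unfolding X_def using integrable_Xs[of "Suc n" "\<lambda>x. (h x)\<^sup>2"] h_sq by (simp add: square_integrable_def)
      show "variance (X n) = (sqrt v)\<^sup>2" for n
        using expectation_Xs[of "Suc n" "\<lambda>x. (h x)\<^sup>2"] 2 mean[of n] by (simp add: X_def v_def)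
      show "distr M borel (X n) = distr P borel h" for n
        unfolding X_def using distr_distr[OF h_m Xs_m[of "Suc n"]] distr_Xs[of "Suc n"] by (simp add: o_def)
    qed
    \<comment> \<open>Evaluating at frequency sqrt v cancels the division by the standard deviation
      and leaves frequency 1 for the sum over sqrt n.\<close>
    then have "(\<lambda>n. char (distr M borel (\<lambda>\<omega>. (\<Sum>i<n. X i \<omega>) / sqrt (real n * (sqrt v)\<^sup>2))) (sqrt v)) \<longlonglongrightarrow> char std_normal_distribution (sqrt v)"
      by (intro levy_continuity1 real_distribution_distr real_dist_normal_dist) auto
    moreover have "char (distr M borel (\<lambda>\<omega>. (\<Sum>i<n. X i \<omega>) / sqrt (real n * (sqrt v)\<^sup>2))) (sqrt v) =
        (CLINT \<omega>|M. iexp ((\<Sum>i=1..n. h (Xs i \<omega>)) / sqrt n))" for n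
    proof -
      have "sqrt v * (t / sqrt (real n * (sqrt v)\<^sup>2)) = t / sqrt n" for t
        using 2 by (simp add: real_sqrt_mult)
      then show ?thesis by (subst char_distr) (simp_all only: X_sum[symmetric], measurable)
    qed
    ultimately show ?thesis using 2 by (simp add: char_std_normal_distribution)
  qed
  then show ?thesis unfolding Sh v_def h_def .
qed

lemma emp_second_moment:
  assumes z: "z \<in> Z" and n: "1 \<le> n"
  shows "expectation (\<lambda>\<omega>. (emp n z \<omega> $ c)\<^sup>2) = (LINT x|P. (k z x $ c)\<^sup>2)" "square_integrable M (\<lambda>\<omega>. emp n z \<omega> $ c)"
proof -
  define h where "h x = k z x $ c" for x
  have h_sq: "square_integrable P h" unfolding h_def using k_inner_sq[OF z, of "axis c 1"] by (simp add: inner_axis')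
  have h_m: "h \<in> borel_measurable P" by (rule square_integrable_measurable[OF h_sq])
  have h_mean: "(LINT x|P. h x) = 0"
    unfolding h_def using sum_k_inner_mean[of "{z}" "\<lambda>_. axis c 1"] z by (simp add: inner_axis')
  have sq: "square_integrable M (\<lambda>\<omega>. h (Xs i \<omega>))" if "i \<in> {1..n}" for i
    using that h_sq integrable_Xs[of i "\<lambda>x. (h x)\<^sup>2"] measurable_compose[OF Xs_m h_m, of i]
    by (auto simp: square_integrable_def)
  have mean: "expectation (\<lambda>\<omega>. h (Xs i \<omega>)) = 0" if "i \<in> {1..n}" for i
    using that h_mean expectation_Xs[OF _ h_m] by simp
  note sm = second_moment_sum_indep[OF _ indep_Xs[OF h_m, of n] sq mean]
  have Sh: "emp n z \<omega> $ c = (1 / sqrt n) * (\<Sum>i=1..n. h (Xs i \<omega>))" for \<omega>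
    by (simp add: emp_def h_def sum_component)
  have "expectation (\<lambda>\<omega>. (\<Sum>i=1..n. h (Xs i \<omega>))\<^sup>2) = (\<Sum>i=1..n. expectation (\<lambda>\<omega>. (h (Xs i \<omega>))\<^sup>2))"
    by (rule sm(2)) auto
  also have "\<dots> = (\<Sum>i=1..n. (LINT x|P. (h x)\<^sup>2))"
    using expectation_Xs[of _ "\<lambda>x. (h x)\<^sup>2"] h_m by (intro sum.cong refl) simp
  finally have "expectation (\<lambda>\<omega>. (\<Sum>i=1..n. h (Xs i \<omega>))\<^sup>2) = n * (LINT x|P. (h x)\<^sup>2)" by simp
  then show "expectation (\<lambda>\<omega>. (emp n z \<omega> $ c)\<^sup>2) = (LINT x|P. (k z x $ c)\<^sup>2)"
    unfolding Sh using n by (simp add: power_mult_distrib power_divide h_def)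
  show "square_integrable M (\<lambda>\<omega>. emp n z \<omega> $ c)"
    unfolding Sh by (intro square_integrable_cmult sm(1)) auto
qed

text \<open>Chebyshev's inequality: the second moments of the components of \<open>emp n z\<close>
  do not depend on n.\<close>

lemma emp_pointwise_tight:
  assumes z: "z \<in> Z" and \<eta>: "0 < \<eta>"
  shows "\<exists>R. \<forall>n\<ge>1. prob {\<omega>\<in>space M. R < norm (emp n z \<omega>)} \<le> \<eta>"
proof -
  define d where "d = real CARD('s)"
  have d: "0 < d" by (simp add: d_def)
  \<comment> \<open>The summand 1 makes b, and with it t, positive even if all variances are
    0.\<close>
  define b where "b = (\<Sum>c\<in>UNIV. (LINT x|P. (k z x $ c)\<^sup>2)) + 1"
  have b: "(LINT x|P. (k z x $ c)\<^sup>2) \<le> b" for c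
    unfolding b_def using member_le_sum[of c UNIV "\<lambda>c. (LINT x|P. (k z x $ c)\<^sup>2)"] by simp
  have b0: "0 < b" unfolding b_def by (intro add_nonneg_pos sum_nonneg) auto
  define t where "t = sqrt (b * d / \<eta>)"
  have t: "0 < t" "t\<^sup>2 = b * d / \<eta>" using b0 d \<eta> by (simp_all add: t_def)
  show ?thesis
  proof (intro exI[of _ "CARD('s) * t"] allI impI)
    fix n :: nat assume n: "1 \<le> n"
    have "prob {\<omega>\<in>space M. t < \<bar>emp n z \<omega> $ c\<bar>} \<le> \<eta> / d" for c
    proof -
      note sm = emp_second_moment[OF z n, of c]
      have "prob {\<omega>\<in>space M. t < \<bar>emp n z \<omega> $ c\<bar>} \<le> prob {\<omega>\<in>space M. t\<^sup>2 \<le> (emp n z \<omega> $ c)\<^sup>2}"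
      proof (rule finite_measure_mono)
        show "{\<omega>\<in>space M. t < \<bar>emp n z \<omega> $ c\<bar>} \<subseteq> {\<omega>\<in>space M. t\<^sup>2 \<le> (emp n z \<omega> $ c)\<^sup>2}"
          using t(1) by (auto simp: abs_le_square_iff[symmetric])
        have [measurable]: "emp n z \<in> borel_measurable M" by (rule emp_m[OF z])
        show "{\<omega>\<in>space M. t\<^sup>2 \<le> (emp n z \<omega> $ c)\<^sup>2} \<in> sets M" by measurable
      qed
      also have "\<dots> \<le> expectation (\<lambda>\<omega>. (emp n z \<omega> $ c)\<^sup>2) / t\<^sup>2"
        by (rule integral_Markov_inequality_measure[where A = "space M" and M=M, simplified])
          (use sm(2) t(1) in \<open>auto simp: square_integrable_def\<close>)
      also have "\<dots> \<le> b / t\<^sup>2" unfolding sm(1) using b[of c] zero_le_power2[of t] by (rule divide_right_mono)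
      also have "\<dots> = \<eta> / d" using b0 d \<eta> by (simp add: t(2))
      finally show ?thesis .
    qed
    then have "prob {\<omega>\<in>space M. CARD('s) * t < norm (emp n z \<omega>)} \<le> CARD('s) * (\<eta> / d)"
      by (intro prob_norm_gt_le_components emp_m z)
    then show "prob {\<omega>\<in>space M. CARD('s) * t < norm (emp n z \<omega>)} \<le> \<eta>" using d by (simp add: d_def)
  qed
qed

section \<open>Truncation\<close>

definition trunc :: "nat \<Rightarrow> 'x \<Rightarrow> real" where
  "trunc n x = indicator {x. L x \<le> sqrt n} x"

definition trunc_mean :: "nat \<Rightarrow> real^'d \<Rightarrow> real^'s" where
  "trunc_mean n z = (LINT x|P. trunc n x *\<^sub>R k z x)"

text \<open>Weights cut off by L rather than by the size of \<open>k z\<close> are the same for all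
  z, so one event accounts for the truncation everywhere. Subtracting \<open>trunc_mean\<close>
  restores mean 0, which truncation can destroy.\<close>

definition trunc_emp :: "nat \<Rightarrow> real^'d \<Rightarrow> 'a \<Rightarrow> real^'s" where
  "trunc_emp n z \<omega> = (1 / sqrt n) *\<^sub>R (\<Sum>i=1..n. trunc n (Xs i \<omega>) *\<^sub>R k z (Xs i \<omega>) - trunc_mean n z)"

definition L_moment :: real where "L_moment = (LINT x|P. (L x)\<^sup>2)"

lemma L_m: "L \<in> borel_measurable P" by (rule square_integrable_measurable[OF L_sq])

lemma trunc_m: "trunc n \<in> borel_measurable P"
  unfolding trunc_def using L_m by (simp add: indicator_def[abs_def])

lemma trunc_01: "trunc n x = 0 \<or> trunc n x = 1" "0 \<le> trunc n x" "trunc n x \<le> 1"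
  by (auto simp: trunc_def indicator_def)

lemma L_moment_nonneg: "0 \<le> L_moment" by (simp add: L_moment_def)

lemma trunc_k_int:
  assumes "z \<in> Z"
  shows "integrable P (\<lambda>x. trunc n x *\<^sub>R k z x)"
proof (rule Bochner_Integration.integrable_bound[OF k_int[OF assms]])
  show "(\<lambda>x. trunc n x *\<^sub>R k z x) \<in> borel_measurable P"
    using trunc_m k_m[OF assms] by (rule borel_measurable_scaleR)
  show "AE x in P. norm (trunc n x *\<^sub>R k z x) \<le> norm (k z x)"
    using trunc_01[of n] by (auto intro!: AE_I2 mult_left_le_one_le)
qed

lemma trunc_emp_m: "z \<in> Z \<Longrightarrow> trunc_emp n z \<in> borel_measurable M"
  unfolding trunc_emp_def using Xs_m k_m trunc_m
  by (auto intro!: borel_measurable_scaleR borel_measurable_sum borel_measurable_diff measurable_compose[of "Xs _" M P])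

text \<open>
  Truncation at \<open>sqrt n\<close> is what makes each summand, divided by \<open>2 (dist u v) sqrt n\<close>, bounded by 1.
\<close>

lemma trunc_emp_tail:
  assumes uv: "u \<in> Z" "v \<in> Z" and n: "1 \<le> n"
  shows "prob {\<omega>\<in>space M. t * dist u v < norm (trunc_emp n u \<omega> - trunc_emp n v \<omega>)}
    \<le> (real CARD('s) * (2 * exp L_moment)) * exp (- (1 / (2 * real CARD('s))) * t)"
proof (cases "u = v")
  case False
  define d where "d = dist u v"
  have d: "0 < d" using False by (simp add: d_def)
  define s where "s = sqrt (real n)"
  have s: "0 < s" "s\<^sup>2 = n" using n by (simp_all add: s_def)
  define p where "p x = trunc n x *\<^sub>R (k u x - k v x)" for x
  define q where "q = (LINT x|P. p x)"
  have p_eq: "p x = trunc n x *\<^sub>R k u x - trunc n x *\<^sub>R k v x" for x by (simp add: p_def scaleR_diff_right)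
  have p_int: "integrable P p" unfolding p_eq[abs_def] using trunc_k_int uv by auto
  have p_m[measurable]: "p \<in> borel_measurable P" using p_int by auto
  have q_eq: "q = trunc_mean n u - trunc_mean n v"
    unfolding q_def p_eq trunc_mean_def using trunc_k_int uv by (intro Bochner_Integration.integral_diff) auto
  have p_L: "norm (p x) \<le> L x * d" if "x \<in> space P" for x
  proof -
    have "norm (p x) \<le> norm (k u x - k v x)" using trunc_01[of n x] by (auto simp: p_def)
    then show ?thesis using lip[OF uv that] by (simp add: d_def)
  qed
  have p_s: "norm (p x) \<le> s * d" if "x \<in> space P" for x
  proof (cases "L x \<le> s")
    case True
    then have "L x * d \<le> s * d" using d by (intro mult_right_mono) auto
    then show ?thesis using p_L[OF that] by linarith
  next
    case False
    then have "trunc n x = 0" by (simp add: trunc_def s_def)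
    then show ?thesis using s d by (simp add: p_def)
  qed
  have q_s: "norm q \<le> s * d"
  proof -
    have "norm q \<le> (LINT x|P. norm (p x))" unfolding q_def by (rule integral_norm_bound)
    also have "\<dots> \<le> (LINT x|P. s * d)" using p_int p_s by (intro integral_mono) auto
    finally show ?thesis by (simp add: P.prob_space)
  qed
  have comp: "prob {\<omega>\<in>space M. t / (2 * real CARD('s)) * 1 < \<bar>((1 / (2 * d)) *\<^sub>R (trunc_emp n u \<omega> - trunc_emp n v \<omega>)) $ c\<bar>}
     \<le> 2 * exp L_moment * exp (- (t / (2 * real CARD('s))))" for c t
  proof -
    \<comment> \<open>Both p and its mean q are at most s d in norm, so their difference is at most
      2 s d in each component and the divisor makes h at most 1.\<close>
    define h where "h x = (p x $ c - q $ c) / (2 * d * s)" for x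
    have pc_m: "(\<lambda>x. p x $ c) \<in> borel_measurable P" by (rule measurable_compose[OF p_m]) simp
    have h_m: "h \<in> borel_measurable P" unfolding h_def using pc_m by auto
    have pc_sq: "square_integrable P (\<lambda>x. p x $ c)"
    proof (rule square_integrable_bound[OF square_integrable_cmult[OF L_sq, of d]])
      show "\<bar>p x $ c\<bar> \<le> d * L x" if "x \<in> space P" for x
        using component_le_norm_cart[of "p x" c] p_L[OF that] by (simp add: mult.commute)
    qed (rule pc_m)
    have pc_int: "integrable P (\<lambda>x. p x $ c)" "(LINT x|P. p x $ c) = q $ c"
      unfolding q_def using p_int
      by (auto intro!: integrable_bounded_linear[OF bounded_linear_vec_nth] integral_bounded_linear[OF bounded_linear_vec_nth])
    have h_mean: "(LINT x|P. h x) = 0"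
      unfolding h_def using pc_int by (simp add: P.prob_space)
    have h_bd: "\<bar>h x\<bar> \<le> 1" if "x \<in> space P" for x
    proof -
      have "\<bar>p x $ c - q $ c\<bar> \<le> s * d + s * d"
        using component_le_norm_cart[of "p x" c] component_le_norm_cart[of q c] p_s[OF that] q_s
        by (intro order_trans[OF abs_triangle_ineq4] add_mono) linarith+
      then show ?thesis using s d by (simp add: h_def abs_mult pos_divide_le_eq mult_ac)
    qed
    \<comment> \<open>A variance of order 1 / n is compensated by n summands: the factor in the
      exponential bound involves \<open>exp L_moment\<close> for every n.\<close>
    have h_var: "(LINT x|P. (h x)\<^sup>2) \<le> L_moment / n"
    proof -
      have "(LINT x|P. (p x $ c - q $ c)\<^sup>2) = (LINT x|P. (p x $ c)\<^sup>2) - (q $ c)\<^sup>2"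
        using P.variance_eq[OF pc_int(1)] pc_sq pc_int(2) by (simp add: square_integrable_def)
      also have "\<dots> \<le> (LINT x|P. (p x $ c)\<^sup>2)" by simp
      also have "\<dots> \<le> (LINT x|P. (d * L x)\<^sup>2)"
      proof (rule integral_mono)
        show "integrable P (\<lambda>x. (p x $ c)\<^sup>2)" using pc_sq by (simp add: square_integrable_def)
        show "integrable P (\<lambda>x. (d * L x)\<^sup>2)" using square_integrable_cmult[OF L_sq, of d] by (simp add: square_integrable_def)
        fix x assume x: "x \<in> space P"
        have "\<bar>p x $ c\<bar> \<le> \<bar>d * L x\<bar>"
          using component_le_norm_cart[of "p x" c] p_L[OF x] d L0[of x] by (simp add: mult.commute abs_mult)
        then show "(p x $ c)\<^sup>2 \<le> (d * L x)\<^sup>2" by (simp only: abs_le_square_iff)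
      qed
      also have "\<dots> = d\<^sup>2 * L_moment" by (simp add: power_mult_distrib L_moment_def)
      finally have *: "(LINT x|P. (p x $ c - q $ c)\<^sup>2) \<le> d\<^sup>2 * L_moment" .
      have "(LINT x|P. (h x)\<^sup>2) = (LINT x|P. (p x $ c - q $ c)\<^sup>2) / (4 * d\<^sup>2 * n)"
        unfolding h_def using s(2) by (simp add: power_divide power_mult_distrib)
      also have "\<dots> \<le> (d\<^sup>2 * L_moment) / (4 * d\<^sup>2 * n)" using * by (intro divide_right_mono) auto
      also have "\<dots> = L_moment / n / 4" using d by simp
      also have "\<dots> \<le> L_moment / n"
      proof -
        have quarter: "x / 4 \<le> x" if "0 \<le> x" for x :: real using that by simp
        show ?thesis by (rule quarter) (rule divide_nonneg_nonneg[OF L_moment_nonneg of_nat_0_le_iff])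
      qed
      finally show ?thesis .
    qed
    have "prob {\<omega>\<in>space M. t / (2 * real CARD('s)) < \<bar>\<Sum>i\<in>{1..n}. h (Xs i \<omega>)\<bar>} \<le> 2 * exp (card {1..n} * (L_moment / n)) * exp (- (t / (2 * real CARD('s))))"
    proof (rule bernstein_tail[OF indep_Xs[OF h_m]])
      show "\<bar>h (Xs i \<omega>)\<bar> \<le> 1" if "i \<in> {1..n}" "\<omega> \<in> space M" for i \<omega>
        using h_bd measurable_space[OF Xs_m] that by simp
      show "expectation (\<lambda>\<omega>. h (Xs i \<omega>)) = 0" if "i \<in> {1..n}" for i
        using expectation_Xs[OF _ h_m] h_mean that by simp
      show "expectation (\<lambda>\<omega>. (h (Xs i \<omega>))\<^sup>2) \<le> L_moment / n" if "i \<in> {1..n}" for i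
        using expectation_Xs[of i "\<lambda>x. (h x)\<^sup>2"] h_m h_var that by simp
    qed simp
    moreover have "(\<Sum>i\<in>{1..n}. h (Xs i \<omega>)) = ((1 / (2 * d)) *\<^sub>R (trunc_emp n u \<omega> - trunc_emp n v \<omega>)) $ c" for \<omega>
    proof -
      have "trunc_emp n u \<omega> - trunc_emp n v \<omega> = (1 / s) *\<^sub>R (\<Sum>i=1..n. p (Xs i \<omega>) - q)"
        unfolding trunc_emp_def s_def[symmetric] scaleR_diff_right[symmetric] sum_subtractf[symmetric]
        by (simp add: p_eq q_eq algebra_simps)
      then show ?thesis
        by (simp add: h_def sum_component sum_divide_distrib sum_distrib_left field_simps)
    qed
    moreover have "card {1..n} * (L_moment / n) = L_moment" using n by simp
    ultimately show ?thesis by simp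
  qed
  have "prob {\<omega>\<in>space M. CARD('s) * (t / (2 * real CARD('s)) * 1) < norm ((1 / (2 * d)) *\<^sub>R (trunc_emp n u \<omega> - trunc_emp n v \<omega>))}
    \<le> CARD('s) * (2 * exp L_moment * exp (- (t / (2 * real CARD('s)))))"
    using trunc_emp_m uv by (intro prob_norm_gt_le_components comp) auto
  moreover have "CARD('s) * (t / (2 * real CARD('s)) * 1) < norm ((1 / (2 * d)) *\<^sub>R (trunc_emp n u \<omega> - trunc_emp n v \<omega>))
      \<longleftrightarrow> t * dist u v < norm (trunc_emp n u \<omega> - trunc_emp n v \<omega>)" for \<omega>
    using d by (simp add: d_def pos_less_divide_eq mult_ac)
  ultimately show ?thesis by (simp add: mult.assoc)
qed (simp add: mult_nonneg_nonneg)

text \<open>A union bound over the sample gives n P(L > sqrt n), which is at most the integral of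
  L^2 over {L > sqrt n}; dominated convergence sends this to 0, and the finite second moment is
  exactly what it uses.\<close>

lemma truncation_prob_tendsto_0: "(\<lambda>n. prob {\<omega>\<in>space M. \<exists>i\<in>{1..n}. sqrt n < L (Xs i \<omega>)}) \<longlonglongrightarrow> 0"
proof (rule tendsto_sandwich[OF _ _ tendsto_const])
  let ?I = "\<lambda>n x. indicator {x. sqrt (real n) < L x} x :: real"
  have [measurable]: "L \<in> borel_measurable P" by (rule L_m)
  have I_m[measurable]: "?I n \<in> borel_measurable P" for n by (simp add: indicator_def[abs_def])
  show "\<forall>\<^sub>F n in sequentially. 0 \<le> prob {\<omega>\<in>space M. \<exists>i\<in>{1..n}. sqrt n < L (Xs i \<omega>)}" by simp
  have bd: "prob {\<omega>\<in>space M. \<exists>i\<in>{1..n}. sqrt n < L (Xs i \<omega>)} \<le> (LINT x|P. (L x)\<^sup>2 * ?I n x)" for n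
  proof -
    have LX_m: "(\<lambda>\<omega>. L (Xs i \<omega>)) \<in> borel_measurable M" if "i \<in> {1..n}" for i
      using that by (intro measurable_compose[OF Xs_m L_m]) auto
    have ev: "{\<omega>\<in>space M. sqrt n < L (Xs i \<omega>)} \<in> sets M" if "i \<in> {1..n}" for i
      using LX_m[OF that] by measurable
    have "prob {\<omega>\<in>space M. \<exists>i\<in>{1..n}. sqrt n < L (Xs i \<omega>)} = prob (\<Union>i\<in>{1..n}. {\<omega>\<in>space M. sqrt n < L (Xs i \<omega>)})"
      by (rule arg_cong[where f=prob]) auto
    also have "\<dots> \<le> (\<Sum>i\<in>{1..n}. prob {\<omega>\<in>space M. sqrt n < L (Xs i \<omega>)})"
      using ev by (intro finite_measure_subadditive_finite) auto
    also have "\<dots> = (\<Sum>i\<in>{1..n}. (LINT x|P. ?I n x))"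
    proof (rule sum.cong[OF refl])
      fix i assume i: "i \<in> {1..n}"
      have "prob {\<omega>\<in>space M. sqrt n < L (Xs i \<omega>)} = expectation (indicator {\<omega>\<in>space M. sqrt n < L (Xs i \<omega>)})"
        using ev[OF i] by simp
      also have "\<dots> = expectation (\<lambda>\<omega>. ?I n (Xs i \<omega>))"
        by (intro Bochner_Integration.integral_cong) (auto simp: indicator_def)
      also have "\<dots> = (LINT x|P. ?I n x)" using i by (intro expectation_Xs I_m) auto
      finally show "prob {\<omega>\<in>space M. sqrt n < L (Xs i \<omega>)} = (LINT x|P. ?I n x)" .
    qed
    also have "\<dots> = (LINT x|P. n * ?I n x)" by simp
    also have "\<dots> \<le> (LINT x|P. (L x)\<^sup>2 * ?I n x)"
    proof (rule integral_mono)
      show "integrable P (\<lambda>x. n * ?I n x)"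
      proof (rule integrable_mult_right)
        show "integrable P (?I n)"
          by (rule P.integrable_const_bound[where B=1, OF _ I_m]) (simp add: indicator_def)
      qed
      show "integrable P (\<lambda>x. (L x)\<^sup>2 * ?I n x)"
      proof (rule Bochner_Integration.integrable_bound)
        show "integrable P (\<lambda>x. (L x)\<^sup>2)" using L_sq by (simp add: square_integrable_def)
        show "(\<lambda>x. (L x)\<^sup>2 * ?I n x) \<in> borel_measurable P"
          by (intro borel_measurable_times borel_measurable_power L_m I_m)
        show "AE x in P. norm ((L x)\<^sup>2 * ?I n x) \<le> norm ((L x)\<^sup>2)"
          by (rule AE_I2) (simp add: indicator_def)
      qed
      fix x
      have "real n \<le> (L x)\<^sup>2" if "sqrt n < L x"
      proof -
        have "(sqrt n)\<^sup>2 \<le> (L x)\<^sup>2" using that by (intro power_mono) auto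
        then show ?thesis by simp
      qed
      then show "n * ?I n x \<le> (L x)\<^sup>2 * ?I n x" by (simp add: indicator_def)
    qed
    finally show ?thesis .
  qed
  then show "\<forall>\<^sub>F n in sequentially. prob {\<omega>\<in>space M. \<exists>i\<in>{1..n}. sqrt n < L (Xs i \<omega>)} \<le> (LINT x|P. (L x)\<^sup>2 * ?I n x)"
    by simp
  have "(\<lambda>n. LINT x|P. (L x)\<^sup>2 * ?I n x) \<longlonglongrightarrow> (LINT x|P. 0)"
  proof (rule integral_dominated_convergence[where w="\<lambda>x. (L x)\<^sup>2"])
    show "integrable P (\<lambda>x. (L x)\<^sup>2)" using L_sq by (simp add: square_integrable_def)
    show "AE x in P. (\<lambda>n. (L x)\<^sup>2 * ?I n x) \<longlonglongrightarrow> 0"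
    proof (rule AE_I2)
      fix x
      have "\<forall>\<^sub>F n in sequentially. L x < sqrt (real n)"
        using filterlim_compose[OF sqrt_at_top filterlim_real_sequentially] by (simp add: filterlim_at_top_dense)
      then have "\<forall>\<^sub>F n in sequentially. (L x)\<^sup>2 * ?I n x = 0" by eventually_elim (simp add: indicator_def)
      then show "(\<lambda>n. (L x)\<^sup>2 * ?I n x) \<longlonglongrightarrow> 0" by (rule tendsto_eventually)
    qed
    show "AE x in P. norm ((L x)\<^sup>2 * ?I n x) \<le> (L x)\<^sup>2" for n
      by (rule AE_I2) (simp add: indicator_def)
  qed (auto intro!: borel_measurable_times borel_measurable_power L_m I_m)
  then show "(\<lambda>n. LINT x|P. (L x)\<^sup>2 * ?I n x) \<longlonglongrightarrow> 0" by simp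
qed

text \<open>The full increment has mean 0, so the difference of truncated means is minus its mean
  over {L > sqrt n}, where L \<le> L^2 / sqrt n. The gained 1 / sqrt n cancels the factor sqrt n,
  and the bias is Lipschitz uniformly in n.\<close>

lemma truncation_bias:
  assumes uv: "u \<in> Z" "v \<in> Z" and n: "1 \<le> n"
  shows "norm (sqrt n *\<^sub>R (trunc_mean n u - trunc_mean n v)) \<le> L_moment * dist u v"
proof -
  have s: "0 < sqrt (real n)" using n by simp
  have "trunc_mean n u - trunc_mean n v = (LINT x|P. (trunc n x *\<^sub>R k u x - trunc n x *\<^sub>R k v x) - (k u x - k v x))"
    unfolding trunc_mean_def using trunc_k_int k_int k_mean uv by simp
  also have "norm \<dots> \<le> (LINT x|P. norm ((trunc n x *\<^sub>R k u x - trunc n x *\<^sub>R k v x) - (k u x - k v x)))"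
    by (rule integral_norm_bound)
  also have "\<dots> \<le> (LINT x|P. (dist u v / sqrt n) * (L x)\<^sup>2)"
  proof (rule integral_mono)
    show "integrable P (\<lambda>x. norm ((trunc n x *\<^sub>R k u x - trunc n x *\<^sub>R k v x) - (k u x - k v x)))"
      using trunc_k_int k_int uv by auto
    show "integrable P (\<lambda>x. (dist u v / sqrt n) * (L x)\<^sup>2)" using L_sq by (simp add: square_integrable_def)
    fix x assume x: "x \<in> space P"
    show "norm ((trunc n x *\<^sub>R k u x - trunc n x *\<^sub>R k v x) - (k u x - k v x)) \<le> (dist u v / sqrt n) * (L x)\<^sup>2"
    proof (cases "L x \<le> sqrt n")
      case True
      then have "trunc n x = 1" by (simp add: trunc_def)
      then show ?thesis by simp
    next
      case False
      then have "trunc n x = 0" by (simp add: trunc_def)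
      then have "norm ((trunc n x *\<^sub>R k u x - trunc n x *\<^sub>R k v x) - (k u x - k v x)) = norm (k u x - k v x)"
        by (simp add: norm_minus_commute)
      also have "\<dots> \<le> L x * dist u v" by (rule lip[OF uv x])
      also have "L x \<le> (L x)\<^sup>2 / sqrt n"
        using False s L0[of x] by (simp add: pos_le_divide_eq power2_eq_square mult_left_mono)
      then have "L x * dist u v \<le> (L x)\<^sup>2 / sqrt n * dist u v" by (intro mult_right_mono) auto
      finally show ?thesis by (simp add: mult_ac)
    qed
  qed
  also have "\<dots> = L_moment * dist u v / sqrt n" by (simp add: L_moment_def)
  finally show ?thesis using s by (simp add: pos_le_divide_eq mult.commute)
qed

lemma emp_eq_trunc_emp:
  assumes uv: "u \<in> Z" "v \<in> Z" and n: "1 \<le> n" and trunc: "\<And>i. i \<in> {1..n} \<Longrightarrow> L (Xs i \<omega>) \<le> sqrt n"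
  shows "emp n u \<omega> - emp n v \<omega> = (trunc_emp n u \<omega> - trunc_emp n v \<omega>) + sqrt n *\<^sub>R (trunc_mean n u - trunc_mean n v)"
proof -
  have trunc_emp_eq: "trunc_emp n z \<omega> = emp n z \<omega> - sqrt n *\<^sub>R trunc_mean n z" for z
  proof -
    have "(\<Sum>i=1..n. trunc n (Xs i \<omega>) *\<^sub>R k z (Xs i \<omega>) - trunc_mean n z) = (\<Sum>i=1..n. k z (Xs i \<omega>)) - real n *\<^sub>R trunc_mean n z"
      using trunc by (simp add: sum_subtractf trunc_def sum_constant_scaleR del: sum_constant)
    moreover have "(1 / sqrt n) * real n = sqrt n" by (simp add: real_div_sqrt)
    ultimately show ?thesis by (simp only: trunc_emp_def emp_def scaleR_diff_right scaleR_scaleR)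
  qed
  show ?thesis by (simp add: trunc_emp_eq algebra_simps)
qed

text \<open>Outside the event that some sample point is truncated, an increment of
  \<open>emp\<close> is an increment of \<open>trunc_emp\<close>, handled by chaining on the nets,
  plus the Lipschitz bias. Continuity of the paths of \<open>emp\<close> extends the bound from D to
  Z.\<close>

lemma emp_modulus:
  assumes \<eta>: "0 < \<eta>"
  shows "\<exists>\<delta>>0. \<exists>n0. \<forall>n\<ge>n0. \<exists>A\<in>sets M. prob A \<le> \<eta> \<and>
      (\<forall>\<omega>\<in>space M - A. \<forall>u\<in>Z. \<forall>v\<in>Z. dist u v \<le> \<delta> \<longrightarrow> norm (emp n u \<omega> - emp n v \<omega>) \<le> \<eta>)"
proof -
  obtain K Q :: real and F :: "nat \<Rightarrow> (real^'d) set"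
  where net: "\<forall>j. finite (F j) \<and> F j \<subseteq> Z \<and> F j \<subseteq> F (Suc j) \<and> real (card (F j)) \<le> K * Q ^ j \<and>
    (\<forall>z\<in>Z. \<exists>y\<in>F j. dist z y \<le> (1/4)^j)"
    using compact_nets[OF compact_Z] by (elim exE)
  have F: "finite (F j)" "F j \<subseteq> Z" "F j \<subseteq> F (Suc j)" "real (card (F j)) \<le> K * Q ^ j"
    "z \<in> Z \<Longrightarrow> \<exists>y\<in>F j. dist z y \<le> (1/4)^j" for j z
    using net by blast+
  define D where "D = (\<Union>j. F j)"
  have DZ: "D \<subseteq> Z" using F(2) by (auto simp: D_def)
  have netD: "\<exists>y\<in>F j. dist z y \<le> (1/4)^j" if "z \<in> (\<Union>i. F i)" for j z
    using F(5)[of z j] that F(2) by blast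
  have ZD: "Z \<subseteq> closure D"
  proof
    fix z assume z: "z \<in> Z"
    show "z \<in> closure D"
      unfolding closure_approachable
    proof (intro allI impI)
      fix e :: real assume "0 < e"
      then obtain j where "(1/4::real)^j < e" using real_arch_pow_inv[of e "1/4"] by auto
      then show "\<exists>y\<in>D. dist y z < e" using F(5)[OF z, of j] by (force simp: D_def dist_commute)
    qed
  qed
  have c: "0 < 1 / (2 * real CARD('s))" and \<eta>2: "0 < \<eta> / 2" using \<eta> by simp_all
  obtain \<delta> where \<delta>: "\<delta> > 0 \<and> (\<forall>(M :: 'a measure) (V :: real^'d \<Rightarrow> 'a \<Rightarrow> real^'s).
      prob_space M \<longrightarrow> (\<forall>z\<in>(\<Union>i. F i). V z \<in> borel_measurable M) \<longrightarrow>
      (\<forall>u\<in>(\<Union>i. F i). \<forall>v\<in>(\<Union>i. F i). \<forall>t>0.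
        measure M {\<omega>\<in>space M. t * dist u v < norm (V u \<omega> - V v \<omega>)}
          \<le> (real CARD('s) * (2 * exp L_moment)) * exp (- (1 / (2 * real CARD('s))) * t)) \<longrightarrow>
      (\<exists>A\<in>sets M. measure M A \<le> \<eta> / 2 \<and>
        (\<forall>\<omega>\<in>space M - A. \<forall>u\<in>(\<Union>i. F i). \<forall>v\<in>(\<Union>i. F i). dist u v \<le> \<delta> \<longrightarrow> norm (V u \<omega> - V v \<omega>) \<le> \<eta> / 2)))"
    by (rule exE[OF chaining_modulus[OF F(1,3,4) netD c \<eta>2, where C = "real CARD('s) * (2 * exp L_moment)"]], assumption, rule that)
  have mod_trunc_emp: "\<exists>A\<in>sets M. prob A \<le> \<eta> / 2 \<and>
      (\<forall>\<omega>\<in>space M - A. \<forall>u\<in>D. \<forall>v\<in>D. dist u v \<le> \<delta> \<longrightarrow> norm (trunc_emp n u \<omega> - trunc_emp n v \<omega>) \<le> \<eta> / 2)" if n: "1 \<le> n" for n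
  proof -
    have "\<forall>z\<in>(\<Union>i. F i). trunc_emp n z \<in> borel_measurable M" using DZ trunc_emp_m by (auto simp: D_def)
    moreover have "\<forall>u\<in>(\<Union>i. F i). \<forall>v\<in>(\<Union>i. F i). \<forall>t>0. prob {\<omega>\<in>space M. t * dist u v < norm (trunc_emp n u \<omega> - trunc_emp n v \<omega>)}
          \<le> (real CARD('s) * (2 * exp L_moment)) * exp (- (1 / (2 * real CARD('s))) * t)"
      using DZ n unfolding D_def by (intro ballI allI impI trunc_emp_tail) auto
    ultimately show ?thesis
      unfolding D_def using \<delta>[THEN conjunct2, THEN spec, THEN spec, THEN mp, THEN mp, THEN mp] prob_space_axioms by blast
  qed
  obtain n1 where n1: "\<And>n. n \<ge> n1 \<Longrightarrow> prob {\<omega>\<in>space M. \<exists>i\<in>{1..n}. sqrt n < L (Xs i \<omega>)} < \<eta> / 2"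
    using order_tendstoD(2)[OF truncation_prob_tendsto_0 \<eta>2] by (auto simp: eventually_sequentially)
  \<comment> \<open>The second bound keeps the bias below \<eta> / 2; adding 1 to
    \<open>L_moment\<close> avoids a zero denominator.\<close>
  define \<delta>' where "\<delta>' = min \<delta> (\<eta> / (2 * (L_moment + 1)))"
  have \<delta>': "0 < \<delta>'" "\<delta>' \<le> \<delta>" "\<delta>' \<le> \<eta> / (2 * (L_moment + 1))"
    using \<delta> \<eta> L_moment_nonneg by (auto simp: \<delta>'_def)
  show ?thesis
  proof (intro exI[of _ "\<delta>' / 2"] exI[of _ "max 1 n1"] conjI allI impI)
    show "0 < \<delta>' / 2" using \<delta>' by simp
    fix n assume "max 1 n1 \<le> n"
    then have n: "1 \<le> n" "n1 \<le> n" by auto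
    obtain A where A: "A \<in> sets M \<and> prob A \<le> \<eta> / 2 \<and>
      (\<forall>\<omega>\<in>space M - A. \<forall>u\<in>D. \<forall>v\<in>D. dist u v \<le> \<delta> \<longrightarrow> norm (trunc_emp n u \<omega> - trunc_emp n v \<omega>) \<le> \<eta> / 2)"
      using mod_trunc_emp[OF n(1)] unfolding Bex_def by (elim exE)
    define E where "E = {\<omega>\<in>space M. \<exists>i\<in>{1..n}. sqrt n < L (Xs i \<omega>)}"
    have E_m: "E \<in> sets M"
    proof -
      have "(\<lambda>\<omega>. L (Xs i \<omega>)) \<in> borel_measurable M" if "i \<in> {1..n}" for i
        using that by (intro measurable_compose[OF Xs_m L_m]) auto
      then have "(\<Union>i\<in>{1..n}. {\<omega>\<in>space M. sqrt n < L (Xs i \<omega>)}) \<in> sets M"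
        by (intro sets.finite_UN) auto
      moreover have "E = (\<Union>i\<in>{1..n}. {\<omega>\<in>space M. sqrt n < L (Xs i \<omega>)})" by (auto simp: E_def)
      ultimately show ?thesis by simp
    qed
    show "\<exists>A\<in>sets M. prob A \<le> \<eta> \<and>
      (\<forall>\<omega>\<in>space M - A. \<forall>u\<in>Z. \<forall>v\<in>Z. dist u v \<le> \<delta>' / 2 \<longrightarrow> norm (emp n u \<omega> - emp n v \<omega>) \<le> \<eta>)"
    proof (intro bexI[of _ "A \<union> E"] conjI ballI impI)
      have "prob (A \<union> E) \<le> prob A + prob E" using A E_m by (intro measure_Un_le) auto
      also have "\<dots> \<le> \<eta> / 2 + \<eta> / 2" using A n1[OF n(2)] by (intro add_mono) (auto simp: E_def)
      finally show "prob (A \<union> E) \<le> \<eta>" by simp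
      show "A \<union> E \<in> sets M" using A E_m by auto
      fix \<omega> u v assume \<omega>: "\<omega> \<in> space M - (A \<union> E)" and uv: "u \<in> Z" "v \<in> Z" "dist u v \<le> \<delta>' / 2"
      show "norm (emp n u \<omega> - emp n v \<omega>) \<le> \<eta>"
      proof (rule modulus_from_dense[OF DZ ZD, where w="\<lambda>z. emp n z \<omega>" and \<delta>=\<delta>'])
        show "continuous_on Z (\<lambda>z. emp n z \<omega>)" using \<omega> emp_continuous by auto
        show "dist u v < \<delta>'" using uv \<delta>'(1) by linarith
        fix u v assume D: "u \<in> D" "v \<in> D" "dist u v \<le> \<delta>'"
        then have Z: "u \<in> Z" "v \<in> Z" using DZ by auto
        have "norm (trunc_emp n u \<omega> - trunc_emp n v \<omega>) \<le> \<eta> / 2" using A \<omega> D \<delta>'(2) by auto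
        moreover have "norm (sqrt n *\<^sub>R (trunc_mean n u - trunc_mean n v)) \<le> \<eta> / 2"
        proof -
          have "L_moment * dist u v \<le> (L_moment + 1) * (\<eta> / (2 * (L_moment + 1)))"
            using D(3) \<delta>'(3) L_moment_nonneg by (intro mult_mono) auto
          also have "\<dots> = \<eta> / 2" using L_moment_nonneg by (simp add: field_simps)
          finally show ?thesis using truncation_bias[OF Z n(1)] by linarith
        qed
        moreover have eq: "emp n u \<omega> - emp n v \<omega> = (trunc_emp n u \<omega> - trunc_emp n v \<omega>) + sqrt n *\<^sub>R (trunc_mean n u - trunc_mean n v)"
          using \<omega> by (intro emp_eq_trunc_emp Z n) (auto simp: E_def not_less)
        ultimately show "norm (emp n u \<omega> - emp n v \<omega>) \<le> \<eta>"
          unfolding eq using norm_triangle_ineq[of "trunc_emp n u \<omega> - trunc_emp n v \<omega>" "sqrt n *\<^sub>R (trunc_mean n u - trunc_mean n v)"] by linarith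
      qed (use uv in auto)
    qed
  qed
qed

text \<open>A modulus at one radius reduces the supremum to a finite net, on which pointwise
  tightness is enough.\<close>

lemma emp_bounded:
  assumes \<eta>: "0 < \<eta>"
  shows "\<exists>R n0. \<forall>n\<ge>n0. \<exists>A\<in>sets M. prob A \<le> \<eta> \<and> (\<forall>\<omega>\<in>space M - A. \<forall>z\<in>Z. norm (emp n z \<omega>) \<le> R)"
proof -
  have \<eta>2: "0 < \<eta> / 2" using \<eta> by simp
  obtain \<delta> n0 where \<delta>: "0 < \<delta> \<and> (\<forall>n\<ge>n0. \<exists>A\<in>sets M. prob A \<le> \<eta> / 2 \<and>
      (\<forall>\<omega>\<in>space M - A. \<forall>u\<in>Z. \<forall>v\<in>Z. dist u v \<le> \<delta> \<longrightarrow> norm (emp n u \<omega> - emp n v \<omega>) \<le> \<eta> / 2))"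
    using emp_modulus[OF \<eta>2] by blast
  have "seq_compact Z" "0 < \<delta>" using compact_Z \<delta> by (simp_all add: compact_eq_seq_compact_metric)
  then obtain J where "finite J \<and> J \<subseteq> Z \<and> Z \<subseteq> (\<Union>z\<in>J. ball z \<delta>)"
    using seq_compact_imp_totally_bounded by metis
  then have J: "finite J" "J \<subseteq> Z" "Z \<subseteq> (\<Union>z\<in>J. ball z \<delta>)" by auto
  \<comment> \<open>Half of \<eta> is shared among the points of J; the added 1 covers an empty
    J.\<close>
  define \<eta>' where "\<eta>' = \<eta> / (2 * (card J + 1))"
  have \<eta>': "0 < \<eta>'" "card J * \<eta>' \<le> \<eta> / 2" using \<eta> by (simp_all add: \<eta>'_def field_simps)
  have "\<forall>z\<in>J. \<exists>R. \<forall>n\<ge>1. prob {\<omega>\<in>space M. R < norm (emp n z \<omega>)} \<le> \<eta>'"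
    using emp_pointwise_tight[OF _ \<eta>'(1)] J(2) by blast
  then obtain R where R: "\<And>z n. z \<in> J \<Longrightarrow> 1 \<le> n \<Longrightarrow> prob {\<omega>\<in>space M. R z < norm (emp n z \<omega>)} \<le> \<eta>'" by metis
  define R' where "R' = Max (insert 0 (R ` J)) + \<eta>"
  have R': "R z + \<eta> \<le> R'" if "z \<in> J" for z using that J(1) by (auto simp: R'_def intro!: Max_ge)
  show ?thesis
  proof (intro exI[of _ R'] exI[of _ "max 1 n0"] allI impI)
    fix n assume "max 1 n0 \<le> n"
    then have n: "1 \<le> n" "n0 \<le> n" by auto
    obtain A where A: "A \<in> sets M \<and> prob A \<le> \<eta> / 2 \<and>
      (\<forall>\<omega>\<in>space M - A. \<forall>u\<in>Z. \<forall>v\<in>Z. dist u v \<le> \<delta> \<longrightarrow> norm (emp n u \<omega> - emp n v \<omega>) \<le> \<eta> / 2)"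
      using \<delta> n(2) unfolding Bex_def by blast
    define E where "E = (\<Union>z\<in>J. {\<omega>\<in>space M. R z < norm (emp n z \<omega>)})"
    have ev: "{\<omega>\<in>space M. R z < norm (emp n z \<omega>)} \<in> sets M" if "z \<in> J" for z
    proof -
      have [measurable]: "emp n z \<in> borel_measurable M" using that J(2) by (intro emp_m) auto
      show ?thesis by measurable
    qed
    have E_m: "E \<in> sets M" unfolding E_def using J(1) ev by (intro sets.finite_UN) auto
    have "prob E \<le> (\<Sum>z\<in>J. prob {\<omega>\<in>space M. R z < norm (emp n z \<omega>)})"
      unfolding E_def using J(1) ev by (intro finite_measure_subadditive_finite) auto
    also have "\<dots> \<le> (\<Sum>z\<in>J. \<eta>')" using R n by (intro sum_mono) auto
    also have "\<dots> \<le> \<eta> / 2" using \<eta>'(2) by simp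
    finally have E: "prob E \<le> \<eta> / 2" .
    show "\<exists>A\<in>sets M. prob A \<le> \<eta> \<and> (\<forall>\<omega>\<in>space M - A. \<forall>z\<in>Z. norm (emp n z \<omega>) \<le> R')"
    proof (intro bexI[of _ "A \<union> E"] conjI ballI)
      have "prob (A \<union> E) \<le> prob A + prob E" using A E_m by (intro measure_Un_le) auto
      then show "prob (A \<union> E) \<le> \<eta>" using A E by linarith
      show "A \<union> E \<in> sets M" using A E_m by auto
      fix \<omega> z assume \<omega>: "\<omega> \<in> space M - (A \<union> E)" and z: "z \<in> Z"
      obtain j where j: "j \<in> J" "dist j z < \<delta>" using J(3) z by auto
      have "norm (emp n z \<omega> - emp n j \<omega>) \<le> \<eta> / 2"
        using A \<omega> z j J(2) by (auto simp: dist_commute)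
      moreover have "norm (emp n j \<omega>) \<le> R j" using \<omega> j(1) by (auto simp: E_def not_less)
      ultimately show "norm (emp n z \<omega>) \<le> R'"
        using R'[OF j(1)] norm_triangle_ineq[of "emp n z \<omega> - emp n j \<omega>" "emp n j \<omega>"] \<eta> by simp
    qed
  qed
qed

end

section \<open>Brownian processes and the limit theorem\<close>

lemma integrable_inner_imp_integrable:
  fixes U :: "'a \<Rightarrow> 'b::euclidean_space"
  assumes "\<And>a. integrable M (\<lambda>\<omega>. inner a (U \<omega>))"
  shows "integrable M U"
proof -
  have "integrable M (\<lambda>\<omega>. inner (U \<omega>) b)" for b
    using assms[of b] by (simp only: inner_commute)
  then have "integrable M (\<lambda>\<omega>. \<Sum>b\<in>Basis. inner (U \<omega>) b *\<^sub>R b)"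
    by (intro Bochner_Integration.integrable_sum integrable_scaleR_left)
  then show ?thesis by (simp only: euclidean_representation)
qed

lemma integrable_outer_product:
  fixes U V :: "'a \<Rightarrow> real^'n"
  assumes U: "\<And>a. square_integrable M (\<lambda>\<omega>. inner a (U \<omega>))" and V: "\<And>a. square_integrable M (\<lambda>\<omega>. inner a (V \<omega>))"
  shows "integrable M (\<lambda>\<omega>. outer_product (U \<omega>) (V \<omega>))"
proof (rule integrable_inner_imp_integrable)
  fix A :: "real^'n^'n"
  have "square_integrable M (\<lambda>\<omega>. U \<omega> $ i)" "square_integrable M (\<lambda>\<omega>. V \<omega> $ i)" for i
    using U[of "axis i 1"] V[of "axis i 1"] by (simp_all add: inner_axis')
  then have "integrable M (\<lambda>\<omega>. \<Sum>i\<in>UNIV. \<Sum>j\<in>UNIV. A $ i $ j * (U \<omega> $ i * V \<omega> $ j))"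
    by (intro Bochner_Integration.integrable_sum integrable_mult_right square_integrable_mult)
  then show "integrable M (\<lambda>\<omega>. inner A (outer_product (U \<omega>) (V \<omega>)))"
    by (simp add: inner_vec_def outer_product_def)
qed

lemma inner_integral_outer_product:
  fixes U V :: "'a \<Rightarrow> real^'n"
  assumes "integrable M (\<lambda>\<omega>. outer_product (U \<omega>) (V \<omega>))"
  shows "inner a ((LINT \<omega>|M. outer_product (U \<omega>) (V \<omega>)) *v b) = (LINT \<omega>|M. inner a (U \<omega>) * inner b (V \<omega>))"
  unfolding inner_outer_product_mult
  by (rule integral_bounded_linear[OF bounded_linear_inner_matrix_vector assms, symmetric])

lemma matrix_eqI_inner:
  fixes A B :: "real^'n^'n"
  assumes "\<And>a b. inner a (A *v b) = inner a (B *v b)"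
  shows "A = B"
proof -
  have "A *v b = B *v b" for b
  proof -
    have "inner (A *v b - B *v b) (A *v b - B *v b) = 0"
      using assms[of "A *v b - B *v b" b] by (simp only: inner_diff_right)
    then show ?thesis by simp
  qed
  then show ?thesis by (simp add: matrix_eq)
qed

text \<open>Covariances follow from the variances of linear combinations by polarization, so the
  assumed laws of the combinations determine the covariance matrices.\<close>

lemma (in prob_space) zero_mean_brownian_processI:
  fixes W :: "'z::topological_space \<Rightarrow> 'a \<Rightarrow> real^'s" and k :: "'z \<Rightarrow> 'x \<Rightarrow> real^'s"
  assumes W_m: "\<And>z. z \<in> Z \<Longrightarrow> W z \<in> borel_measurable M"
    and cont: "\<And>\<omega>. \<omega> \<in> space M \<Longrightarrow> continuous_on Z (\<lambda>z. W z \<omega>)"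
    and k: "\<And>z a. z \<in> Z \<Longrightarrow> square_integrable P (\<lambda>x. inner a (k z x))"
    and normal: "\<And>J a. finite J \<Longrightarrow> J \<subseteq> Z \<Longrightarrow>
      normal_char M (\<lambda>\<omega>. \<Sum>z\<in>J. inner (a z) (W z \<omega>)) (LINT x|P. (\<Sum>z\<in>J. inner (a z) (k z x))\<^sup>2)"
  shows "zero_mean_brownian_process M Z (\<lambda>z' z''. LINT x|P. outer_product (k z' x) (k z'' x)) W"
proof -
  have single: "normal_char M (\<lambda>\<omega>. inner a (W z \<omega>)) (LINT x|P. (inner a (k z x))\<^sup>2)" if "z \<in> Z" for z a
    using normal[of "{z}" "\<lambda>_. a"] that by simp
  have W_sq: "square_integrable M (\<lambda>\<omega>. inner a (W z \<omega>))" if "z \<in> Z" for z a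
    using normal_char_moments(3)[OF single[OF that, of a]] single[OF that, of a, unfolded normal_char_def, THEN conjunct1]
    unfolding square_integrable_def by (intro conjI)
  have W_int: "integrable M (W z)" if "z \<in> Z" for z
    by (rule integrable_inner_imp_integrable) (rule normal_char_moments(1)[OF single[OF that]])
  have mean: "expectation (W z) = 0" if "z \<in> Z" for z
  proof -
    have "inner a (expectation (W z)) = 0" for a
      using normal_char_moments(2)[OF single[OF that]] W_int[OF that] by simp
    then show ?thesis by (metis inner_eq_zero_iff)
  qed
  have cross: "expectation (\<lambda>\<omega>. inner a (W u \<omega>) * inner b (W v \<omega>)) = (LINT x|P. inner a (k u x) * inner b (k v x))"
    if u: "u \<in> Z" and v: "v \<in> Z" for u v a b
  proof -
    \<comment> \<open>For u = v the set {u, v} has one element, and the two coefficients have to be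
      added.\<close>
    have sq: "expectation (\<lambda>\<omega>. (inner a (W u \<omega>) + inner c (W v \<omega>))\<^sup>2) = (LINT x|P. (inner a (k u x) + inner c (k v x))\<^sup>2)" for c
    proof (cases "u = v")
      case True
      then show ?thesis
        using normal_char_moments(4)[OF single[OF v, of "a + c"]] by (simp add: inner_add_left)
    next
      case False
      then show ?thesis
        using normal_char_moments(4)[OF normal[of "{u, v}" "\<lambda>z. if z = u then a else c"]] u v by auto
    qed
    have pol: "(LINT \<omega>|L. p \<omega> * q \<omega>) = ((LINT \<omega>|L. (p \<omega> + q \<omega>)\<^sup>2) - (LINT \<omega>|L. (p \<omega> + - q \<omega>)\<^sup>2)) / 4"
      if "square_integrable L p" "square_integrable L q" for L :: "'c measure" and p q
    proof -
      have "(LINT \<omega>|L. (p \<omega> + q \<omega>)\<^sup>2) - (LINT \<omega>|L. (p \<omega> + - q \<omega>)\<^sup>2) = (LINT \<omega>|L. (p \<omega> + q \<omega>)\<^sup>2 - (p \<omega> + - q \<omega>)\<^sup>2)"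
        using square_integrable_add[OF that] square_integrable_diff[OF that]
        by (intro Bochner_Integration.integral_diff[symmetric]) (simp_all add: square_integrable_def)
      also have "\<dots> = (LINT \<omega>|L. 4 * (p \<omega> * q \<omega>))"
        by (simp add: power2_eq_square algebra_simps)
      finally show ?thesis by simp
    qed
    show ?thesis
      unfolding pol[OF W_sq[OF u, of a] W_sq[OF v, of b]] pol[OF k[OF u, of a] k[OF v, of b]]
      using sq[of b] sq[of "- b"] by simp
  qed
  have "covariance_matrix M (W u) (W v) = (LINT x|P. outer_product (k u x) (k v x))" if "u \<in> Z" "v \<in> Z" for u v
  proof (rule matrix_eqI_inner)
    fix a b
    show "inner a (covariance_matrix M (W u) (W v) *v b) = inner a ((LINT x|P. outer_product (k u x) (k v x)) *v b)"
      unfolding covariance_matrix_def mean[OF that(1)] mean[OF that(2)] diff_zero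
      using that by (simp add: inner_integral_outer_product integrable_outer_product W_sq k cross)
  qed
  then show ?thesis
    using W_m cont mean normal_char_imp_gaussian_variable[OF normal] prob_space_axioms
    by (auto simp: zero_mean_brownian_process_def gaussian_process_on_def)
qed

text \<open>Mean and covariance fix a Gaussian law, so any process with the prescribed covariance
  has the finite-dimensional laws of the constructed one; this opens the limit theorem to every
  realization of the limit.\<close>

lemma zero_mean_brownian_processD:
  fixes W :: "'z::topological_space \<Rightarrow> 'a \<Rightarrow> real^'s" and k :: "'z \<Rightarrow> 'x \<Rightarrow> real^'s"
  assumes B: "zero_mean_brownian_process M Z (\<lambda>z' z''. LINT x|P. outer_product (k z' x) (k z'' x)) W"
    and k: "\<And>z a. z \<in> Z \<Longrightarrow> square_integrable P (\<lambda>x. inner a (k z x))"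
    and J: "finite J" "J \<subseteq> Z"
  shows "normal_char M (\<lambda>\<omega>. \<Sum>z\<in>J. inner (a z) (W z \<omega>)) (LINT x|P. (\<Sum>z\<in>J. inner (a z) (k z x))\<^sup>2)"
proof -
  interpret prob_space M using B by (simp add: zero_mean_brownian_process_def)
  have gauss: "gaussian_variable M (\<lambda>\<omega>. \<Sum>z\<in>F. inner (b z) (W z \<omega>))" if "finite F" "F \<subseteq> Z" for F b
    using B that by (simp add: zero_mean_brownian_process_def gaussian_process_on_def)
  have single: "gaussian_variable M (\<lambda>\<omega>. inner b (W z \<omega>))" if "z \<in> Z" for z b
    using gauss[of "{z}" "\<lambda>_. b"] that by simp
  have W_sq: "square_integrable M (\<lambda>\<omega>. inner b (W z \<omega>))" if "z \<in> Z" for z b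
    using gaussian_variable_integrable(2)[OF single[OF that, of b]] single[OF that, of b, unfolded gaussian_variable_def, THEN conjunct1]
    unfolding square_integrable_def by (intro conjI)
  have W_int: "integrable M (W z)" if "z \<in> Z" for z
    by (rule integrable_inner_imp_integrable) (rule gaussian_variable_integrable(1)[OF single[OF that]])
  have mean: "expectation (W z) = 0" if "z \<in> Z" for z
    using B that by (simp add: zero_mean_brownian_process_def)
  have cov: "expectation (\<lambda>\<omega>. outer_product (W u \<omega>) (W v \<omega>)) = (LINT x|P. outer_product (k u x) (k v x))" if "u \<in> Z" "v \<in> Z" for u v
    using B that by (simp add: zero_mean_brownian_process_def covariance_matrix_def mean)
  have E: "expectation (\<lambda>\<omega>. \<Sum>z\<in>J. inner (a z) (W z \<omega>)) = 0"
    using J W_int mean by (subst Bochner_Integration.integral_sum) (auto simp: subset_eq)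
  have "expectation (\<lambda>\<omega>. (\<Sum>z\<in>J. inner (a z) (W z \<omega>))\<^sup>2) = (LINT x|P. (\<Sum>z\<in>J. inner (a z) (k z x))\<^sup>2)"
  proof -
    have "expectation (\<lambda>\<omega>. (\<Sum>z\<in>J. inner (a z) (W z \<omega>))\<^sup>2) =
        (\<Sum>i\<in>J. \<Sum>j\<in>J. inner (a i) (expectation (\<lambda>\<omega>. outer_product (W i \<omega>) (W j \<omega>)) *v a j))"
      using J by (intro integral_square_sum_inner(2) integrable_outer_product W_sq) auto
    also have "\<dots> = (\<Sum>i\<in>J. \<Sum>j\<in>J. inner (a i) ((LINT x|P. outer_product (k i x) (k j x)) *v a j))"
      using J by (intro sum.cong refl) (auto simp: cov subset_eq)
    also have "\<dots> = (LINT x|P. (\<Sum>z\<in>J. inner (a z) (k z x))\<^sup>2)"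
      using J by (intro integral_square_sum_inner(2)[symmetric] integrable_outer_product k) auto
    finally show ?thesis .
  qed
  then show ?thesis using gaussian_variable_imp_normal_char[OF gauss[OF J] E] by simp
qed

text \<open>The first conjunct realizes the limit process on the functions from
  \<open>real^'d\<close> to \<open>real^'s\<close>; the second allows an arbitrary realization over
  any type 'b. \<open>mean_exists\<close> and \<open>cov_exists\<close> give meaning to the
  expectations and to the covariance function.\<close>

theorem theorem3p1:
  fixes Z :: "(real^'d) set"
    and f1 :: "real^'d \<Rightarrow> real^'s \<Rightarrow> real"
    and f2 :: "real^'d \<Rightarrow> real^'m \<Rightarrow> real^'s"
    and M :: "'a measure"
    and XX :: "(real^'m) set"
    and P :: "(real^'m) measure"
    and X :: "'a \<Rightarrow> real^'m"
    and Xs :: "nat \<Rightarrow> 'a \<Rightarrow> real^'m"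
    and \<gamma> :: "real^'m \<Rightarrow> real"
  assumes Z: "compact Z" "Z \<noteq> {}"
    and M: "prob_space M"
    and P: "sets P = sets (restrict_space borel XX)"
    and X: "X \<in> measurable M P" "distr M P X = P"
    and sample_indep: "prob_space.indep_vars M (\<lambda>_. P) Xs {1..}"
    and sample_distr: "\<And>i. i \<ge> 1 \<Longrightarrow> distr M P (Xs i) = P"
    and mean_exists: "\<And>z. z \<in> Z \<Longrightarrow> integrable M (\<lambda>\<omega>. f2 z (X \<omega>))"
    and cov_exists: "\<And>z' z''. z' \<in> Z \<Longrightarrow> z'' \<in> Z \<Longrightarrow>
          integrable P (\<lambda>x. outer_product (f2 z' x - (LINT \<omega>|M. f2 z' (X \<omega>)))
                                           (f2 z'' x - (LINT \<omega>|M. f2 z'' (X \<omega>))))"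
    and i: "\<And>z. z \<in> Z \<Longrightarrow> f2 z \<in> borel_measurable P"
    and ii_diff: "\<And>z \<eta>. z \<in> Z \<Longrightarrow> f1 z differentiable (at \<eta>)"
    and ii_cont: "continuous_on (Z \<times> UNIV) (\<lambda>(z, \<eta>). f1 z \<eta>)"
    and ii_cont_grad: "continuous_on (Z \<times> UNIV) (\<lambda>(z, \<eta>). gradient (f1 z) \<eta>)"
    and iii_int: "integrable P \<gamma>"
    and iii_lip: "\<And>z' z'' x. z' \<in> Z \<Longrightarrow> z'' \<in> Z \<Longrightarrow> x \<in> XX \<Longrightarrow>
          norm (f2 z' x - f2 z'' x) \<le> \<gamma> x * norm (z' - z'')"
    and iii_sq: "integrable P (\<lambda>x. (\<gamma> x)\<^sup>2)"
  shows "let \<mu> = (\<lambda>z. LINT \<omega>|M. f2 z (X \<omega>));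
             \<rho> = min_value (\<lambda>z. f1 z (\<mu> z)) Z;
             \<rho>n = (\<lambda>n \<omega>. min_value (\<lambda>z. f1 z ((1 / real n) *\<^sub>R (\<Sum>i=1..n. f2 z (Xs i \<omega>)))) Z);
             Zhat = {z. is_arg_min (\<lambda>z. f1 z (\<mu> z)) (\<lambda>z. z \<in> Z) z};
             K = (\<lambda>z' z''. LINT x|P. outer_product (f2 z' x - \<mu> z') (f2 z'' x - \<mu> z''))
         in (\<exists>(N :: (real^'d \<Rightarrow> real^'s) measure) W. zero_mean_brownian_process N Z K W) \<and>
            (\<forall>(N :: 'b measure) W. zero_mean_brownian_process N Z K W \<longrightarrow>
               converges_in_distribution M (\<lambda>n \<omega>. sqrt (real n) * (\<rho>n n \<omega> - \<rho>))
                 N (\<lambda>\<omega>. min_value (\<lambda>z. inner (gradient (f1 z) (\<mu> z)) (W z \<omega>)) Zhat))"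
proof -
  interpret M: prob_space M by (rule M)
  interpret P: prob_space P using M.prob_space_distr[OF X(1)] unfolding X(2) .
  have space_P: "space P = XX" using sets_eq_imp_space_eq[OF P] by (simp add: space_restrict_space)
  define \<mu> where "\<mu> z = (LINT \<omega>|M. f2 z (X \<omega>))" for z
  define k where "k z x = f2 z x - \<mu> z" for z x
  define c where "c = (LINT x|P. \<bar>\<gamma> x\<bar>)"
  \<comment> \<open>Centring adds the Lipschitz constant c of \<mu>. The absolute value is taken
    because the Lipschitz condition does not force \<gamma> \<ge> 0 outside XX, or when Z is a
    single point.\<close>
  define L where "L x = \<bar>\<gamma> x\<bar> + c" for x
  have f2_int: "integrable P (f2 z)" and \<mu>_eq: "\<mu> z = (LINT x|P. f2 z x)" if "z \<in> Z" for z
    using integrable_distr_eq[OF X(1) i[OF that]] integral_distr[OF X(1) i[OF that]] X(2) mean_exists[OF that]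
    by (simp_all add: \<mu>_def)
  have c0: "0 \<le> c" by (simp add: c_def)
  have lip2: "norm (f2 u x - f2 v x) \<le> \<bar>\<gamma> x\<bar> * dist u v" if "u \<in> Z" "v \<in> Z" "x \<in> space P" for u v x
  proof -
    have "norm (f2 u x - f2 v x) \<le> \<gamma> x * norm (u - v)" using that space_P by (intro iii_lip) auto
    also have "\<dots> \<le> \<bar>\<gamma> x\<bar> * norm (u - v)" by (intro mult_right_mono) auto
    finally show ?thesis by (simp add: dist_norm)
  qed
  have \<mu>_lip: "norm (\<mu> u - \<mu> v) \<le> c * dist u v" if "u \<in> Z" "v \<in> Z" for u v
  proof -
    have "\<mu> u - \<mu> v = (LINT x|P. f2 u x - f2 v x)" using \<mu>_eq f2_int that by simp
    also have "norm \<dots> \<le> (LINT x|P. norm (f2 u x - f2 v x))" by (rule integral_norm_bound)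
    also have "\<dots> \<le> (LINT x|P. \<bar>\<gamma> x\<bar> * dist u v)"
      using f2_int that iii_int by (intro integral_mono lip2) auto
    finally show ?thesis by (simp add: c_def)
  qed
  have \<mu>_cont: "continuous_on Z \<mu>"
    using \<mu>_lip c0 by (intro lipschitz_on_continuous_on[of c] lipschitz_onI) (auto simp: dist_norm)
  have k_m: "k z \<in> borel_measurable P" if "z \<in> Z" for z unfolding k_def using i[OF that] by simp
  \<comment> \<open>Square integrability is read off the diagonal entries of
    \<open>cov_exists\<close> at equal arguments.\<close>
  have k_comp: "square_integrable P (\<lambda>x. k z x $ j)" if "z \<in> Z" for z j
  proof -
    have "integrable P (\<lambda>x. inner (axis j 1) (outer_product (k z x) (k z x) *v axis j 1))"
      using cov_exists[OF that that] unfolding k_def \<mu>_def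
      by (rule integrable_bounded_linear[OF bounded_linear_inner_matrix_vector])
    then show ?thesis
      using measurable_compose[OF k_m[OF that] borel_measurable_nth]
      unfolding inner_outer_product_mult[symmetric] by (simp add: square_integrable_def inner_axis' power2_eq_square)
  qed
  have k_sq: "square_integrable P (\<lambda>x. norm (k z x))" if "z \<in> Z" for z
  proof (rule square_integrable_bound)
    have "square_integrable P (\<lambda>x. \<bar>k z x $ j\<bar>)" for j
      using k_comp[OF that, of j] by (auto simp: square_integrable_def)
    then show "square_integrable P (\<lambda>x. \<Sum>j\<in>UNIV. \<bar>k z x $ j\<bar>)" by (intro square_integrable_sum)
    show "\<bar>norm (k z x)\<bar> \<le> (\<Sum>j\<in>UNIV. \<bar>k z x $ j\<bar>)" for x using norm_le_l1_cart by simp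
    show "(\<lambda>x. norm (k z x)) \<in> borel_measurable P" using k_m[OF that] by simp
  qed
  have L_sq: "square_integrable P L"
  proof -
    have "square_integrable P (\<lambda>x. \<bar>\<gamma> x\<bar>)" using iii_int iii_sq by (simp add: square_integrable_def)
    moreover have "square_integrable P (\<lambda>x. c)" by (simp add: square_integrable_def)
    ultimately show ?thesis unfolding L_def by (rule square_integrable_add)
  qed
  have k_lip: "norm (k u x - k v x) \<le> L x * dist u v" if "u \<in> Z" "v \<in> Z" "x \<in> space P" for u v x
  proof -
    have "norm (k u x - k v x) \<le> norm (f2 u x - f2 v x) + norm (\<mu> u - \<mu> v)"
      using norm_triangle_ineq4[of "f2 u x - f2 v x" "\<mu> u - \<mu> v"] by (simp add: k_def algebra_simps)
    also have "\<dots> \<le> L x * dist u v"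
      using lip2[OF that] \<mu>_lip[OF that(1,2)] by (simp add: L_def distrib_right)
    finally show ?thesis .
  qed
  have L0: "0 \<le> L x" for x using c0 by (simp add: L_def)
  interpret E: lipschitz_sample M P Xs Z k L
  proof
    show "(LINT x|P. k z x) = 0" if "z \<in> Z" for z
      unfolding k_def using f2_int[OF that] \<mu>_eq[OF that] by (simp add: P.prob_space)
  qed (use sample_indep sample_distr Z k_m k_sq L_sq L0 k_lip in auto)
  interpret C: composite_minimization Z f1 \<mu>
    by standard (use Z ii_diff ii_cont ii_cont_grad \<mu>_cont in auto)
  let ?K = "\<lambda>z' z''. LINT x|P. outer_product (k z' x) (k z'' x)"
  have exist: "\<exists>(N :: (real^'d \<Rightarrow> real^'s) measure) W. zero_mean_brownian_process N Z ?K W"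
  proof -
    \<comment> \<open>The coordinates of the sample space are indexed by \<open>real^'d\<close>,
      infinite because it is unbounded.\<close>
    have inf: "infinite (UNIV :: (real^'d) set)"
      using finite_imp_bounded[of "UNIV :: (real^'d) set"] not_bounded_UNIV[where 'a = "real^'d"] by blast
    obtain N :: "(real^'d \<Rightarrow> real^'s) measure" and W where W: "prob_space N \<and> (\<forall>z\<in>Z. W z \<in> borel_measurable N) \<and>
      (\<forall>\<omega>. continuous_on Z (\<lambda>z. W z \<omega>)) \<and>
      (\<forall>J a. finite J \<longrightarrow> J \<subseteq> Z \<longrightarrow>
        normal_char N (\<lambda>\<omega>. \<Sum>z\<in>J. inner (a z) (W z \<omega>)) (LINT x|P. (\<Sum>z\<in>J. inner (a z) (k z x))\<^sup>2))"
      by (rule continuous_gaussian_process_exists[OF Z(1) inf k_m k_sq L_sq k_lip L0, THEN exE], assumption+) (elim exE, rule that)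
    interpret N: prob_space N by (rule W[THEN conjunct1])
    note W' = W[THEN conjunct2]
    have "zero_mean_brownian_process N Z ?K W"
    proof (rule N.zero_mean_brownian_processI)
      show "W z \<in> borel_measurable N" if "z \<in> Z" for z
        using W'[THEN conjunct1] that by (rule bspec)
      show "continuous_on Z (\<lambda>z. W z \<omega>)" for \<omega>
        using W'[THEN conjunct2, THEN conjunct1] by (rule spec)
      show "normal_char N (\<lambda>\<omega>. \<Sum>z\<in>J. inner (a z) (W z \<omega>)) (LINT x|P. (\<Sum>z\<in>J. inner (a z) (k z x))\<^sup>2)"
        if "finite J" "J \<subseteq> Z" for J a
        by (rule W'[THEN conjunct2, THEN conjunct2, rule_format, OF that])
    qed (rule E.k_inner_sq)
    then show ?thesis by (intro exI)
  qed
  have conv: "converges_in_distribution M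
      (\<lambda>n \<omega>. sqrt (real n) * (min_value (\<lambda>z. f1 z ((1 / real n) *\<^sub>R (\<Sum>i=1..n. f2 z (Xs i \<omega>)))) Z - C.\<rho>))
      N (\<lambda>\<omega>. min_value (\<lambda>z. inner (C.g z) (W z \<omega>)) C.Zhat)"
    if W: "zero_mean_brownian_process N Z ?K W" for N :: "'b measure" and W
  proof -
    interpret N: prob_space N using W by (simp add: zero_mean_brownian_process_def)
    have W_m: "W z \<in> borel_measurable N" if "z \<in> Z" for z
      using W that by (simp add: zero_mean_brownian_process_def gaussian_process_on_def)
    have W_cont: "continuous_on Z (\<lambda>z. W z \<omega>)" if "\<omega> \<in> space N" for \<omega>
      using W that by (simp add: zero_mean_brownian_process_def)
    have normal: "normal_char N (\<lambda>\<omega>. \<Sum>z\<in>J. inner (a z) (W z \<omega>)) (LINT x|P. (\<Sum>z\<in>J. inner (a z) (k z x))\<^sup>2)"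
      if "finite J" "J \<subseteq> Z" for J a
      by (rule zero_mean_brownian_processD[OF W E.k_inner_sq that])
    have Xs_space: "Xs i \<omega> \<in> space P" if "i \<in> {1..n}" "\<omega> \<in> space M" for i n \<omega>
      by (rule measurable_space[OF E.Xs_m]) (use that in auto)
    have f2_cont: "continuous_on Z (\<lambda>z. f2 z x)" if "x \<in> space P" for x
      using continuous_on_add[OF E.k_continuous[OF that] \<mu>_cont] unfolding k_def diff_add_cancel .
    have f1_m: "f1 z \<in> borel_measurable borel" if "z \<in> Z" for z
    proof (rule borel_measurable_continuous_onI)
      show "continuous_on UNIV (f1 z)"
        using differentiable_imp_continuous_within[OF ii_diff[OF that]]
        by (simp add: continuous_on_eq_continuous_within)
    qed
    have Y_m: "(\<lambda>\<omega>. sqrt (real n) * (min_value (\<lambda>z. f1 z ((1 / real n) *\<^sub>R (\<Sum>i=1..n. f2 z (Xs i \<omega>)))) Z - C.\<rho>)) \<in> borel_measurable M" for n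
    proof -
      have "(\<lambda>\<omega>. min_value (\<lambda>z. f1 z ((1 / real n) *\<^sub>R (\<Sum>i=1..n. f2 z (Xs i \<omega>)))) Z) \<in> borel_measurable M"
      proof (rule borel_measurable_min_value[OF Z])
        show "(\<lambda>\<omega>. f1 z ((1 / real n) *\<^sub>R (\<Sum>i=1..n. f2 z (Xs i \<omega>)))) \<in> borel_measurable M" if "z \<in> Z" for z
        proof -
          have "(\<lambda>\<omega>. \<Sum>i=1..n. f2 z (Xs i \<omega>)) \<in> borel_measurable M"
            by (intro borel_measurable_sum measurable_compose[OF E.Xs_m i[OF that]]) auto
          then show ?thesis
            by (intro measurable_compose[OF _ f1_m[OF that]] borel_measurable_scaleR borel_measurable_const)
        qed
        show "continuous_on Z (\<lambda>z. f1 z ((1 / real n) *\<^sub>R (\<Sum>i=1..n. f2 z (Xs i \<omega>))))" if "\<omega> \<in> space M" for \<omega>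
          using Xs_space that by (intro C.continuous_on_f_compose continuous_intros f2_cont) auto
      qed
      then show ?thesis by simp
    qed
    have T_m: "(\<lambda>\<omega>. min_value (\<lambda>z. inner (C.g z) (W z \<omega>)) C.Zhat) \<in> borel_measurable N"
    proof (rule borel_measurable_min_value[OF C.compact_Zhat C.Zhat_nonempty])
      show "(\<lambda>\<omega>. inner (C.g z) (W z \<omega>)) \<in> borel_measurable N" if "z \<in> C.Zhat" for z
        using W_m that C.Zhat_subset by auto
      show "continuous_on C.Zhat (\<lambda>z. inner (C.g z) (W z \<omega>))" if "\<omega> \<in> space N" for \<omega>
        by (intro continuous_intros continuous_on_subset[OF C.cont_g C.Zhat_subset] continuous_on_subset[OF W_cont[OF that] C.Zhat_subset])
    qed
    have "weak_conv_m (\<lambda>n. distr M borel (\<lambda>\<omega>. sqrt (real n) * (min_value (\<lambda>z. f1 z ((1 / real n) *\<^sub>R (\<Sum>i=1..n. f2 z (Xs i \<omega>)))) Z - C.\<rho>)))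
        (distr N borel (\<lambda>\<omega>. min_value (\<lambda>z. inner (C.g z) (W z \<omega>)) C.Zhat))"
    proof (rule C.delta_method_weak_conv[where S = E.emp])
      show "(\<lambda>n. CLINT \<omega>|M. iexp (\<Sum>z\<in>J. inner (a z) (E.emp n z \<omega>))) \<longlonglongrightarrow> (CLINT \<omega>|N. iexp (\<Sum>z\<in>J. inner (a z) (W z \<omega>)))"
        if "finite J" "J \<subseteq> Z" for J a
      proof -
        have "(CLINT \<omega>|N. iexp (1 * (\<Sum>z\<in>J. inner (a z) (W z \<omega>)))) =
            complex_of_real (exp (- ((LINT x|P. (\<Sum>z\<in>J. inner (a z) (k z x))\<^sup>2) * 1\<^sup>2) / 2))"
          using normal[OF that, of a] unfolding normal_char_def by blast
        then show ?thesis using E.emp_fidi[OF that, of a] by simp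
      qed
      \<comment> \<open>The sample mean is \<mu> plus \<open>emp\<close> over sqrt n. This takes n
        \<ge> 1: for n = 0 the sample mean is 0 instead of \<mu>.\<close>
      show "sqrt (real n) * (min_value (\<lambda>z. f1 z ((1 / real n) *\<^sub>R (\<Sum>i=1..n. f2 z (Xs i \<omega>)))) Z - C.\<rho>) =
          sqrt n * (min_value (\<lambda>z. f1 z (\<mu> z + (1 / sqrt n) *\<^sub>R E.emp n z \<omega>)) Z - C.\<rho>)" if n: "1 \<le> n" for n \<omega>
      proof -
        have "(1 / real n) *\<^sub>R (\<Sum>i=1..n. f2 z (Xs i \<omega>)) = \<mu> z + (1 / sqrt n) *\<^sub>R E.emp n z \<omega>" for z
        proof -
          have "(1 / sqrt n) *\<^sub>R E.emp n z \<omega> = (1 / real n) *\<^sub>R (\<Sum>i=1..n. f2 z (Xs i \<omega>) - \<mu> z)"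
            using n by (simp add: E.emp_def k_def)
          also have "\<dots> = (1 / real n) *\<^sub>R (\<Sum>i=1..n. f2 z (Xs i \<omega>)) - \<mu> z"
            using n by (simp add: sum_subtractf sum_constant_scaleR scaleR_diff_right del: sum_constant)
          finally show ?thesis by simp
        qed
        then show ?thesis by simp
      qed
    qed (use Z M N.prob_space_axioms E.emp_m W_m E.emp_continuous W_cont E.emp_modulus E.emp_bounded Y_m T_m
        N.continuous_process_modulus[of Z W] N.continuous_process_bounded[of Z W] in auto)
    then show ?thesis unfolding converges_in_distribution_def using Y_m T_m by blast
  qed
  show ?thesis
    unfolding Let_def
    using exist conv unfolding k_def \<mu>_def C.\<rho>_def C.Zhat_def C.g_def by blast
qed

end
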